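(* Let $T^*S^3=\{(x,\xi)\in\mathbb{R}^4\times\mathbb{R}^4: |x|=1,\ x\cdot\xi=0\}$ with the Calabi-Yau structure $(\omega_{St},\Omega_{St})$, and let $SO(3)\subset SO(4)$ be the subgroup of matrices $\begin{pmatrix}1&0\\0&A\end{pmatrix}$, $A\in SO(3)$. Then $$L_c=\{(gx,g\xi)\ :\ (x,\xi)\in T^*S^3,\ g\in SO(3),\ x=(\cos t,\sin t,0,0),\ 2|\xi|-\cos(2t)\sinh(2|\xi|)=c\},$$ where $c$ is any real constant, is the only $SO(3)$-invariant special Lagrangian $3$-fold of $T^*S^3$.
   Context: In the definition of $L_c$, $t$ is a real parameter. $T^*S^3$ is identified with the affine quadric $Q=\{z\in\mathbb{C}^4: z_0^2+z_1^2+z_2^2+z_3^2=1\}$ by $(x,\xi)\mapsto z=x\cosh|\xi|+i\frac{\sinh|\xi|}{|\xi|}\xi$, which is $SO(4)$-equivariant for the actions $g(x,\xi)=(gx,g\xi)$ and $z\mapsto gz$. Let $|z|^2=\sum_j|z_j|^2$. Fix a constant $\kappa>0$ and let $u$ be the smooth function $$u(r^2)=\int_0^{\cosh^{-1}(r^2)}\left[\tfrac{3\kappa}{2}\left(\tfrac{\sinh(2\sigma)}{2}-\sigma\right)\right]^{1/3}d\sigma .$$ The Stenzel Ricci-flat Kähler form on $Q$ is the restriction of $\omega_{St}=i\partial\bar\partial\,u(|z|^2)$. The holomorphic volume form $\Omega_{St}$ on $Q$ is given by $\Omega_{St}(v_1,v_2,v_3)=(dz_0\wedge dz_1\wedge dz_2\wedge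 dz_3)(z,v_1,v_2,v_3)$ for $v_1,v_2,v_3\in T_zQ$. A real $3$-dimensional submanifold $L$ is special Lagrangian if $\omega_{St}|_L\equiv0$ and $\operatorname{Im}\Omega_{St}|_L\equiv0$.
   Formalization: In L_c, ξ is also taken in the plane of the first two coordinates (else L_c is 5-dimensional); L_0 is special Lagrangian off (±e_0,0), and a finite union of closed special Lagrangians; "only" means each component of an invariant one lies in some L_c, open there off those points. *)

theory Defs
  imports "HOL-Analysis.Analysis"
begin

text \<open>
  Coordinates \<open>0, 1, 2, 3\<close> of the literature are the components \<open>$1, $2, $3, $4\<close> here.
\<close>

section \<open>Submanifolds\<close>

text \<open>Only used on open sets of finite-dimensional spaces.\<close>

primrec Ck_on :: "nat \<Rightarrow> ('a::real_normed_vector \<Rightarrow> 'b::real_normed_vector) \<Rightarrow> 'a set \<Rightarrow> bool" where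
  "Ck_on 0 f S \<longleftrightarrow> continuous_on S f"
| "Ck_on (Suc k) f S \<longleftrightarrow>
     (\<forall>x\<in>S. f differentiable (at x)) \<and>
     (\<forall>v. Ck_on k (\<lambda>x. frechet_derivative f (at x) v) S)"

definition smooth_on :: "('a::real_normed_vector \<Rightarrow> 'b::real_normed_vector) \<Rightarrow> 'a set \<Rightarrow> bool" where
  "smooth_on f S \<longleftrightarrow> (\<forall>k. Ck_on k f S)"

text \<open>Embedded smooth submanifolds of real dimension 3, not necessarily closed or connected.\<close>

definition submanifold3 :: "'a::euclidean_space set \<Rightarrow> bool" where
  "submanifold3 M \<longleftrightarrow>
     (\<forall>p\<in>M. \<exists>U V (\<phi> :: real^3 \<Rightarrow> 'a) \<psi>.
        open U \<and> p \<in> U \<and> open V \<and> smooth_on \<phi> V \<and>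
        (\<forall>y\<in>V. inj (frechet_derivative \<phi> (at y))) \<and>
        homeomorphism V (M \<inter> U) \<phi> \<psi>)"

definition tangent_space :: "'a::real_normed_vector set \<Rightarrow> 'a \<Rightarrow> 'a set" where
  "tangent_space M p =
     {v. \<exists>\<gamma> \<epsilon>. \<epsilon> > 0 \<and> (\<forall>s::real. \<bar>s\<bar> < \<epsilon> \<longrightarrow> \<gamma> s \<in> M) \<and> \<gamma> 0 = p \<and>
               (\<gamma> has_vector_derivative v) (at 0)}"

section \<open>The form \<open>i \<partial> \<partial>bar f\<close>\<close>

text \<open>
  Wirtinger derivatives, taken relative to a domain \<open>D\<close>. All that is needed is that \<open>D\<close> has at
  each of its points enough directions to make the derivative unique; \<open>D\<close> need not be open.
\<close>

definition dz :: "(complex^'n) set \<Rightarrow> 'n \<Rightarrow> (complex^'n \<Rightarrow> complex) \<Rightarrow> complex^'n \<Rightarrow> complex" where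
  "dz D j f z =
     (frechet_derivative f (at z within D) (axis j 1)
      - \<i> * frechet_derivative f (at z within D) (axis j \<i>)) / 2"

definition dzbar :: "(complex^'n) set \<Rightarrow> 'n \<Rightarrow> (complex^'n \<Rightarrow> complex) \<Rightarrow> complex^'n \<Rightarrow> complex" where
  "dzbar D j f z =
     (frechet_derivative f (at z within D) (axis j 1)
      + \<i> * frechet_derivative f (at z within D) (axis j \<i>)) / 2"

definition i_ddbar ::
    "(complex^'n) set \<Rightarrow> (complex^'n \<Rightarrow> complex) \<Rightarrow> complex^'n \<Rightarrow> complex^'n \<Rightarrow> complex^'n \<Rightarrow> complex" where
  "i_ddbar D f z v w =
     \<i> * (\<Sum>j\<in>UNIV. \<Sum>k\<in>UNIV. dz D j (dzbar D k f) z * (v $ j * cnj (w $ k) - w $ j * cnj (v $ k)))"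

section \<open>The Stenzel Calabi-Yau structure\<close>

definition cotangent_S3 :: "((real^4) \<times> (real^4)) set" where
  "cotangent_S3 = {(x, \<xi>). norm x = 1 \<and> x \<bullet> \<xi> = 0}"

definition quadric :: "(complex^4) set" where
  "quadric = {z. (\<Sum>j\<in>UNIV. (z $ j)\<^sup>2) = 1}"

text \<open>For \<open>\<xi> = 0\<close> the quotient \<open>sinh \<bar>\<xi>\<bar> / \<bar>\<xi>\<bar>\<close> is \<open>0\<close>, but it only occurs multiplied by \<open>\<xi>\<close>.\<close>

definition to_quadric :: "(real^4) \<times> (real^4) \<Rightarrow> complex^4" where
  "to_quadric = (\<lambda>(x, \<xi>). \<chi> j.
     complex_of_real (x $ j * cosh (norm \<xi>))
     + \<i> * complex_of_real (sinh (norm \<xi>) / norm \<xi> * \<xi> $ j))"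

definition stenzel_u :: "real \<Rightarrow> real \<Rightarrow> real" where
  "stenzel_u \<kappa> s = integral {0..arcosh s} (\<lambda>\<sigma>. root 3 (3 * \<kappa> / 2 * (sinh (2 * \<sigma>) / 2 - \<sigma>)))"

text \<open>
  The formula for \<open>u\<close> makes sense for arguments \<open>\<ge> 1\<close> only, so the potential \<open>u(\<bar>z\<bar>\<^sup>2)\<close> lives on
  \<open>{z. \<bar>z\<bar> \<ge> 1}\<close>, which contains the quadric; the zero section \<open>S\<^sup>3\<close> lies on the
  boundary. Since \<open>u\<close> is smooth up to \<open>1\<close>, derivatives within this closed domain
  agree with those of any smooth extension.
\<close>

definition stenzel_form :: "real \<Rightarrow> complex^4 \<Rightarrow> complex^4 \<Rightarrow> complex^4 \<Rightarrow> complex" where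
  "stenzel_form \<kappa> =
     i_ddbar {z. norm z \<ge> 1} (\<lambda>z. complex_of_real (stenzel_u \<kappa> ((norm z)\<^sup>2)))"

definition stenzel_volume :: "complex^4 \<Rightarrow> complex^4 \<Rightarrow> complex^4 \<Rightarrow> complex^4 \<Rightarrow> complex" where
  "stenzel_volume z v1 v2 v3 = det (vector [z, v1, v2, v3] :: complex^4^4)"

definition special_lagrangian_quadric :: "real \<Rightarrow> (complex^4) set \<Rightarrow> bool" where
  "special_lagrangian_quadric \<kappa> N \<longleftrightarrow>
     N \<subseteq> quadric \<and> submanifold3 N \<and>
     (\<forall>z\<in>N. \<forall>v\<in>tangent_space N z. \<forall>w\<in>tangent_space N z. stenzel_form \<kappa> z v w = 0) \<and>
     (\<forall>z\<in>N. \<forall>v1\<in>tangent_space N z. \<forall>v2\<in>tangent_space N z. \<forall>v3\<in>tangent_space N z.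
        Im (stenzel_volume z v1 v2 v3) = 0)"

text \<open>\<open>T*S\<^sup>3\<close> carries the structure transported from the quadric along \<^const>\<open>to_quadric\<close>.\<close>

definition special_lagrangian :: "real \<Rightarrow> ((real^4) \<times> (real^4)) set \<Rightarrow> bool" where
  "special_lagrangian \<kappa> L \<longleftrightarrow>
     L \<subseteq> cotangent_S3 \<and> special_lagrangian_quadric \<kappa> (to_quadric ` L)"

section \<open>The group action and the family \<open>L_c\<close>\<close>

definition block_matrix :: "real^3^3 \<Rightarrow> real^4^4" where
  "block_matrix A = vector
     [vector [1, 0, 0, 0],
      vector [0, A $ 1 $ 1, A $ 1 $ 2, A $ 1 $ 3],
      vector [0, A $ 2 $ 1, A $ 2 $ 2, A $ 2 $ 3],
      vector [0, A $ 3 $ 1, A $ 3 $ 2, A $ 3 $ 3]]"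

definition SO3 :: "(real^4^4) set" where
  "SO3 = block_matrix ` {A. rotation_matrix A}"

definition SO3_invariant :: "((real^4) \<times> (real^4)) set \<Rightarrow> bool" where
  "SO3_invariant S \<longleftrightarrow> (\<forall>g\<in>SO3. \<forall>(x, \<xi>)\<in>S. (g *v x, g *v \<xi>) \<in> S)"

text \<open>
  The representative \<open>(x, \<xi>)\<close> of an orbit is taken in the plane of the first two coordinates:
  not only \<open>x = (cos t, sin t, 0, 0)\<close> but also \<open>\<xi>\<close> has vanishing last two coordinates, so that
  \<open>\<xi>\<close> is a multiple of \<open>(-sin t, cos t, 0, 0)\<close>. The orbits of these points fill the zero level of
  the \<open>SO(3)\<close> moment map. With \<open>\<xi>\<close> ranging over all of \<open>x\<^sup>\<bottom>\<close> the set would have dimension 5.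
\<close>

definition L_c :: "real \<Rightarrow> ((real^4) \<times> (real^4)) set" where
  "L_c c = {(g *v x, g *v \<xi>) | g x \<xi> t.
     g \<in> SO3 \<and> (x, \<xi>) \<in> cotangent_S3 \<and>
     x = vector [cos t, sin t, 0, 0] \<and> \<xi> $ 3 = 0 \<and> \<xi> $ 4 = 0 \<and>
     2 * norm \<xi> - cos (2 * t) * sinh (2 * norm \<xi>) = c}"

text \<open>
  The fixed points of \<open>SO(3)\<close> in the zero section. They lie in \<open>L_c 0\<close> only, and are the
  self-intersection points of \<open>L_c 0\<close>: there the zero section \<open>S\<^sup>3\<close> meets further smooth sheets.
\<close>

definition poles :: "((real^4) \<times> (real^4)) set" where
  "poles = {(axis 1 1, 0), (- axis 1 1, 0)}"

end

theory Submission
  imports Defs "HOL-Complex_Analysis.Conformal_Mappings" "HOL-Real_Asymp.Real_Asymp"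
begin

text \<open>
  The zero level of the \<open>SO(3)\<close> moment map on the quadric consists of the points \<open>(cos w, sin w e)\<close>
  with \<open>w\<close> complex and \<open>e\<close> a real unit vector. The Kaehler form vanishes on every invariant
  3-fold in it, and the holomorphic volume form restricts to \<open>(sin w)\<^sup>2 dw\<close> times the area form of the
  sphere of the \<open>e\<close>. So a curve of parameters \<open>w\<close> gives a special Lagrangian iff
  \<open>Im (2 w - sin (2 w))\<close> is constant along it. This function has no critical points except at the
  poles, where its zero set consists of three curves crossing: the zero section, and two curves
  giving the other sheets of \<open>L_c 0\<close>.

  Conversely, the Kaehler form evaluated on two orbit directions is a positive multiple of the
  moment map applied to their commutator, which puts an invariant Lagrangian into the zero level.
  The volume form evaluated on two orbit directions then shows that \<open>\<bar>c\<bar>\<close> is locally constant off the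
  poles. Hence \<open>c\<close> takes only countably many values, and it is continuous, so it is constant on
  components; these are open in \<open>L_c\<close> off the poles by invariance of domain.
\<close>

section \<open>Smooth maps\<close>

text \<open>Off the poles a point determines (w, e) only up to shifts of w by 2 pi and the exchange
  with (-w, -e). Since \<open>phase\<close> is odd, the first coordinate cos w yields the absolute
  value of Im (\<open>phase\<close> w) but no sign; \<open>Lq\<close> fixes the sign by Im w >= 0,
  and \<open>level\<close> recovers it as a continuous function. Hence the local statements about an
  invariant N concern absolute values. A component of N may run through a pole, where cos and
  \<open>phase\<close> have critical points and no local argument in w is at hand; countability of
  the values gets past the pole without any analysis there. At w = 0 the phase starts with 4 w^3 /
  3, so the zero set of its imaginary part consists of three curves meeting at angles pi / 3. The
  sheets other than the zero section are smooth because (sin t)^2 / s^2 is an analytic function of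
  s^2. The Kaehler form is u' times the flat form plus a multiple of one rank-one term: on orbit
  directions the second term vanishes, and u' > 0 then forces the moment map to be zero.\<close>

lemma Ck_on_cong:
  assumes "open S" "\<And>x. x \<in> S \<Longrightarrow> f x = g x" "Ck_on k f S"
  shows "Ck_on k g S"
  using assms(2,3)
proof (induction k arbitrary: f g)
  case 0
  then show ?case
    by (simp cong: continuous_on_cong)
next
  case (Suc k)
  have diff: "f differentiable (at x)" if "x \<in> S" for x
    using Suc.prems that by simp
  have "g differentiable (at x)" if "x \<in> S" for x
  proof -
    obtain D where "(f has_derivative D) (at x)"
      using diff[OF \<open>x \<in> S\<close>] unfolding differentiable_def by blast
    then have "(g has_derivative D) (at x)"
      by (rule has_derivative_transform_within_open[OF _ assms(1) \<open>x \<in> S\<close>]) (rule Suc.prems(1))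
    then show ?thesis
      unfolding differentiable_def by blast
  qed
  moreover have "Ck_on k (\<lambda>x. frechet_derivative g (at x) v) S" for v
  proof (rule Suc.IH)
    show "Ck_on k (\<lambda>x. frechet_derivative f (at x) v) S"
      using Suc.prems(2) by simp
    show "frechet_derivative f (at x) v = frechet_derivative g (at x) v" if "x \<in> S" for x
      using frechet_derivative_transform_within_open[OF diff[OF that] assms(1) that Suc.prems(1)] by simp
  qed
  ultimately show ?case
    by simp
qed

text \<open>Lets an explicit formula stand for \<open>frechet_derivative\<close>; the two agree at
  every point of the open set, which \<open>Ck_on_cong\<close> transfers to all higher
  derivatives.\<close>

lemma Ck_on_SucI:
  assumes "open S" "\<And>x. x \<in> S \<Longrightarrow> (f has_derivative f' x) (at x)"
    and "\<And>v. Ck_on k (\<lambda>x. f' x v) S"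
  shows "Ck_on (Suc k) f S"
proof -
  have "Ck_on k (\<lambda>x. frechet_derivative f (at x) v) S" for v
    by (rule Ck_on_cong[OF assms(1) _ assms(3)[of v]])
      (use assms(2) frechet_derivative_at in metis)
  then show ?thesis
    using assms(2) by (auto simp: differentiable_def)
qed

lemma Ck_on_SucE:
  assumes "Ck_on (Suc k) f S"
  obtains f' where "\<And>x. x \<in> S \<Longrightarrow> (f has_derivative f' x) (at x)"
    and "\<And>v. Ck_on k (\<lambda>x. f' x v) S"
  using assms that[of "\<lambda>x. frechet_derivative f (at x)"]
  by (auto simp: frechet_derivative_works)

lemma Ck_on_SucD: "Ck_on (Suc k) f S \<Longrightarrow> Ck_on k f S"
proof (induction k arbitrary: f)
  case 0
  then show ?case
    by (auto intro!: continuous_at_imp_continuous_on differentiable_imp_continuous_within)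
next
  case (Suc k)
  then show ?case
    using Ck_on.simps(2) by blast
qed

lemma Ck_on_const: "open S \<Longrightarrow> Ck_on k (\<lambda>x. c) S"
proof (induction k arbitrary: c)
  case (Suc k)
  show ?case
    by (rule Ck_on_SucI[OF Suc.prems, where f' = "\<lambda>_ _. 0"]) (auto intro: Suc)
qed auto

lemma Ck_on_bounded_linear:
  assumes "open S" "bounded_linear L" "Ck_on k f S"
  shows "Ck_on k (\<lambda>x. L (f x)) S"
  using assms(3)
proof (induction k arbitrary: f)
  case 0
  then show ?case
    using assms(2) by (simp add: bounded_linear.continuous_on)
next
  case (Suc k)
  obtain f' where f': "\<And>x. x \<in> S \<Longrightarrow> (f has_derivative f' x) (at x)"
    "\<And>v. Ck_on k (\<lambda>x. f' x v) S"
    by (rule Ck_on_SucE[OF Suc.prems]) (rule that)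
  show ?case
    by (rule Ck_on_SucI[OF assms(1), where f' = "\<lambda>x v. L (f' x v)"])
      (use f' bounded_linear.has_derivative[OF assms(2) f'(1)] Suc.IH in auto)
qed

lemma Ck_on_ident: "open S \<Longrightarrow> Ck_on k (\<lambda>x. x) S"
proof (cases k)
  case (Suc m)
  assume "open S"
  then show ?thesis
    unfolding Suc
    by (intro Ck_on_SucI[where f' = "\<lambda>_ v. v"]) (auto intro: Ck_on_const)
qed auto

lemma Ck_on_add:
  assumes "open S" "Ck_on k f S" "Ck_on k g S"
  shows "Ck_on k (\<lambda>x. f x + g x) S"
  using assms(2,3)
proof (induction k arbitrary: f g)
  case 0
  then show ?case
    by (simp add: continuous_on_add)
next
  case (Suc k)
  obtain f' where f': "\<And>x. x \<in> S \<Longrightarrow> (f has_derivative f' x) (at x)"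
    "\<And>v. Ck_on k (\<lambda>x. f' x v) S"
    by (rule Ck_on_SucE[OF Suc.prems(1)]) (rule that)
  obtain g' where g': "\<And>x. x \<in> S \<Longrightarrow> (g has_derivative g' x) (at x)"
    "\<And>v. Ck_on k (\<lambda>x. g' x v) S"
    by (rule Ck_on_SucE[OF Suc.prems(2)]) (rule that)
  show ?case
    by (rule Ck_on_SucI[OF assms(1), where f' = "\<lambda>x v. f' x v + g' x v"])
      (use f' g' has_derivative_add Suc.IH in auto)
qed

lemma Ck_on_bilinear:
  assumes "open S" "bounded_bilinear B" "Ck_on k f S" "Ck_on k g S"
  shows "Ck_on k (\<lambda>x. B (f x) (g x)) S"
  using assms(3,4)
proof (induction k arbitrary: f g)
  case 0
  then show ?case
    using assms(2) by (simp add: bounded_bilinear.continuous_on)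
next
  case (Suc k)
  obtain f' where f': "\<And>x. x \<in> S \<Longrightarrow> (f has_derivative f' x) (at x)"
    "\<And>v. Ck_on k (\<lambda>x. f' x v) S"
    by (rule Ck_on_SucE[OF Suc.prems(1)]) (rule that)
  obtain g' where g': "\<And>x. x \<in> S \<Longrightarrow> (g has_derivative g' x) (at x)"
    "\<And>v. Ck_on k (\<lambda>x. g' x v) S"
    by (rule Ck_on_SucE[OF Suc.prems(2)]) (rule that)
  show ?case
  proof (rule Ck_on_SucI[OF assms(1), where f' = "\<lambda>x v. B (f x) (g' x v) + B (f' x v) (g x)"])
    show "((\<lambda>x. B (f x) (g x)) has_derivative (\<lambda>v. B (f x) (g' x v) + B (f' x v) (g x))) (at x)"
      if "x \<in> S" for x
      using bounded_bilinear.FDERIV[OF assms(2) f'(1)[OF that] g'(1)[OF that]] .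
    show "Ck_on k (\<lambda>x. B (f x) (g' x v) + B (f' x v) (g x)) S" for v
      \<comment> \<open>The product rule pairs f with g' and f' with g, so f and g are first
        weakened from class k + 1 to class k.\<close>
      using Suc.prems[THEN Ck_on_SucD] f'(2) g'(2)
      by (intro Ck_on_add[OF assms(1)] Suc.IH)
  qed
qed

text \<open>Apart from products, all nonlinear functions enter through this chain rule: branches of
  arccos, inverses of \<open>phase\<close>, and real square roots as real parts of
  \<open>csqrt\<close>. The induction closes because the derivative of h is again
  holomorphic.\<close>

lemma Ck_on_holomorphic_compose:
  assumes "open S" "open T" "h holomorphic_on T" "Ck_on k f S" "f ` S \<subseteq> T"
  shows "Ck_on k (\<lambda>x. h (f x)) S"
  using assms(3,4,5)
proof (induction k arbitrary: h)
  case 0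
  then show ?case
    by (auto intro: continuous_on_compose2[OF holomorphic_on_imp_continuous_on])
next
  case (Suc k)
  obtain f' where f': "\<And>x. x \<in> S \<Longrightarrow> (f has_derivative f' x) (at x)"
    "\<And>v. Ck_on k (\<lambda>x. f' x v) S"
    by (rule Ck_on_SucE[OF Suc.prems(2)]) (rule that)
  show ?case
  proof (rule Ck_on_SucI[OF assms(1), where f' = "\<lambda>x v. deriv h (f x) * f' x v"])
    show "((\<lambda>x. h (f x)) has_derivative (\<lambda>v. deriv h (f x) * f' x v)) (at x)" if "x \<in> S" for x
    proof -
      have "(h has_field_derivative deriv h (f x)) (at (f x))"
        using Suc.prems(1,3) assms(2) that by (intro holomorphic_derivI) auto
      then have "(h has_derivative (*) (deriv h (f x))) (at (f x))"
        by (simp add: has_field_derivative_def)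
      then show ?thesis
        using has_derivative_compose[OF f'(1)[OF that]] by fastforce
    qed
    show "Ck_on k (\<lambda>x. deriv h (f x) * f' x v) S" for v
    proof (rule Ck_on_bilinear[OF assms(1) bounded_bilinear_mult])
      show "Ck_on k (\<lambda>x. deriv h (f x)) S"
        using Suc.prems Suc.IH[of "deriv h"] Ck_on_SucD assms(2) holomorphic_deriv by blast
      show "Ck_on k (\<lambda>x. f' x v) S"
        using f'(2) .
    qed
  qed
qed

lemma Ck_on_sum:
  assumes "open S" "\<And>i. i \<in> I \<Longrightarrow> Ck_on k (f i) S"
  shows "Ck_on k (\<lambda>x. \<Sum>i\<in>I. f i x) S"
  using assms(2)
  by (induction I rule: infinite_finite_induct) (auto intro: Ck_on_const Ck_on_add assms(1))

lemma bounded_linear_axis: "bounded_linear (axis i :: 'a::real_normed_vector \<Rightarrow> 'a^'n)"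
proof (intro bounded_linear_intro[where K = 1])
  show "axis i (x + y) = axis i x + (axis i y :: 'a^'n)" for x y
    by (simp add: axis_def vec_eq_iff)
  show "axis i (r *\<^sub>R x) = r *\<^sub>R (axis i x :: 'a^'n)" for r x
    by (simp add: axis_def vec_eq_iff)
  have "(\<Sum>j\<in>UNIV. norm ((axis i x :: 'a^'n) $ j)) = (\<Sum>j\<in>UNIV. if j = i then norm x else 0)" for x
    by (intro sum.cong) (auto simp: axis_def)
  then show "norm (axis i x :: 'a^'n) \<le> norm x * 1" for x
    using L2_set_le_sum[of UNIV "\<lambda>j. norm ((axis i x :: 'a^'n) $ j)"] by (simp add: norm_vec_def)
qed

lemma smooth_on_vec:
  fixes f :: "'a::real_normed_vector \<Rightarrow> 'b::real_normed_vector^'n"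
  assumes "open S" "\<And>i. smooth_on (\<lambda>x. f x $ i) S"
  shows "smooth_on f S"
proof -
  have f: "f = (\<lambda>x. \<Sum>i\<in>UNIV. axis i (f x $ i))"
    by (simp add: fun_eq_iff vec_eq_iff axis_def)
  have "Ck_on k (\<lambda>x. \<Sum>i\<in>UNIV. axis i (f x $ i)) S" for k
  proof (rule Ck_on_sum[OF assms(1)])
    fix i :: 'n
    have "Ck_on k (\<lambda>x. f x $ i) S"
      using assms(2)[of i] by (simp add: smooth_on_def)
    then show "Ck_on k (\<lambda>x. axis i (f x $ i)) S"
      by (rule Ck_on_bounded_linear[OF assms(1) bounded_linear_axis])
  qed
  then have "smooth_on (\<lambda>x. \<Sum>i\<in>UNIV. axis i (f x $ i)) S"
    by (simp only: smooth_on_def) simp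
  with f show ?thesis
    by (rule back_subst[of "\<lambda>g. smooth_on g S", OF _ sym, rotated])
qed

lemma smooth_on_const: "open S \<Longrightarrow> smooth_on (\<lambda>x. c) S"
  by (simp add: smooth_on_def Ck_on_const)

lemma smooth_on_ident: "open S \<Longrightarrow> smooth_on (\<lambda>x. x) S"
  by (simp add: smooth_on_def Ck_on_ident)

lemma smooth_on_bounded_linear:
  "open S \<Longrightarrow> bounded_linear L \<Longrightarrow> smooth_on f S \<Longrightarrow> smooth_on (\<lambda>x. L (f x)) S"
  by (simp add: smooth_on_def Ck_on_bounded_linear)

lemma smooth_on_add:
  "open S \<Longrightarrow> smooth_on f S \<Longrightarrow> smooth_on g S \<Longrightarrow> smooth_on (\<lambda>x. f x + g x) S"
  by (simp add: smooth_on_def Ck_on_add)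

lemma smooth_on_bilinear:
  "open S \<Longrightarrow> bounded_bilinear B \<Longrightarrow> smooth_on f S \<Longrightarrow> smooth_on g S \<Longrightarrow> smooth_on (\<lambda>x. B (f x) (g x)) S"
  by (simp add: smooth_on_def Ck_on_bilinear)

lemma smooth_on_holomorphic_compose:
  "open S \<Longrightarrow> open T \<Longrightarrow> h holomorphic_on T \<Longrightarrow> smooth_on f S \<Longrightarrow> f ` S \<subseteq> T
    \<Longrightarrow> smooth_on (\<lambda>x. h (f x)) S"
  by (simp add: smooth_on_def Ck_on_holomorphic_compose)

lemma smooth_on_cong:
  "open S \<Longrightarrow> (\<And>x. x \<in> S \<Longrightarrow> f x = g x) \<Longrightarrow> smooth_on f S \<Longrightarrow> smooth_on g S"
  unfolding smooth_on_def using Ck_on_cong by blast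

lemma smooth_on_has_derivative:
  assumes "smooth_on f S" "x \<in> S"
  shows "(f has_derivative frechet_derivative f (at x)) (at x)"
  using assms frechet_derivative_works unfolding smooth_on_def
  by (metis Ck_on.simps(2))

section \<open>The quadric and the rotation group\<close>

lemma vector_4 [simp]:
  "(vector [a, b, c, d] :: 'a::zero^4) $ 1 = a"
  "(vector [a, b, c, d] :: 'a::zero^4) $ 2 = b"
  "(vector [a, b, c, d] :: 'a::zero^4) $ 3 = c"
  "(vector [a, b, c, d] :: 'a::zero^4) $ 4 = d"
  unfolding vector_def by simp_all

lemma det_4:
  "det (A::'a::comm_ring_1^4^4) =
    A$1$1 * (A$2$2 * A$3$3 * A$4$4 + A$2$3 * A$3$4 * A$4$2 + A$2$4 * A$3$2 * A$4$3
           - A$2$2 * A$3$4 * A$4$3 - A$2$3 * A$3$2 * A$4$4 - A$2$4 * A$3$3 * A$4$2)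
  - A$1$2 * (A$2$1 * A$3$3 * A$4$4 + A$2$3 * A$3$4 * A$4$1 + A$2$4 * A$3$1 * A$4$3
           - A$2$1 * A$3$4 * A$4$3 - A$2$3 * A$3$1 * A$4$4 - A$2$4 * A$3$3 * A$4$1)
  + A$1$3 * (A$2$1 * A$3$2 * A$4$4 + A$2$2 * A$3$4 * A$4$1 + A$2$4 * A$3$1 * A$4$2
           - A$2$1 * A$3$4 * A$4$2 - A$2$2 * A$3$1 * A$4$4 - A$2$4 * A$3$2 * A$4$1)
  - A$1$4 * (A$2$1 * A$3$2 * A$4$3 + A$2$2 * A$3$3 * A$4$1 + A$2$3 * A$3$1 * A$4$2
           - A$2$1 * A$3$3 * A$4$2 - A$2$2 * A$3$1 * A$4$3 - A$2$3 * A$3$2 * A$4$1)"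
proof -
  have f1: "finite {2::4, 3, 4}" "1 \<notin> {2::4, 3, 4}"
    by auto
  have f2: "finite {3::4, 4}" "2 \<notin> {3::4, 4}"
    by auto
  have f3: "finite {4::4}" "3 \<notin> {4::4}"
    by auto
  have "det A = (\<Sum>p | p permutes {1::4, 2, 3, 4}. of_int (sign p) * (A$1$p 1 * (A$2$p 2 * (A$3$p 3 * A$4$p 4))))"
    unfolding det_def UNIV_4 by (intro sum.cong refl) (simp add: mult.assoc)
  then show ?thesis
    unfolding sum_over_permutations_insert[OF f1] sum_over_permutations_insert[OF f2]
      sum_over_permutations_insert[OF f3] permutes_sing
    by (simp add: sign_swap_id permutation_swap_id permutation_compose sign_compose sign_id swap_id_eq
        algebra_simps)
qed

text \<open>A real direction scaled by one complex number in the last three coordinates. Rotations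
  act on e alone, and points of the zero level and their tangent vectors have this shape or are sums
  of two such vectors.\<close>

definition cvec :: "complex \<Rightarrow> complex \<Rightarrow> real^3 \<Rightarrow> complex^4" where
  "cvec a b e = vector [a, b * of_real (e $ 1), b * of_real (e $ 2), b * of_real (e $ 3)]"

lemma cvec_nth [simp]:
  "cvec a b e $ 1 = a"
  "cvec a b e $ 2 = b * of_real (e $ 1)"
  "cvec a b e $ 3 = b * of_real (e $ 2)"
  "cvec a b e $ 4 = b * of_real (e $ 3)"
  by (simp_all add: cvec_def)

lemma cvec_eq_iff:
  "cvec a b e = z \<longleftrightarrow>
     a = z $ 1 \<and> b * of_real (e $ 1) = z $ 2 \<and> b * of_real (e $ 2) = z $ 3 \<and> b * of_real (e $ 3) = z $ 4"
  by (simp add: vec_eq_iff forall_4)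

lemma cvec_uminus: "cvec a (- b) (- e) = cvec a b e"
  by (simp add: cvec_eq_iff)

definition rot :: "real^3^3 \<Rightarrow> complex^4 \<Rightarrow> complex^4" where
  "rot A z = (\<chi> i. \<Sum>j\<in>UNIV. of_real (block_matrix A $ i $ j) * z $ j)"

lemma rot_nth [simp]:
  "rot A z $ 1 = z $ 1"
  "rot A z $ 2 = of_real (A$1$1) * z$2 + of_real (A$1$2) * z$3 + of_real (A$1$3) * z$4"
  "rot A z $ 3 = of_real (A$2$1) * z$2 + of_real (A$2$2) * z$3 + of_real (A$2$3) * z$4"
  "rot A z $ 4 = of_real (A$3$1) * z$2 + of_real (A$3$2) * z$3 + of_real (A$3$3) * z$4"
  by (simp_all add: rot_def block_matrix_def sum_4)

lemma rot_cvec: "rot A (cvec a b e) = cvec a b (A *v e)"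
  by (simp add: vec_eq_iff forall_4 matrix_vector_mult_def sum_3 algebra_simps)

definition spatial :: "real^4 \<Rightarrow> real^3" where
  "spatial x = vector [x$2, x$3, x$4]"

lemma spatial_nth [simp]: "spatial x $ 1 = x $ 2" "spatial x $ 2 = x $ 3" "spatial x $ 3 = x $ 4"
  by (simp_all add: spatial_def)

lemma block_matrix_mult_nth:
  "(block_matrix A *v x) $ 1 = x $ 1"
  "(block_matrix A *v x) $ 2 = (A *v spatial x) $ 1"
  "(block_matrix A *v x) $ 3 = (A *v spatial x) $ 2"
  "(block_matrix A *v x) $ 4 = (A *v spatial x) $ 3"
  by (simp_all add: block_matrix_def matrix_vector_mult_def sum_4 sum_3)

lemma matrix_vector_mult_3: "(A *v v) $ i = A$i$1 * v$1 + A$i$2 * v$2 + A$i$3 * (v::real^3)$3"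
  by (simp add: matrix_vector_mult_def sum_3)

lemma spatial_block_matrix: "spatial (block_matrix A *v x) = A *v spatial x"
  by (simp add: vec_eq_iff forall_3 block_matrix_mult_nth)

lemma inner_spatial: "x \<bullet> y = x $ 1 * y $ 1 + spatial x \<bullet> spatial y"
  by (simp add: inner_vec_def sum_4 sum_3)

lemma rotation_inner: "rotation_matrix A \<Longrightarrow> (A *v x) \<bullet> (A *v y) = x \<bullet> (y :: real^'n)"
  using orthogonal_transformation_matrix[of "(*v) A"]
  by (simp add: rotation_matrix_def orthogonal_transformation_def)

lemma block_matrix_inner:
  assumes "rotation_matrix A"
  shows "(block_matrix A *v x) \<bullet> (block_matrix A *v y) = x \<bullet> y"
  by (simp add: inner_spatial[of _ "block_matrix A *v y"] spatial_block_matrix rotation_inner[OF assms]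
      block_matrix_mult_nth inner_spatial[of x y])

lemma block_matrix_norm: "rotation_matrix A \<Longrightarrow> norm (block_matrix A *v x) = norm x"
  by (simp add: norm_eq_sqrt_inner block_matrix_inner)

lemma block_matrix_mult: "block_matrix A ** block_matrix B = block_matrix (A ** B)"
  by (simp add: vec_eq_iff forall_4 forall_3 block_matrix_def matrix_matrix_mult_def sum_4 sum_3)

lemma rotation_matrix_mult:
  "rotation_matrix A \<Longrightarrow> rotation_matrix B \<Longrightarrow> rotation_matrix (A ** B :: real^'n^'n)"
  by (simp add: rotation_matrix_def orthogonal_matrix_mul det_mul)

lemma SO3_mult: "g \<in> SO3 \<Longrightarrow> h \<in> SO3 \<Longrightarrow> g ** h \<in> SO3"
  by (auto simp: SO3_def block_matrix_mult intro!: imageI rotation_matrix_mult)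

lemma cotangent_S3_block_matrix:
  "rotation_matrix A \<Longrightarrow> (x, \<xi>) \<in> cotangent_S3 \<Longrightarrow>
     (block_matrix A *v x, block_matrix A *v \<xi>) \<in> cotangent_S3"
  by (simp add: cotangent_S3_def block_matrix_norm block_matrix_inner)

lemma to_quadric_nth:
  "to_quadric (x, \<xi>) $ j =
     Complex (cosh (norm \<xi>) * x $ j) (sinh (norm \<xi>) / norm \<xi> * \<xi> $ j)"
  by (simp add: to_quadric_def complex_eq_iff mult.commute)

lemma to_quadric_block_matrix:
  assumes "rotation_matrix A"
  shows "to_quadric (block_matrix A *v x, block_matrix A *v \<xi>) = rot A (to_quadric (x, \<xi>))"
  by (simp add: vec_eq_iff forall_4 to_quadric_nth block_matrix_norm[OF assms] block_matrix_mult_nth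
      matrix_vector_mult_3 complex_eq_iff algebra_simps add_divide_distrib)

lemma SO3_invariant_L_c: "SO3_invariant (L_c c)"
  unfolding SO3_invariant_def L_c_def
proof (intro ballI, clarify)
  fix h g x \<xi> t
  assume "h \<in> SO3" "g \<in> SO3" "((vector [cos t, sin t, 0, 0] :: real^4), \<xi>) \<in> cotangent_S3" "\<xi> $ 3 = 0" "\<xi> $ 4 = 0"
    "c = 2 * norm \<xi> - cos (2 * t) * sinh (2 * norm \<xi>)"
  then show "\<exists>g' x' \<xi>' t'. (h *v (g *v vector [cos t, sin t, 0, 0]), h *v (g *v \<xi>)) = (g' *v x', g' *v \<xi>') \<and>
     g' \<in> SO3 \<and> (x', \<xi>') \<in> cotangent_S3 \<and> x' = vector [cos t', sin t', 0, 0] \<and>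
     \<xi>' $ 3 = 0 \<and> \<xi>' $ 4 = 0 \<and>
     2 * norm \<xi>' - cos (2 * t') * sinh (2 * norm \<xi>') = 2 * norm \<xi> - cos (2 * t) * sinh (2 * norm \<xi>)"
    by (intro exI[of _ "h ** g"] exI[of _ "vector [cos t, sin t, 0, 0]"] exI[of _ \<xi>] exI[of _ t])
      (simp add: SO3_mult matrix_vector_mul_assoc)
qed

section \<open>The inverse of the identification with the quadric\<close>

definition re_vec :: "complex^4 \<Rightarrow> real^4" where "re_vec z = (\<chi> j. Re (z $ j))"
definition im_vec :: "complex^4 \<Rightarrow> real^4" where "im_vec z = (\<chi> j. Im (z $ j))"

lemma re_vec_nth [simp]: "re_vec z $ j = Re (z $ j)" and im_vec_nth [simp]: "im_vec z $ j = Im (z $ j)"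
  by (simp_all add: re_vec_def im_vec_def)

lemma quadric_iff:
  "z \<in> quadric \<longleftrightarrow> re_vec z \<bullet> re_vec z - im_vec z \<bullet> im_vec z = 1 \<and> re_vec z \<bullet> im_vec z = 0"
  by (simp add: quadric_def complex_eq_iff inner_vec_def sum_4 power2_eq_square) (auto simp: algebra_simps)

lemma to_quadric_parts:
  "re_vec (to_quadric (x, \<xi>)) = cosh (norm \<xi>) *\<^sub>R x"
  "im_vec (to_quadric (x, \<xi>)) = (sinh (norm \<xi>) / norm \<xi>) *\<^sub>R \<xi>"
  by (simp_all add: vec_eq_iff to_quadric_nth)

lemma norm_im_to_quadric: "norm (im_vec (to_quadric (x, \<xi>))) = sinh (norm \<xi>)"
  by (simp add: to_quadric_parts)

text \<open>On the image of \<open>to_quadric\<close> the real and imaginary parts have norms cosh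
  |xi| and sinh |xi|, which gives the scaling factors. Where the imaginary part is 0 the quotient is
  0 / 0 = 0 and multiplies the zero vector.\<close>

definition from_quadric :: "complex^4 \<Rightarrow> (real^4) \<times> (real^4)" where
  "from_quadric z = (re_vec z /\<^sub>R norm (re_vec z), (arsinh (norm (im_vec z)) / norm (im_vec z)) *\<^sub>R im_vec z)"

text \<open>The coefficient may jump at 0, where division by zero makes it 0, but the product with x
  has norm |g(|x|)|, and that tends to g 0 = 0. This covers sinh for \<open>to_quadric\<close> and
  arsinh for its inverse.\<close>

lemma continuous_on_radial:
  fixes g :: "real \<Rightarrow> real"
  assumes "continuous_on UNIV g" "g 0 = 0"
  shows "continuous_on UNIV (\<lambda>x::'a::real_normed_vector. (g (norm x) / norm x) *\<^sub>R x)"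
proof -
  have g: "isCont g x" for x
    using assms(1) by (simp add: continuous_on_eq_continuous_at)
  have "isCont (\<lambda>x::'a. (g (norm x) / norm x) *\<^sub>R x) y" for y
  proof (cases "y = 0")
    case False
    then show ?thesis
      by (intro continuous_intros isCont_o2[OF _ g]) auto
  next
    case True
    have "((\<lambda>x::'a. g (norm x)) \<longlongrightarrow> g 0) (at 0)"
      by (rule isCont_tendsto_compose[OF g]) (rule tendsto_norm_zero[OF tendsto_ident_at])
    then have lim: "((\<lambda>x::'a. \<bar>g (norm x)\<bar>) \<longlongrightarrow> 0) (at 0)"
      unfolding assms(2) by (rule tendsto_rabs_zero)
    have "((\<lambda>x::'a. (g (norm x) / norm x) *\<^sub>R x) \<longlongrightarrow> 0) (at 0)"
      by (rule Lim_null_comparison[OF _ lim]) (simp add: eventually_at_filter)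
    then show ?thesis
      by (simp add: True isCont_def)
  qed
  then show ?thesis
    by (simp add: continuous_at_imp_continuous_on)
qed

lemma continuous_on_re_vec: "continuous_on S re_vec" and continuous_on_im_vec: "continuous_on S im_vec"
  unfolding re_vec_def im_vec_def by (intro continuous_intros)+

lemma continuous_on_to_quadric: "continuous_on UNIV to_quadric"
proof -
  have "continuous_on UNIV (\<lambda>x::real^4. (sinh (norm x) / norm x) *\<^sub>R x)"
    by (rule continuous_on_radial) (auto intro: continuous_intros)
  then have 1: "continuous_on UNIV (\<lambda>p::(real^4)\<times>(real^4). (sinh (norm (snd p)) / norm (snd p)) *\<^sub>R snd p)"
    by (rule continuous_on_compose2) (auto intro: continuous_intros)
  have eq: "to_quadric = (\<lambda>p. \<chi> j. of_real (fst p $ j * cosh (norm (snd p)))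
      + \<i> * of_real (((sinh (norm (snd p)) / norm (snd p)) *\<^sub>R snd p) $ j))"
    by (auto simp: to_quadric_def fun_eq_iff)
  show ?thesis
    unfolding eq by (intro continuous_intros continuous_on_component[OF 1])
qed

lemma re_vec_quadric_nonzero: "z \<in> quadric \<Longrightarrow> re_vec z \<noteq> 0"
  by (auto simp: quadric_iff) (smt (verit) inner_ge_zero)

lemma continuous_on_from_quadric: "continuous_on quadric from_quadric"
proof -
  have "continuous_on UNIV (\<lambda>x::real^4. (arsinh (norm x) / norm x) *\<^sub>R x)"
    by (rule continuous_on_radial) (auto intro!: continuous_intros)
  then have "continuous_on quadric (\<lambda>z. (arsinh (norm (im_vec z)) / norm (im_vec z)) *\<^sub>R im_vec z)"
    by (rule continuous_on_compose2) (auto intro: continuous_on_im_vec)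
  moreover have "continuous_on quadric (\<lambda>z. re_vec z /\<^sub>R norm (re_vec z))"
    by (intro continuous_intros continuous_on_re_vec) (auto dest: re_vec_quadric_nonzero)
  ultimately show ?thesis
    unfolding from_quadric_def by (intro continuous_on_Pair)
qed

lemma to_quadric_in_quadric: "p \<in> cotangent_S3 \<Longrightarrow> to_quadric p \<in> quadric"
proof -
  assume p: "p \<in> cotangent_S3"
  obtain x \<xi> where [simp]: "p = (x, \<xi>)" by (cases p)
  have x: "x \<bullet> x = 1" "x \<bullet> \<xi> = 0"
    using p by (auto simp: cotangent_S3_def norm_eq_1)
  have "re_vec (to_quadric p) \<bullet> re_vec (to_quadric p) = (cosh (norm \<xi>))\<^sup>2"
    using x by (simp add: to_quadric_parts power2_eq_square)
  moreover have "im_vec (to_quadric p) \<bullet> im_vec (to_quadric p) = (sinh (norm \<xi>))\<^sup>2"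
    by (simp add: dot_square_norm norm_im_to_quadric)
  ultimately show "to_quadric p \<in> quadric"
    using x by (simp add: quadric_iff cosh_square_eq to_quadric_parts)
qed

lemma from_to_quadric: "p \<in> cotangent_S3 \<Longrightarrow> from_quadric (to_quadric p) = p"
proof -
  assume p: "p \<in> cotangent_S3"
  obtain x \<xi> where [simp]: "p = (x, \<xi>)" by (cases p)
  have "norm x = 1"
    using p by (auto simp: cotangent_S3_def)
  then show ?thesis
    by (simp add: from_quadric_def to_quadric_parts arsinh_sinh_real)
qed

lemma to_from_quadric:
  assumes "z \<in> quadric"
  shows "from_quadric z \<in> cotangent_S3" "to_quadric (from_quadric z) = z"
proof -
  define x where "x = re_vec z"
  define y where "y = im_vec z"
  have xy: "x \<bullet> x - y \<bullet> y = 1" "x \<bullet> y = 0" "x \<noteq> 0"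
    using assms re_vec_quadric_nonzero[OF assms] by (auto simp: quadric_iff x_def y_def)
  then show "from_quadric z \<in> cotangent_S3"
    by (simp add: from_quadric_def cotangent_S3_def x_def[symmetric] y_def[symmetric])
  have "norm x = sqrt (1 + (norm y)\<^sup>2)"
    using xy by (simp add: norm_eq_sqrt_inner[of x] power2_norm_eq_inner)
  then have c: "cosh (arsinh (norm y)) = norm x"
    by (simp add: cosh_arsinh_real add.commute)
  have n: "norm ((arsinh (norm y) / norm y) *\<^sub>R y) = arsinh (norm y)"
    using arsinh_real_neg_iff[of "norm y"] by (simp add: not_less[symmetric])
  have "re_vec (to_quadric (from_quadric z)) = x"
    unfolding from_quadric_def to_quadric_parts x_def[symmetric] y_def[symmetric] n c
    using xy by simp
  moreover have "im_vec (to_quadric (from_quadric z)) = y"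
    unfolding from_quadric_def to_quadric_parts x_def[symmetric] y_def[symmetric] n
    by simp
  ultimately show "to_quadric (from_quadric z) = z"
    by (simp add: vec_eq_iff complex_eq_iff x_def y_def)
qed

section \<open>The Stenzel form\<close>

lemma sinh_gt_self:
  fixes x :: real
  assumes "x > 0"
  shows "x < sinh x"
proof -
  have "(\<lambda>x. sinh x - x) 0 < (\<lambda>x. sinh x - x) x"
  proof (rule DERIV_pos_imp_increasing_open[OF assms])
    fix y :: real
    assume "0 < y"
    then have "cosh y - 1 > 0"
      using cosh_real_ge_1[of y] cosh_real_one_iff[of y] by linarith
    moreover have "((\<lambda>x. sinh x - x) has_real_derivative cosh y - 1) (at y)"
      by (auto intro!: derivative_eq_intros)
    ultimately show "\<exists>D. ((\<lambda>x. sinh x - x) has_real_derivative D) (at y) \<and> D > 0"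
      by blast
  qed (auto intro!: continuous_intros)
  then show ?thesis
    by simp
qed

definition stenzel_integrand :: "real \<Rightarrow> real \<Rightarrow> real" where
  "stenzel_integrand \<kappa> \<sigma> = root 3 (3 * \<kappa> / 2 * (sinh (2 * \<sigma>) / 2 - \<sigma>))"

text \<open>The chain rule with arcosh' (s) = 1 / sinh (arcosh s). At s = 1 the quotient is 0 / 0;
  since 3/2 (sinh (2 r) / 2 - r) = r^3 + ..., its limit is the cube root of kappa.\<close>

definition stenzel_u' :: "real \<Rightarrow> real \<Rightarrow> real" where
  "stenzel_u' \<kappa> s = (if s = 1 then root 3 \<kappa> else stenzel_integrand \<kappa> (arcosh s) / sinh (arcosh s))"

text \<open>Splitting off kappa leaves limits without parameters for
  \<open>real_asymp\<close>.\<close>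

lemma stenzel_integrand_factor:
  "stenzel_integrand \<kappa> \<sigma> = root 3 \<kappa> * root 3 (3 / 2 * (sinh (2 * \<sigma>) / 2 - \<sigma>))"
  unfolding stenzel_integrand_def real_root_mult[symmetric] by (simp add: field_simps)

lemma stenzel_integrand_pos: "\<kappa> > 0 \<Longrightarrow> \<sigma> > 0 \<Longrightarrow> stenzel_integrand \<kappa> \<sigma> > 0"
  using sinh_gt_self[of "2 * \<sigma>"] by (simp add: stenzel_integrand_def)

lemma stenzel_u'_pos: "\<kappa> > 0 \<Longrightarrow> s \<ge> 1 \<Longrightarrow> stenzel_u' \<kappa> s > 0"
  using arcosh_real_gt_1_iff[of s] by (auto simp: stenzel_u'_def stenzel_integrand_pos)

lemma continuous_stenzel_integrand: "continuous_on S (stenzel_integrand \<kappa>)"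
  unfolding stenzel_integrand_def by (intro continuous_intros) simp

lemma filterlim_arcosh_at_right_1: "filterlim arcosh (at_right 0) (at_right (1::real))"
  unfolding filterlim_at
  by (intro conjI tendsto_arcosh_at_left_1 eventually_at_right_less[THEN eventually_mono]) simp_all

lemma stenzel_u'_tendsto_1: "(stenzel_u' \<kappa> \<longlongrightarrow> root 3 \<kappa>) (at_right 1)"
proof -
  have "((\<lambda>\<sigma>::real. root 3 (3 / 2 * (sinh (2 * \<sigma>) / 2 - \<sigma>)) / sinh \<sigma>) \<longlongrightarrow> 1) (at_right 0)"
    by real_asymp
  from tendsto_mult_left[OF this, of "root 3 \<kappa>"]
  have "((\<lambda>\<sigma>. stenzel_integrand \<kappa> \<sigma> / sinh \<sigma>) \<longlongrightarrow> root 3 \<kappa>) (at_right 0)"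
    unfolding stenzel_integrand_factor times_divide_eq_right[symmetric] by (simp only: mult_1_right)
  then have "((\<lambda>s. stenzel_integrand \<kappa> (arcosh s) / sinh (arcosh s)) \<longlongrightarrow> root 3 \<kappa>) (at_right 1)"
    using filterlim_compose filterlim_arcosh_at_right_1 by blast
  then show ?thesis
    by (rule Lim_transform_eventually) (auto simp: stenzel_u'_def eventually_at_filter)
qed

lemma stenzel_u_has_derivative_gt:
  assumes "s > 1"
  shows "(stenzel_u \<kappa> has_real_derivative stenzel_u' \<kappa> s) (at s)"
proof -
  have pos: "0 < arcosh s"
    using assms arcosh_real_gt_1_iff[of s] by simp
  have "((\<lambda>t. integral {0..t} (stenzel_integrand \<kappa>)) has_real_derivative stenzel_integrand \<kappa> (arcosh s))
      (at (arcosh s) within {0..arcosh s + 1})"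
    using pos by (intro integral_has_real_derivative continuous_stenzel_integrand) auto
  moreover have "at (arcosh s) within {0..arcosh s + 1} = at (arcosh s)"
    using pos by (intro at_within_interior) (simp add: interior_atLeastAtMost_real)
  ultimately have "((\<lambda>t. integral {0..t} (stenzel_integrand \<kappa>)) has_real_derivative
      stenzel_integrand \<kappa> (arcosh s)) (at (arcosh s))"
    by simp
  from DERIV_chain2[OF this arcosh_real_has_field_derivative[OF assms]]
  have "((\<lambda>s. integral {0..arcosh s} (stenzel_integrand \<kappa>)) has_real_derivative
      stenzel_integrand \<kappa> (arcosh s) * (1 / sqrt (s\<^sup>2 - 1))) (at s)"
    by simp
  then show ?thesis
    using assms sinh_arcosh_real[of s]
    by (simp add: stenzel_u_def[abs_def] stenzel_integrand_def[abs_def] stenzel_u'_def)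
qed

lemma stenzel_u_has_derivative:
  assumes "s \<ge> 1"
  shows "(stenzel_u \<kappa> has_real_derivative stenzel_u' \<kappa> s) (at s within {1..})"
proof (cases "s = 1")
  case False
  then show ?thesis
    using stenzel_u_has_derivative_gt[of s \<kappa>] assms by (simp add: has_field_derivative_at_within)
next
  case True
  have u1: "stenzel_u \<kappa> 1 = 0"
    by (simp add: stenzel_u_def)
  have "continuous_on {0..2} (\<lambda>t. integral {0..t} (stenzel_integrand \<kappa>))"
    by (intro indefinite_integral_continuous_1 integrable_continuous_real continuous_stenzel_integrand)
  then have "((\<lambda>t. integral {0..t} (stenzel_integrand \<kappa>)) \<longlongrightarrow> integral {0..0} (stenzel_integrand \<kappa>))
      (at 0 within {0..2})"
    unfolding continuous_on by (rule bspec) simp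
  then have "((\<lambda>t. integral {0..t} (stenzel_integrand \<kappa>)) \<longlongrightarrow> 0) (at_right 0)"
    by (simp add: at_within_Icc_at_right)
  from filterlim_compose[OF this filterlim_arcosh_at_right_1]
  have lim: "(stenzel_u \<kappa> \<longlongrightarrow> 0) (at_right 1)"
    by (simp add: stenzel_u_def[abs_def] stenzel_integrand_def[abs_def])
  have "((\<lambda>s. stenzel_u \<kappa> s / (s - 1)) \<longlongrightarrow> root 3 \<kappa>) (at_right 1)"
  proof (rule lhopital_right[OF lim])
    show "((\<lambda>s::real. s - 1) \<longlongrightarrow> 0) (at_right 1)"
      by (auto intro: tendsto_eq_intros)
    show "\<forall>\<^sub>F s in at_right 1. (stenzel_u \<kappa> has_real_derivative stenzel_u' \<kappa> s) (at s)"
      by (rule eventually_mono[OF eventually_at_right_less stenzel_u_has_derivative_gt])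
    show "\<forall>\<^sub>F s in at_right 1. ((\<lambda>s::real. s - 1) has_real_derivative 1) (at s)"
      by (auto intro!: always_eventually derivative_eq_intros)
    show "((\<lambda>s. stenzel_u' \<kappa> s / 1) \<longlongrightarrow> root 3 \<kappa>) (at_right 1)"
      using stenzel_u'_tendsto_1 by simp
  qed (auto simp: eventually_at_filter)
  then show ?thesis
    by (simp add: True has_field_derivative_iff at_within_Ici_at_right u1 stenzel_u'_def)
qed

lemma stenzel_u'_differentiable:
  assumes "s \<ge> 1"
  shows "\<exists>D. (stenzel_u' \<kappa> has_real_derivative D) (at s within {1..})"
proof (cases "s = 1")
  case True
  \<comment> \<open>With s = cosh r, the quotient in the numerator is 1 - r^2 / 10 + ... and cosh r
    - 1 = r^2 / 2 + ..., which gives -1/5.\<close>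
  have "((\<lambda>\<sigma>::real. (root 3 (3 / 2 * (sinh (2 * \<sigma>) / 2 - \<sigma>)) / sinh \<sigma> - 1) / (cosh \<sigma> - 1)) \<longlongrightarrow> - 1 / 5)
      (at_right 0)"
    by real_asymp
  then have "((\<lambda>\<sigma>. root 3 \<kappa> * ((root 3 (3 / 2 * (sinh (2 * \<sigma>) / 2 - \<sigma>)) / sinh \<sigma> - 1) / (cosh \<sigma> - 1)))
      \<longlongrightarrow> root 3 \<kappa> * (- 1 / 5)) (at_right 0)"
    by (rule tendsto_mult_left)
  moreover have "root 3 \<kappa> * ((root 3 (3 / 2 * (sinh (2 * \<sigma>) / 2 - \<sigma>)) / sinh \<sigma> - 1) / (cosh \<sigma> - 1))
      = (stenzel_integrand \<kappa> \<sigma> / sinh \<sigma> - root 3 \<kappa>) / (cosh \<sigma> - 1)" for \<sigma>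
    unfolding stenzel_integrand_factor by (simp add: right_diff_distrib)
  ultimately have "((\<lambda>\<sigma>. (stenzel_integrand \<kappa> \<sigma> / sinh \<sigma> - root 3 \<kappa>) / (cosh \<sigma> - 1))
      \<longlongrightarrow> root 3 \<kappa> * (- 1 / 5)) (at_right 0)"
    by (simp only:)
  from filterlim_compose[OF this filterlim_arcosh_at_right_1]
  have "((\<lambda>s. (stenzel_u' \<kappa> s - stenzel_u' \<kappa> 1) / (s - 1)) \<longlongrightarrow> root 3 \<kappa> * (- 1 / 5)) (at_right 1)"
    by (rule Lim_transform_eventually) (auto simp: stenzel_u'_def eventually_at_filter)
  then show ?thesis
    by (auto simp: True has_field_derivative_iff at_within_Ici_at_right)
next
  case False
  with assms have "s > 1"
    by simp
  then have pos: "0 < arcosh s"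
    using arcosh_real_gt_1_iff[of s] by simp
  have "0 < 3 / 2 * (sinh (2 * arcosh s) / 2 - arcosh s)"
    using sinh_gt_self[of "2 * arcosh s"] pos by simp
  then have "(\<lambda>s. root 3 \<kappa> * root 3 (3 / 2 * (sinh (2 * arcosh s) / 2 - arcosh s)) / sinh (arcosh s))
      field_differentiable (at s)"
    using pos \<open>s > 1\<close> unfolding field_differentiable_def
    by (intro exI) (rule derivative_eq_intros refl | simp)+
  then obtain D where D: "((\<lambda>s. stenzel_integrand \<kappa> (arcosh s) / sinh (arcosh s)) has_real_derivative D) (at s)"
    unfolding stenzel_integrand_factor field_differentiable_def by blast
  have "(stenzel_u' \<kappa> has_real_derivative D) (at s)"
    by (rule has_field_derivative_transform_within_open[OF D, of "{1<..}"]) (use \<open>s > 1\<close> in \<open>auto simp: stenzel_u'_def\<close>)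
  then show ?thesis
    using has_field_derivative_at_within by blast
qed

lemma has_derivative_radial:
  fixes U :: "real \<Rightarrow> real" and z :: "complex^'n"
  assumes "norm z \<ge> 1" "(U has_real_derivative D) (at ((norm z)\<^sup>2) within {1..})"
  shows "((\<lambda>z. U ((norm z)\<^sup>2)) has_derivative (\<lambda>v. D * (2 * (z \<bullet> v)))) (at z within {z. norm z \<ge> 1})"
proof -
  have "((\<lambda>z. (norm z)\<^sup>2) has_derivative (\<lambda>v. 2 * (z \<bullet> v))) (at z within {z. norm z \<ge> 1})"
    unfolding power2_norm_eq_inner by (auto intro!: derivative_eq_intros simp: inner_commute)
  moreover have "(\<lambda>z::complex^'n. (norm z)\<^sup>2) ` {z. norm z \<ge> 1} \<subseteq> {1..}"
    by auto
  then have "(U has_derivative (*) D) (at ((norm z)\<^sup>2) within (\<lambda>z. (norm z)\<^sup>2) ` {z::complex^'n. norm z \<ge> 1})"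
    using assms(2) has_derivative_subset unfolding has_field_derivative_def by blast
  ultimately show ?thesis
    by (rule has_derivative_in_compose)
qed

text \<open>Derivatives within a set are unique if every coordinate direction admits arbitrarily
  short steps inside the set. Even on the boundary sphere one of the two signs works: stepping along
  i with the sign of the inner product of z and i increases the norm.\<close>

lemma frechet_derivative_outside_ball:
  fixes f :: "'a::euclidean_space \<Rightarrow> 'b::real_normed_vector"
  assumes "norm z \<ge> 1" "(f has_derivative f') (at z within {z. norm z \<ge> 1})"
  shows "frechet_derivative f (at z within {z. norm z \<ge> 1}) = f'"
proof (rule frechet_derivative_unique_within)
  show "(f has_derivative frechet_derivative f (at z within {z. norm z \<ge> 1})) (at z within {z. norm z \<ge> 1})"
    using assms(2) by (auto simp: frechet_derivative_works[symmetric] differentiable_def)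
  fix i :: 'a and e :: real
  assume "i \<in> Basis" "0 < e"
  define d where "d = (if z \<bullet> i \<ge> 0 then e / 2 else - e / 2)"
  have "(norm (z + d *\<^sub>R i))\<^sup>2 = (norm z)\<^sup>2 + 2 * (d * (z \<bullet> i)) + d\<^sup>2"
    using \<open>i \<in> Basis\<close> unfolding power2_norm_eq_inner
    by (simp add: inner_add_left inner_add_right inner_commute power2_eq_square)
  moreover have "d * (z \<bullet> i) \<ge> 0"
    using \<open>0 < e\<close> by (auto simp: d_def mult_nonneg_nonpos)
  ultimately have "1\<^sup>2 \<le> (norm (z + d *\<^sub>R i))\<^sup>2"
    using power_mono[OF assms(1), of 2] zero_le_power2[of d] by linarith
  then have "norm (z + d *\<^sub>R i) \<ge> 1"
    by (rule power2_le_imp_le) simp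
  then show "\<exists>d. 0 < \<bar>d\<bar> \<and> \<bar>d\<bar> < e \<and> z + d *\<^sub>R i \<in> {z. norm z \<ge> 1}"
    using \<open>0 < e\<close> by (intro exI[of _ d]) (auto simp: d_def)
qed (rule assms)

lemma inner_axis_complex:
  fixes z :: "complex^'n"
  shows "z \<bullet> axis j 1 = Re (z $ j)" "z \<bullet> axis j \<i> = Im (z $ j)"
  by (simp_all add: inner_axis inner_complex_def)

lemma dzbar_stenzel:
  assumes "norm z \<ge> 1"
  shows "dzbar {z. norm z \<ge> 1} k (\<lambda>z. complex_of_real (stenzel_u \<kappa> ((norm z)\<^sup>2))) z
    = of_real (stenzel_u' \<kappa> ((norm z)\<^sup>2)) * z $ k"
proof -
  have "((\<lambda>z. complex_of_real (stenzel_u \<kappa> ((norm z)\<^sup>2))) has_derivative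
     (\<lambda>v. of_real (stenzel_u' \<kappa> ((norm z)\<^sup>2) * (2 * (z \<bullet> v))))) (at z within {z. norm z \<ge> 1})"
    using assms by (intro has_derivative_of_real has_derivative_radial stenzel_u_has_derivative) auto
  from frechet_derivative_outside_ball[OF assms this] show ?thesis
    unfolding dzbar_def by (simp add: inner_axis_complex complex_eq_iff)
qed

text \<open>The mixed derivatives of u(|z|^2) are u' delta_jk + u'' cnj z_j z_k, so the flat Kaehler
  form appears with factor u', together with a rank-one term built from v -> sum of cnj z_j v_j. B
  is the one-sided derivative of \<open>stenzel_u'\<close>, known only to exist.\<close>

lemma stenzel_form_eq:
  assumes "norm z \<ge> 1"
  shows "\<exists>B. \<forall>v w. stenzel_form \<kappa> z v w = of_real (- 2 *
     (stenzel_u' \<kappa> ((norm z)\<^sup>2) * Im (\<Sum>j\<in>UNIV. v $ j * cnj (w $ j))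
      + B * Im ((\<Sum>j\<in>UNIV. cnj (z $ j) * v $ j) * cnj (\<Sum>j\<in>UNIV. cnj (z $ j) * w $ j))))"
proof -
  let ?D = "{z::complex^4. norm z \<ge> 1}"
  let ?f = "\<lambda>z::complex^4. complex_of_real (stenzel_u \<kappa> ((norm z)\<^sup>2))"
  define A where "A = stenzel_u' \<kappa> ((norm z)\<^sup>2)"
  have "(norm z)\<^sup>2 \<ge> 1"
    using assms by simp
  then obtain B where B: "(stenzel_u' \<kappa> has_real_derivative B) (at ((norm z)\<^sup>2) within {1..})"
    using stenzel_u'_differentiable by blast
  have dz: "dz ?D j (dzbar ?D k ?f) z = of_real B * cnj (z $ j) * z $ k + (if j = k then of_real A else 0)" for j k
  proof -
    have "((\<lambda>z. of_real (stenzel_u' \<kappa> ((norm z)\<^sup>2)) * z $ k) has_derivative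
       (\<lambda>v. of_real A * v $ k + of_real (B * (2 * (z \<bullet> v))) * z $ k)) (at z within ?D)"
      unfolding A_def
      by (intro has_derivative_mult has_derivative_of_real has_derivative_radial[OF assms B]
          bounded_linear.has_derivative[OF bounded_linear_vec_nth] has_derivative_ident)
    then have "((\<lambda>z. dzbar ?D k ?f z) has_derivative
       (\<lambda>v. of_real A * v $ k + of_real (B * (2 * (z \<bullet> v))) * z $ k)) (at z within ?D)"
      by (rule has_derivative_transform_within[where d = 1]) (use assms in \<open>auto simp: dzbar_stenzel\<close>)
    moreover have "axis j x $ k = (if j = k then x else 0)" for x :: complex
      by (auto simp: axis_def)
    ultimately show ?thesis
      unfolding dz_def
      by (simp add: frechet_derivative_outside_ball[OF assms] inner_axis_complex complex_eq_iff algebra_simps)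
        (simp add: field_simps)
  qed
  have "stenzel_form \<kappa> z v w = of_real (- 2 * (A * Im (\<Sum>j\<in>UNIV. v $ j * cnj (w $ j))
      + B * Im ((\<Sum>j\<in>UNIV. cnj (z $ j) * v $ j) * cnj (\<Sum>j\<in>UNIV. cnj (z $ j) * w $ j))))" for v w
  proof -
    define V where "V = (\<Sum>j\<in>UNIV. cnj (z $ j) * v $ j)"
    define W where "W = (\<Sum>j\<in>UNIV. cnj (z $ j) * w $ j)"
    define P where "P = (\<Sum>j\<in>UNIV. v $ j * cnj (w $ j))"
    have "(\<Sum>j\<in>UNIV. \<Sum>k\<in>UNIV. dz ?D j (dzbar ?D k ?f) z * (v $ j * cnj (w $ k) - w $ j * cnj (v $ k)))
      = of_real A * (P - cnj P) + of_real B * (V * cnj W - W * cnj V)"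
      by (simp add: dz sum_4 V_def W_def P_def) (simp add: algebra_simps)
    then have "stenzel_form \<kappa> z v w = \<i> * (of_real A * (P - cnj P) + of_real B * (V * cnj W - cnj (V * cnj W)))"
      by (simp add: stenzel_form_def i_ddbar_def mult.commute)
    then show ?thesis
      unfolding V_def[symmetric] W_def[symmetric] P_def[symmetric] complex_diff_cnj
      by (simp add: complex_eq_iff)
  qed
  then show ?thesis
    unfolding A_def by blast
qed

lemma norm_quadric_ge_1: "z \<in> quadric \<Longrightarrow> norm z \<ge> 1"
proof -
  assume "z \<in> quadric"
  moreover have "(norm z)\<^sup>2 = re_vec z \<bullet> re_vec z + im_vec z \<bullet> im_vec z"
    unfolding power2_norm_eq_inner by (simp add: inner_vec_def sum_4 inner_complex_def)
  ultimately have "1\<^sup>2 \<le> (norm z)\<^sup>2"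
    using inner_ge_zero[of "im_vec z"] unfolding quadric_iff power_one by (elim conjE) linarith
  then show ?thesis
    by (rule power2_le_imp_le) simp
qed

section \<open>The zero level of the moment map\<close>

text \<open>For \<open>w = t + i s\<close>, the imaginary part of \<open>phase w\<close> is the left-hand side of the equation
  defining \<^const>\<open>L_c\<close>, and \<open>(sin w)\<^sup>2 dw\<close> is a multiple of its differential.\<close>

definition phase :: "complex \<Rightarrow> complex" where
  "phase w = 2 * w - sin (2 * w)"

text \<open>The pairs (w, e) and (-w, -e) describe the same point with opposite values of Im
  (\<open>phase\<close> w). Requiring Im w >= 0, where Im w plays the role of |xi|, fixes the sign
  of c.\<close>

definition Lq :: "real \<Rightarrow> (complex^4) set" where
  "Lq c = {cvec (cos w) (sin w) e |w e. norm e = 1 \<and> Im w \<ge> 0 \<and> Im (phase w) = c}"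

lemma Im_phase: "Im (phase w) = 2 * Im w - cos (2 * Re w) * sinh (2 * Im w)"
  by (simp add: phase_def Im_sin sinh_def exp_minus)

lemma has_field_derivative_phase [derivative_intros]:
  "(phase has_field_derivative 4 * (sin w)\<^sup>2) (at w within S)"
proof -
  have "cos (2 * w) = 1 - 2 * (sin w)\<^sup>2"
    by (rule cos_double_sin)
  then show ?thesis
    unfolding phase_def[abs_def] by (auto intro!: derivative_eq_intros)
qed

lemma holomorphic_phase: "phase holomorphic_on S"
  unfolding phase_def[abs_def] by (intro holomorphic_intros)

lemma deriv_phase: "deriv phase w = 4 * (sin w)\<^sup>2"
  by (rule DERIV_imp_deriv[OF has_field_derivative_phase])

lemma phase_alt: "phase w = 2 * w - 2 * (sin w * cos w)"
  by (simp add: phase_def sin_double)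

text \<open>cos w determines w up to sign and shifts by 2 pi. A shift changes \<open>phase\<close>
  by a real number, a sign change negates it.\<close>

lemma cos_eq_cases:
  assumes "cos w = cos z"
  shows "sin w = sin z \<and> Im (phase w) = Im (phase z) \<or> sin w = - sin z \<and> Im (phase w) = - Im (phase z)"
proof -
  obtain r where "r \<in> \<int>" and r: "w = z + of_real (2 * r * pi) \<or> w = - z + of_real (2 * r * pi)"
    using assms unfolding complex_cos_eq by blast
  from \<open>r \<in> \<int>\<close> obtain n :: int where n: "r = of_int n"
    by (rule Ints_cases)
  consider "w = z + of_real (2 * real_of_int n * pi)" | "w = - z + of_real (2 * real_of_int n * pi)"
    using r unfolding n by blast
  then show ?thesis
  proof cases
    case 1
    then have "sin w = sin z"
      using Periodic_Fun.sin.plus_of_int[of z n] by (simp add: algebra_simps)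
    moreover have "Im w = Im z"
      using 1 by simp
    ultimately show ?thesis
      using assms by (simp add: phase_alt)
  next
    case 2
    then have "sin w = - sin z"
      using Periodic_Fun.sin.plus_of_int[of "- z" n] by (simp add: 2 algebra_simps)
    moreover have "Im w = - Im z"
      using 2 by simp
    ultimately show ?thesis
      using assms by (simp add: phase_alt)
  qed
qed

lemma sin_zero_imp_real: "sin (w::complex) = 0 \<Longrightarrow> Im w = 0"
  by (auto simp: sin_eq_0)

lemma cos_sin_Complex:
  "cos (Complex t s) = Complex (cos t * cosh s) (- sin t * sinh s)"
  "sin (Complex t s) = Complex (sin t * cosh s) (cos t * sinh s)"
  by (simp_all add: complex_eq_iff Re_sin Im_sin Re_cos Im_cos cosh_def sinh_def exp_minus field_simps)

lemma unit_vector_rotation: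
  fixes e :: "real^3"
  assumes "norm e = 1"
  obtains A where "rotation_matrix A" "A *v axis 1 1 = e"
proof (rule rotation_matrix_exists_basis[of e 1])
  show "2 \<le> CARD(3)"
    by simp
qed (use assms that in auto)

lemma rotation_matrix_norm: "rotation_matrix A \<Longrightarrow> norm (A *v x) = norm (x :: real^'n)"
  by (simp add: norm_eq_sqrt_inner rotation_inner)

lemma to_quadric_L_c: "to_quadric ` L_c c = Lq c"
proof
  show "to_quadric ` L_c c \<subseteq> Lq c"
  proof (clarsimp simp: L_c_def)
    fix g \<xi> t
    let ?x = "vector [cos t, sin t, 0, 0] :: real^4"
    assume g: "g \<in> SO3" and cot: "(?x, \<xi>) \<in> cotangent_S3" and \<xi>: "\<xi> $ 3 = 0" "\<xi> $ 4 = 0"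
    then obtain A where A: "g = block_matrix A" "rotation_matrix A"
      by (auto simp: SO3_def)
    \<comment> \<open>The signed length of xi along (-sin t, cos t), the only direction in the plane
      orthogonal to x.\<close>
    define s where "s = \<xi> $ 2 * cos t - \<xi> $ 1 * sin t"
    have orth: "cos t * \<xi> $ 1 + sin t * \<xi> $ 2 = 0"
      using cot \<xi> by (simp add: cotangent_S3_def inner_vec_def sum_4)
    have "\<xi> $ 1 * ((sin t)\<^sup>2 + (cos t)\<^sup>2) = - s * sin t" "\<xi> $ 2 * ((sin t)\<^sup>2 + (cos t)\<^sup>2) = s * cos t"
      using orth unfolding s_def by algebra+
    then have \<xi>12: "\<xi> $ 1 = - s * sin t" "\<xi> $ 2 = s * cos t"
      by simp_all
    have "(norm \<xi>)\<^sup>2 = (\<xi> $ 1)\<^sup>2 + (\<xi> $ 2)\<^sup>2"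
      unfolding power2_norm_eq_inner using \<xi> by (simp add: inner_vec_def sum_4 power2_eq_square)
    also have "\<dots> = s\<^sup>2 * ((sin t)\<^sup>2 + (cos t)\<^sup>2)"
      unfolding \<xi>12 by (simp only: power_mult_distrib power2_minus distrib_left mult_minus_left)
    finally have "(norm \<xi>)\<^sup>2 = \<bar>s\<bar>\<^sup>2"
      by simp
    then have n: "norm \<xi> = \<bar>s\<bar>"
      by (rule power2_eq_imp_eq) simp_all
    \<comment> \<open>In the plane the point is (cos u, sin u) for u = t + i s; when s < 0, passing
      to -u and -e makes the imaginary part |s|.\<close>
    define w where "w = Complex (if s \<ge> 0 then t else - t) \<bar>s\<bar>"
    define e where "e = (if s \<ge> 0 then axis 1 1 else - axis 1 1 :: real^3)"
    have "to_quadric (?x, \<xi>) = cvec (cos w) (sin w) e"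
    proof (cases "s = 0")
      case False
      then show ?thesis
        using \<xi> \<xi>12 unfolding vec_eq_iff forall_4
        by (auto simp: to_quadric_nth n w_def e_def cos_sin_Complex complex_eq_iff axis_def)
    next
      case True
      then show ?thesis
        using \<xi> \<xi>12 unfolding vec_eq_iff forall_4
        by (auto simp: to_quadric_nth n w_def e_def cos_sin_Complex complex_eq_iff axis_def)
    qed
    then have "to_quadric (g *v ?x, g *v \<xi>) = cvec (cos w) (sin w) (A *v e)"
      by (simp add: A to_quadric_block_matrix rot_cvec)
    moreover have "norm (A *v e) = 1"
      by (simp add: rotation_matrix_norm[OF A(2)] e_def)
    moreover have "Im (phase w) = 2 * norm \<xi> - cos (2 * t) * sinh (2 * norm \<xi>)"
      by (simp add: Im_phase w_def n)
    ultimately show "to_quadric (g *v ?x, g *v \<xi>) \<in> Lq (2 * norm \<xi> - cos (2 * t) * sinh (2 * norm \<xi>))"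
      unfolding Lq_def by (auto simp: w_def intro!: exI[of _ w] exI[of _ "A *v e"])
  qed
  show "Lq c \<subseteq> to_quadric ` L_c c"
  proof
    fix z
    assume "z \<in> Lq c"
    then obtain w e where z: "z = cvec (cos w) (sin w) e" and e: "norm e = 1" and w: "0 \<le> Im w"
      and c: "c = Im (phase w)"
      unfolding Lq_def by blast
    obtain A where A: "rotation_matrix A" "A *v axis 1 1 = e"
      using e by (rule unit_vector_rotation)
    define t where "t = Re w"
    define s where "s = Im w"
    define x where "x = (vector [cos t, sin t, 0, 0] :: real^4)"
    define \<xi> where "\<xi> = (vector [- s * sin t, s * cos t, 0, 0] :: real^4)"
    have "(norm \<xi>)\<^sup>2 = (- s * sin t)\<^sup>2 + (s * cos t)\<^sup>2"
      unfolding power2_norm_eq_inner by (simp add: \<xi>_def inner_vec_def sum_4 power2_eq_square)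
    also have "\<dots> = s\<^sup>2 * ((sin t)\<^sup>2 + (cos t)\<^sup>2)"
      by (simp only: power_mult_distrib power2_minus distrib_left mult_minus_left)
    finally have "(norm \<xi>)\<^sup>2 = s\<^sup>2"
      by simp
    then have n: "norm \<xi> = s"
      by (rule power2_eq_imp_eq) (use w in \<open>simp_all add: s_def\<close>)
    have w_eq: "w = Complex t s"
      by (simp add: t_def s_def)
    have \<xi>_nth: "\<xi> $ 1 = - s * sin t" "\<xi> $ 2 = s * cos t" "\<xi> $ 3 = 0" "\<xi> $ 4 = 0"
      by (simp_all add: \<xi>_def)
    have "to_quadric (x, \<xi>) = cvec (cos w) (sin w) (axis 1 1)"
      unfolding vec_eq_iff forall_4 w_eq cos_sin_Complex
      by (auto simp: to_quadric_nth n x_def \<xi>_nth complex_eq_iff axis_def)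
    then have "to_quadric (block_matrix A *v x, block_matrix A *v \<xi>) = cvec (cos w) (sin w) e"
      by (simp add: A to_quadric_block_matrix rot_cvec)
    moreover have "(norm x)\<^sup>2 = 1\<^sup>2" "x \<bullet> \<xi> = 0"
      unfolding power2_norm_eq_inner
      by (simp_all add: x_def \<xi>_def inner_vec_def sum_4 power2_eq_square[symmetric])
    then have "(x, \<xi>) \<in> cotangent_S3"
      using power2_eq_imp_eq[of "norm x" 1] by (simp add: cotangent_S3_def)
    then have cot: "(x, \<xi>) \<in> cotangent_S3"
      by simp
    have "(block_matrix A *v x, block_matrix A *v \<xi>) \<in> L_c c"
      unfolding L_c_def
      by (rule CollectI, rule exI[of _ "block_matrix A"], rule exI[of _ x], rule exI[of _ \<xi>], rule exI[of _ t])
        (use A(1) n \<xi>_nth cot in \<open>simp add: SO3_def c Im_phase t_def[symmetric] s_def[symmetric] x_def\<close>)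
    ultimately show "z \<in> to_quadric ` L_c c"
      unfolding z by (metis imageI)
  qed
qed

text \<open>The vectors v annihilated by the differentials at z of the functions Im (z_i cnj z_j),
  the components of the moment map. Their common zeros are the points whose last three coordinates
  are real multiples of one complex number.\<close>

definition Im_ratio_cond :: "complex^4 \<Rightarrow> complex^4 \<Rightarrow> bool" where
  "Im_ratio_cond z v \<longleftrightarrow> (\<forall>i\<in>{2,3,4}. \<forall>j\<in>{2,3,4}. Im (v $ i * cnj (z $ j)) = Im (v $ j * cnj (z $ i)))"

definition herm :: "complex^4 \<Rightarrow> complex^4 \<Rightarrow> complex" where
  "herm v w = (\<Sum>j\<in>UNIV. v $ j * cnj (w $ j))"

lemma herm_add: "herm (u + v) w = herm u w + herm v w" "herm w (u + v) = herm w u + herm w v"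
  by (simp_all add: herm_def sum_4 algebra_simps)

lemma herm_cvec: "herm (cvec a b e) (cvec a' b' e') = a * cnj a' + b * cnj b' * of_real (e \<bullet> e')"
  by (simp add: herm_def sum_4 inner_vec_def sum_3 algebra_simps)

text \<open>The three conditions are the linearised equations of the quadric, of the zero level of the
  moment map and of the level set of \<^const>\<open>phase\<close>.\<close>

lemma tangent_normal_form:
  assumes b: "b \<noteq> 0" and ab: "a\<^sup>2 + b\<^sup>2 = 1" and e: "norm e = 1"
    and 1: "(\<Sum>j\<in>UNIV. cvec a b e $ j * v $ j) = 0"
    and 2: "Im_ratio_cond (cvec a b e) v"
    and 3: "Im (b * v $ 1) = 0"
  obtains l f where "b\<^sup>2 * l \<in> \<real>" "f \<bullet> e = 0" "v = cvec (- b * l) (a * l) e + cvec 0 b f"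
proof -
  \<comment> \<open>Dividing by b removes the common phase: condition 2 becomes the statement that
    the imaginary part of u is parallel to e.\<close>
  define u where "u = (vector [v $ 2 / b, v $ 3 / b, v $ 4 / b] :: complex^3)"
  have u: "v $ 2 = b * u $ 1" "v $ 3 = b * u $ 2" "v $ 4 = b * u $ 3"
    using b by (simp_all add: u_def)
  define iu where "iu = (\<chi> i. Im (u $ i))"
  define ru where "ru = (\<chi> i. Re (u $ i))"
  have ee: "e \<bullet> e = 1"
    using e by (simp add: norm_eq_1)
  have Im_eq: "Im (b * x * cnj (b * of_real r)) = (cmod b)\<^sup>2 * (Im x * r)" for x r
    unfolding cmod_power2 by (simp add: power2_eq_square algebra_simps)
  have "Im (v $ 2 * cnj (cvec a b e $ 3)) = Im (v $ 3 * cnj (cvec a b e $ 2))"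
    "Im (v $ 2 * cnj (cvec a b e $ 4)) = Im (v $ 4 * cnj (cvec a b e $ 2))"
    "Im (v $ 3 * cnj (cvec a b e $ 4)) = Im (v $ 4 * cnj (cvec a b e $ 3))"
    using 2 unfolding Im_ratio_cond_def by blast+
  then have cr: "iu $ 1 * e $ 2 = iu $ 2 * e $ 1" "iu $ 1 * e $ 3 = iu $ 3 * e $ 1" "iu $ 2 * e $ 3 = iu $ 3 * e $ 2"
    using b unfolding u cvec_nth Im_eq by (simp_all add: iu_def)
  define \<mu> where "\<mu> = iu \<bullet> e"
  define \<nu> where "\<nu> = ru \<bullet> e"
  define f where "f = ru - \<nu> *\<^sub>R e"
  have "iu $ i = \<mu> * e $ i" for i
  proof -
    have "iu $ 1 * (e \<bullet> e) = \<mu> * e $ 1" "iu $ 2 * (e \<bullet> e) = \<mu> * e $ 2" "iu $ 3 * (e \<bullet> e) = \<mu> * e $ 3"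
      unfolding \<mu>_def inner_vec_def sum_3 inner_real_def using cr by algebra+
    then have "iu $ i * (e \<bullet> e) = \<mu> * e $ i"
      using exhaust_3[of i] by auto
    then show ?thesis
      by (simp add: ee)
  qed
  then have ui: "u $ i = of_real (f $ i) + Complex \<nu> \<mu> * of_real (e $ i)" for i
    by (simp add: complex_eq_iff f_def ru_def iu_def vec_eq_iff)
  define \<eta> where "\<eta> = b * Complex \<nu> \<mu>"
  have fe: "f \<bullet> e = 0"
    by (simp add: f_def inner_diff_left ee \<nu>_def)
  have v: "v $ 2 = \<eta> * of_real (e $ 1) + b * of_real (f $ 1)" "v $ 3 = \<eta> * of_real (e $ 2) + b * of_real (f $ 2)"
     "v $ 4 = \<eta> * of_real (e $ 3) + b * of_real (f $ 3)"
    by (simp_all add: u ui \<eta>_def algebra_simps)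
  have "(\<Sum>j\<in>UNIV. cvec a b e $ j * v $ j) = a * v $ 1 + b * (\<eta> * of_real (e \<bullet> e) + b * of_real (f \<bullet> e))"
    by (simp add: sum_4 v inner_vec_def sum_3 algebra_simps)
  with 1 have eq: "a * v $ 1 + b * \<eta> = 0"
    by (simp add: ee fe)
  \<comment> \<open>l is the velocity dw of the parameter, read off from d (cos w) = - sin w dw, and
    f is the velocity of e. Condition 3 thus says that (sin w)^2 dw is real.\<close>
  define l where "l = - (v $ 1 / b)"
  have b2: "b\<^sup>2 * l = - (b * v $ 1)"
    using b by (simp add: l_def power2_eq_square)
  have "b\<^sup>2 * l \<in> \<real>"
    unfolding b2 using 3 by (simp add: complex_is_Real_iff)
  have "v $ 1 = - b * l"
    using b by (simp add: l_def)
  moreover have "\<eta> = a * l"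
  proof -
    have "b * (\<eta> - a * l) = 0"
      using eq b by (simp add: l_def field_simps)
    then show ?thesis
      using b by simp
  qed
  ultimately have "v = cvec (- b * l) (a * l) e + cvec 0 b f"
    unfolding vec_eq_iff forall_4 by (simp add: v)
  with \<open>b\<^sup>2 * l \<in> \<real>\<close> fe show ?thesis
    by (rule that)
qed

text \<open>Both l and m lie on the real line through 0 and cnj b, so their arguments agree up to
  pi.\<close>

lemma Reals_mult_cnj:
  assumes "b \<noteq> 0" "b * l \<in> \<real>" "b * m \<in> \<real>"
  shows "l * cnj m \<in> \<real>"
proof -
  have "cnj (b * m) = b * m"
    using assms(3) Reals_cnj_iff by blast
  then have "(b * l) * cnj (b * m) \<in> \<real>"
    using Reals_mult[OF assms(2,3)] by (simp only:)
  then have "of_real (1 / (cmod b)\<^sup>2) * ((b * l) * cnj (b * m)) \<in> \<real>"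
    by (rule Reals_mult[OF Reals_of_real])
  moreover have "(b * l) * cnj (b * m) = of_real ((cmod b)\<^sup>2) * (l * cnj m)"
    unfolding complex_norm_square by (simp add: mult_ac)
  moreover have "of_real (1 / (cmod b)\<^sup>2) * (of_real ((cmod b)\<^sup>2) * (l * cnj m)) = l * cnj m"
    using assms(1) by simp
  ultimately show ?thesis
    by (simp only:)
qed

lemma herm_normal_form:
  assumes "f \<bullet> e = 0" "g \<bullet> e = 0" "norm e = 1"
  shows "herm (cvec (- b * l) (a * l) e + cvec 0 b f) (cvec (- b * m) (a * m) e + cvec 0 b g)
    = (l * cnj m) * of_real ((cmod b)\<^sup>2 + (cmod a)\<^sup>2) + of_real ((cmod b)\<^sup>2 * (f \<bullet> g))"
  unfolding herm_add herm_cvec of_real_add of_real_mult complex_norm_square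
  using assms by (simp add: inner_commute[of e g] norm_eq_1 algebra_simps)

lemma herm_normal_form_point:
  assumes "f \<bullet> e = 0" "norm e = 1"
  shows "herm (cvec (- b * l) (a * l) e + cvec 0 b f) (cvec a b e) = l * (a * cnj b - b * cnj a)"
  unfolding herm_add herm_cvec
  using assms by (simp add: norm_eq_1 algebra_simps)

section \<open>The holomorphic volume form on vectors in normal form\<close>

definition tri :: "complex^3 \<Rightarrow> complex^3 \<Rightarrow> complex^3 \<Rightarrow> complex" where
  "tri x y z = x$1 * (y$2 * z$3 - y$3 * z$2) + x$2 * (y$3 * z$1 - y$1 * z$3) + x$3 * (y$1 * z$2 - y$2 * z$1)"

definition cvec3 :: "real^3 \<Rightarrow> complex^3" where
  "cvec3 e = (\<chi> i. of_real (e $ i))"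

lemma tri_cvec3: "tri (cvec3 e) (cvec3 f) (cvec3 g) = of_real (e \<bullet> cross3 f g)"
  by (simp add: tri_def cvec3_def cross3_def inner_vec_def sum_3)

lemma tri_add:
  "tri (x + x') y z = tri x y z + tri x' y z"
  "tri x (y + y') z = tri x y z + tri x y' z"
  "tri x y (z + z') = tri x y z + tri x y z'"
  by (simp_all add: tri_def algebra_simps)

lemma tri_mult:
  "tri (l *s x) y z = l * tri x y z" "tri x (l *s y) z = l * tri x y z" "tri x y (l *s z) = l * tri x y z"
  by (simp_all add: tri_def algebra_simps)

lemma tri_alt: "tri x x z = 0" "tri x y x = 0" "tri x y y = 0"
  by (simp_all add: tri_def algebra_simps)

lemma tri_rotate: "tri y z x = tri x y z" and tri_swap: "tri x z y = - tri x y z"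
  by (simp_all add: tri_def algebra_simps)

text \<open>Cofactor expansion along the first column, with the factor b of the last three
  coordinates of z taken out of the minors that contain them.\<close>

lemma volume_cofactor:
  assumes "z$2 = b * x$1" "z$3 = b * x$2" "z$4 = b * x$3" "u$2 = p$1" "u$3 = p$2" "u$4 = p$3"
    "v$2 = q$1" "v$3 = q$2" "v$4 = q$3" "w$2 = r$1" "w$3 = r$2" "w$4 = r$3"
  shows "stenzel_volume z u v w = z$1 * tri p q r - b * (u$1 * tri x q r + v$1 * tri x r p + w$1 * tri x p q)"
  unfolding stenzel_volume_def det_4 using assms by (simp add: tri_def) (simp add: algebra_simps)

text \<open>This is (sin w)^2 dw times the area form of the sphere: terms with two factors e cancel,
  and each l collects a^2 from the spatial minor and b^2 from the first column. The last summand
  disappears when the f lie in the plane orthogonal to e.\<close>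

lemma volume_normal_form:
  fixes a b :: complex and e f1 f2 f3 :: "real^3"
  shows "stenzel_volume (cvec a b e) (cvec (- b * l1) (a * l1) e + cvec 0 b f1)
     (cvec (- b * l2) (a * l2) e + cvec 0 b f2) (cvec (- b * l3) (a * l3) e + cvec 0 b f3)
    = b\<^sup>2 * (a\<^sup>2 + b\<^sup>2) * (l1 * of_real (e \<bullet> cross3 f2 f3) + l2 * of_real (e \<bullet> cross3 f3 f1) + l3 * of_real (e \<bullet> cross3 f1 f2))
      + a * b^3 * of_real (f1 \<bullet> cross3 f2 f3)"
proof -
  let ?h = "\<lambda>l f. (a * l) *s cvec3 e + b *s cvec3 f"
  have "stenzel_volume (cvec a b e) (cvec (- b * l1) (a * l1) e + cvec 0 b f1)
     (cvec (- b * l2) (a * l2) e + cvec 0 b f2) (cvec (- b * l3) (a * l3) e + cvec 0 b f3)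
    = a * tri (?h l1 f1) (?h l2 f2) (?h l3 f3)
      + b * b * (l1 * tri (cvec3 e) (?h l2 f2) (?h l3 f3) + l2 * tri (cvec3 e) (?h l3 f3) (?h l1 f1)
        + l3 * tri (cvec3 e) (?h l1 f1) (?h l2 f2))"
    by (subst volume_cofactor[where b = b and x = "cvec3 e" and p = "?h l1 f1" and q = "?h l2 f2" and r = "?h l3 f3"])
      (simp_all add: cvec3_def algebra_simps)
  also have "\<dots> = b\<^sup>2 * (a\<^sup>2 + b\<^sup>2) * (l1 * tri (cvec3 e) (cvec3 f2) (cvec3 f3) + l2 * tri (cvec3 e) (cvec3 f3) (cvec3 f1)
        + l3 * tri (cvec3 e) (cvec3 f1) (cvec3 f2)) + a * b^3 * tri (cvec3 f1) (cvec3 f2) (cvec3 f3)"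
    unfolding tri_add tri_mult tri_alt
    unfolding tri_rotate[of "cvec3 f1" "cvec3 e" "cvec3 f3", symmetric] tri_rotate[of "cvec3 e" "cvec3 f1" "cvec3 f2"]
      tri_swap[of "cvec3 e" "cvec3 f1" "cvec3 f3"] tri_rotate[of "cvec3 f3" "cvec3 f1" "cvec3 e", symmetric]
      tri_rotate[of "cvec3 f2" "cvec3 e" "cvec3 f1"]
    by (simp add: power2_eq_square power3_eq_cube algebra_simps)
  finally show ?thesis
    unfolding tri_cvec3 .
qed

section \<open>Tangent vectors of the level sets of the phase\<close>

text \<open>Tangent vectors are velocities of curves, so g is differentiated along a curve, which
  stays in U for small times. Constancy is local because branches of w exist only locally.\<close>

lemma tangent_const:
  fixes g :: "'a::real_normed_vector \<Rightarrow> 'b::real_normed_vector"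
  assumes v: "v \<in> tangent_space M z" and U: "open U" "z \<in> U"
    and const: "\<And>x. x \<in> M \<Longrightarrow> x \<in> U \<Longrightarrow> g x = k"
    and d: "(g has_derivative g') (at z)"
  shows "g' v = 0"
proof -
  obtain \<gamma> \<epsilon> where "\<epsilon> > 0" and M: "\<And>s::real. \<bar>s\<bar> < \<epsilon> \<Longrightarrow> \<gamma> s \<in> M" and "\<gamma> 0 = z"
    and \<gamma>: "(\<gamma> has_vector_derivative v) (at 0)"
    using v unfolding tangent_space_def by blast
  have "isCont \<gamma> 0"
    using \<gamma> by (rule has_vector_derivative_continuous)
  then have "\<forall>\<^sub>F s in at 0. \<gamma> s \<in> U"
    using U \<open>\<gamma> 0 = z\<close> by (auto simp: isCont_def intro: topological_tendstoD)
  then have "\<forall>\<^sub>F s in nhds 0. \<gamma> s \<in> U"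
    using U \<open>\<gamma> 0 = z\<close> by (simp add: eventually_nhds_conv_at)
  moreover have "\<forall>\<^sub>F s in nhds 0. \<gamma> s \<in> M"
    unfolding eventually_nhds_metric using M \<open>\<epsilon> > 0\<close> by (auto intro!: exI[of _ \<epsilon>])
  ultimately have ev: "\<forall>\<^sub>F s in nhds 0. g (\<gamma> s) = k"
    by eventually_elim (rule const)
  have "((\<lambda>s. g (\<gamma> s)) has_derivative (\<lambda>s. g' (s *\<^sub>R v))) (at 0)"
    using has_derivative_compose[OF \<gamma>[unfolded has_vector_derivative_def]] d \<open>\<gamma> 0 = z\<close> by simp
  moreover have "g' (s *\<^sub>R v) = s *\<^sub>R g' v" for s
    using d by (simp add: has_derivative_def bounded_linear.linear linear_cmul)
  ultimately have "((\<lambda>s. g (\<gamma> s)) has_vector_derivative g' v) (at 0)"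
    by (simp add: has_vector_derivative_def)
  moreover obtain d where "d > 0" "\<And>s. dist s 0 < d \<Longrightarrow> g (\<gamma> s) = k"
    using ev unfolding eventually_nhds_metric by blast
  then have "((\<lambda>s. g (\<gamma> s)) has_vector_derivative 0) (at 0)"
    by (intro has_vector_derivative_transform_within[OF has_vector_derivative_const]) auto
  ultimately show ?thesis
    by (rule vector_derivative_unique_at)
qed

text \<open>Off the zeros of sin, both cos and \<open>phase\<close> are locally biholomorphic; W and
  K are their inverses on a common neighbourhood B. The last clause removes the sign ambiguity on B:
  for c nonzero, Im w0 > 0 persists nearby, and a value at distance less than |c| from c cannot be
  -c.\<close>

lemma arccos_branch:
  assumes s: "sin w0 \<noteq> 0" and im: "Im w0 \<ge> 0" and c: "Im (phase w0) = c"
  obtains B W K where "open B" "w0 \<in> B" "\<And>w. w \<in> B \<Longrightarrow> sin w \<noteq> 0"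
    "open (cos ` B)" "W holomorphic_on cos ` B" "\<And>w. w \<in> B \<Longrightarrow> W (cos w) = w"
    "open (phase ` B)" "K holomorphic_on phase ` B" "\<And>w. w \<in> B \<Longrightarrow> K (phase w) = w"
    "\<And>w. w \<in> B \<Longrightarrow> \<bar>Im (phase w)\<bar> = \<bar>c\<bar> \<Longrightarrow> Im (phase w) = c \<and> (Im w \<ge> 0 \<or> c = 0)"
proof -
  have "deriv cos w0 \<noteq> 0"
    using s by (simp add: DERIV_imp_deriv[OF DERIV_cos])
  then obtain r1 where r1: "r1 > 0" "inj_on cos (ball w0 r1)"
    by (rule has_complex_derivative_locally_injective[OF holomorphic_on_cos UNIV_I open_UNIV])
  have "deriv phase w0 \<noteq> 0"
    using s by (simp add: deriv_phase)
  then obtain r2 where r2: "r2 > 0" "inj_on phase (ball w0 r2)"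
    by (rule has_complex_derivative_locally_injective[OF holomorphic_phase UNIV_I open_UNIV])
  have cont: "isCont (\<lambda>w. Im (phase w)) w0"
    by (rule continuous_Im[OF DERIV_isCont[OF has_field_derivative_phase]])
  have "\<forall>\<^sub>F w in nhds w0. sin w \<noteq> 0"
    using s by (intro eventually_nhds_in_open[of "- {w. sin w = 0}", THEN eventually_mono])
      (auto intro!: open_Compl closed_Collect_eq continuous_intros)
  moreover have "\<forall>\<^sub>F w in nhds w0. \<bar>Im (phase w)\<bar> = \<bar>c\<bar> \<longrightarrow> Im (phase w) = c \<and> (Im w \<ge> 0 \<or> c = 0)"
  proof (cases "c = 0")
    case False
    have "Im w0 \<noteq> 0"
      using c False by (auto simp: Im_phase)
    then have "\<forall>\<^sub>F w in nhds w0. Im w > 0"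
      using im by (intro eventually_nhds_in_open[of "{w. Im w > 0}", THEN eventually_mono])
        (auto simp: open_halfspace_Im_gt)
    moreover have "\<forall>\<^sub>F w in nhds w0. dist (Im (phase w)) (Im (phase w0)) < \<bar>c\<bar>"
      using cont False by (intro tendstoD) (auto simp: isCont_def tendsto_nhds_iff)
    ultimately show ?thesis
      by eventually_elim (auto simp: c dist_real_def)
  qed (auto)
  ultimately have "\<forall>\<^sub>F w in nhds w0. sin w \<noteq> 0 \<and>
      (\<bar>Im (phase w)\<bar> = \<bar>c\<bar> \<longrightarrow> Im (phase w) = c \<and> (Im w \<ge> 0 \<or> c = 0))"
    by (rule eventually_conj)
  then obtain r3 where r3: "r3 > 0" "\<And>w. dist w w0 < r3 \<Longrightarrow> sin w \<noteq> 0 \<and>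
      (\<bar>Im (phase w)\<bar> = \<bar>c\<bar> \<longrightarrow> Im (phase w) = c \<and> (Im w \<ge> 0 \<or> c = 0))"
    unfolding eventually_nhds_metric by blast
  define B where "B = ball w0 (min r1 (min r2 r3))"
  have B: "open B" "w0 \<in> B" "B \<subseteq> ball w0 r1" "B \<subseteq> ball w0 r2" "\<And>w. w \<in> B \<Longrightarrow> dist w w0 < r3"
    using r1(1) r2(1) r3(1) by (auto simp: B_def dist_commute)
  have inj: "inj_on cos B" "inj_on phase B"
    using inj_on_subset[OF r1(2) B(3)] inj_on_subset[OF r2(2) B(4)] by simp_all
  obtain W where W: "W holomorphic_on cos ` B" "\<And>w. w \<in> B \<Longrightarrow> W (cos w) = w"
    using holomorphic_has_inverse[OF holomorphic_on_cos B(1) inj(1)] by metis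
  obtain K where K: "K holomorphic_on phase ` B" "\<And>w. w \<in> B \<Longrightarrow> K (phase w) = w"
    using holomorphic_has_inverse[OF holomorphic_phase B(1) inj(2)] by metis
  show ?thesis
  proof (rule that[of B W K])
    show "open (cos ` B)" "open (phase ` B)"
      using open_mapping_thm3[OF _ B(1)] inj holomorphic_on_cos holomorphic_phase by blast+
  qed (use B W K r3(2) in auto)
qed

text \<open>For c = 0 the pairs (w, e) and (-w, -e) both have the value 0, so either sign of Im w is
  admissible.\<close>

lemma Lq_memI:
  assumes "norm e = 1" "Im (phase w) = c" "Im w \<ge> 0 \<or> c = 0"
  shows "cvec (cos w) (sin w) e \<in> Lq c"
proof (cases "Im w \<ge> 0")
  case True
  then show ?thesis
    using assms unfolding Lq_def by blast
next
  case False
  then have "cvec (cos (- w)) (sin (- w)) (- e) \<in> Lq c"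
    using assms unfolding Lq_def by (intro CollectI exI[of _ "- w"] exI[of _ "- e"]) (auto simp: phase_alt)
  then show ?thesis
    by (simp add: cvec_uminus)
qed

text \<open>Rewrites a point in the parameter of a given branch. The last hypothesis, which
  \<open>arccos_branch\<close> provides, rules out that the branch sees -c in place of c.\<close>

lemma Lq_same_cos:
  assumes "z \<in> Lq c" "z $ 1 = cos w" "\<bar>Im (phase w)\<bar> = \<bar>c\<bar> \<Longrightarrow> Im (phase w) = c"
  obtains e where "norm e = 1" "z = cvec (cos w) (sin w) e" "Im (phase w) = c"
proof -
  obtain w' e' where z: "z = cvec (cos w') (sin w') e'" "norm e' = 1" "Im (phase w') = c"
    using assms(1) unfolding Lq_def by blast
  have "cos w = cos w'"
    using assms(2) z(1) by simp
  from cos_eq_cases[OF this] show ?thesis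
  proof
    assume *: "sin w = sin w' \<and> Im (phase w) = Im (phase w')"
    show ?thesis
      by (rule that[of e']) (use * z \<open>cos w = cos w'\<close> in auto)
  next
    assume *: "sin w = - sin w' \<and> Im (phase w) = - Im (phase w')"
    show ?thesis
      by (rule that[of "- e'"]) (use * z \<open>cos w = cos w'\<close> assms(3) cvec_uminus[of "cos w'" "sin w'" e'] in auto)
  qed
qed

lemma cvec_in_quadric:
  assumes "norm e = 1" "a\<^sup>2 + b\<^sup>2 = 1"
  shows "cvec a b e \<in> quadric"
proof -
  have "(\<Sum>j\<in>UNIV. (cvec a b e $ j)\<^sup>2) = a\<^sup>2 + b\<^sup>2 * of_real (e \<bullet> e)"
    by (simp add: sum_4 inner_vec_def sum_3 power2_eq_square algebra_simps)
  then show ?thesis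
    using assms by (simp add: quadric_def norm_eq_1)
qed

lemma Lq_subset_quadric: "Lq c \<subseteq> quadric"
  unfolding Lq_def by (auto intro!: cvec_in_quadric)

text \<open>The branch W of arccos has derivative -1 / sin w0 and \<open>phase\<close> has
  derivative 4 (sin w0)^2. In terms of z the phase depends on the first coordinate alone.\<close>

lemma phase_branch_derivative:
  assumes B: "open B" "w0 \<in> B"
    and W: "open (cos ` B)" "W holomorphic_on cos ` B" "\<And>w. w \<in> B \<Longrightarrow> W (cos w) = w"
    and z: "z $ 1 = cos w0"
  shows "((\<lambda>z. Im (phase (W (z $ 1)))) has_derivative (\<lambda>v. - 4 * Im (sin w0 * v $ 1))) (at (z :: complex^4))"
proof -
  note comp = bounded_linear.has_derivative[OF bounded_linear_vec_nth has_derivative_ident]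
  define D where "D = deriv W (cos w0)"
  have "(W has_field_derivative D) (at (cos w0))"
    unfolding D_def using B by (intro holomorphic_derivI[OF W(2,1)]) blast
  then have dW: "(W has_field_derivative D) (at (z $ 1))"
    by (simp add: z)
  have "((\<lambda>w. W (cos w)) has_field_derivative D * - sin w0) (at w0)"
    using DERIV_chain2[OF _ DERIV_cos[of w0]] dW by (simp add: z)
  moreover have "((\<lambda>w. W (cos w)) has_field_derivative 1) (at w0)"
    by (rule has_field_derivative_transform_within_open[OF DERIV_ident B(1,2)]) (simp add: W)
  ultimately have D: "D * - sin w0 = 1"
    by (rule DERIV_unique)
  have "W (cos w0) = w0"
    using W B by blast
  then have "(phase has_field_derivative 4 * (sin w0)\<^sup>2) (at (W (z $ 1)))"
    using has_field_derivative_phase[of w0] by (simp add: z)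
  from DERIV_chain2[OF this dW]
  have "((\<lambda>x. phase (W x)) has_derivative (*) (4 * (sin w0)\<^sup>2 * D)) (at (z $ 1))"
    unfolding has_field_derivative_def by simp
  from has_derivative_compose[OF comp this]
  have "((\<lambda>z. Im (phase (W (z $ 1)))) has_derivative (\<lambda>v. Im (4 * (sin w0)\<^sup>2 * D * v $ 1))) (at z)"
    by (rule has_derivative_Im)
  moreover have eq: "4 * (sin w0)\<^sup>2 * D * x = - 4 * (sin w0 * x)" for x
    using D by algebra
  have "Im (4 * (sin w0)\<^sup>2 * D * x) = - 4 * Im (sin w0 * x)" for x
    unfolding eq by simp
  ultimately show ?thesis
    by (simp only:)
qed

lemma quadric_tangent:
  assumes "M \<inter> U \<subseteq> quadric" "open U" "z \<in> U" "v \<in> tangent_space M z"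
  shows "(\<Sum>j\<in>UNIV. z $ j * v $ j) = 0"
proof -
  note comp = bounded_linear.has_derivative[OF bounded_linear_vec_nth has_derivative_ident]
  have "((\<lambda>x. \<Sum>j\<in>UNIV. x $ j * x $ j) has_derivative (\<lambda>v. \<Sum>j\<in>UNIV. z $ j * v $ j + v $ j * z $ j)) (at z)"
    by (intro has_derivative_sum has_derivative_mult comp)
  moreover have "(\<Sum>j\<in>UNIV. x $ j * x $ j) = 1" if "x \<in> M" "x \<in> U" for x
    using assms(1) that by (auto simp: quadric_def power2_eq_square)
  ultimately have "(\<Sum>j\<in>UNIV. z $ j * v $ j + v $ j * z $ j) = 0"
    by (intro tangent_const[OF assms(4,2,3), where k = 1 and
        g' = "\<lambda>v. \<Sum>j\<in>UNIV. z $ j * v $ j + v $ j * z $ j"])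
  moreover have "(\<Sum>j\<in>UNIV. z $ j * v $ j + v $ j * z $ j) = 2 * (\<Sum>j\<in>UNIV. z $ j * v $ j)"
    by (simp add: sum_4 algebra_simps)
  ultimately show ?thesis
    by simp
qed

text \<open>Differentiates three functions that are constant on \<open>Lq\<close>: the sum of
  squares, Im (z_i cnj z_j), and the imaginary part of the phase in a local branch. M is arbitrary
  inside the level set, so the result also serves the sheets through the poles, at their other
  points.\<close>

lemma Lq_tangent:
  assumes M: "M \<inter> U \<subseteq> Lq c" and U: "open U" "cvec (cos w0) (sin w0) e \<in> U"
    and w0: "sin w0 \<noteq> 0" "Im w0 \<ge> 0" "Im (phase w0) = c"
    and v: "v \<in> tangent_space M (cvec (cos w0) (sin w0) e)"
  shows "(\<Sum>j\<in>UNIV. cvec (cos w0) (sin w0) e $ j * v $ j) = 0"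
    and "Im_ratio_cond (cvec (cos w0) (sin w0) e) v"
    and "Im (sin w0 * v $ 1) = 0"
proof -
  let ?z = "cvec (cos w0) (sin w0) e"
  note comp = bounded_linear.has_derivative[OF bounded_linear_vec_nth has_derivative_ident]
  show "(\<Sum>j\<in>UNIV. ?z $ j * v $ j) = 0"
    using M Lq_subset_quadric by (intro quadric_tangent[OF _ U v]) blast
  show "Im_ratio_cond ?z v"
    unfolding Im_ratio_cond_def
  proof (intro ballI)
    fix i j :: 4
    assume ij: "i \<in> {2, 3, 4}" "j \<in> {2, 3, 4}"
    have "((\<lambda>z. Im (z $ i * cnj (z $ j))) has_derivative (\<lambda>v. Im (?z $ i * cnj (v $ j) + v $ i * cnj (?z $ j)))) (at ?z)"
      by (intro has_derivative_Im has_derivative_mult has_derivative_cnj comp)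
    moreover have "Im (x $ i * cnj (x $ j)) = 0" if "x \<in> M" "x \<in> U" for x
      using M that ij by (auto simp: Lq_def)
    ultimately have "Im (?z $ i * cnj (v $ j) + v $ i * cnj (?z $ j)) = 0"
      by (intro tangent_const[OF v U, where k = 0 and
          g' = "\<lambda>v. Im (?z $ i * cnj (v $ j) + v $ i * cnj (?z $ j))"])
    then show "Im (v $ i * cnj (?z $ j)) = Im (v $ j * cnj (?z $ i))"
      by (simp add: algebra_simps)
  qed
  obtain B W K where B: "open B" "w0 \<in> B" and W: "open (cos ` B)" "W holomorphic_on cos ` B" "\<And>w. w \<in> B \<Longrightarrow> W (cos w) = w"
    and c: "\<And>w. w \<in> B \<Longrightarrow> \<bar>Im (phase w)\<bar> = \<bar>c\<bar> \<Longrightarrow> Im (phase w) = c \<and> (Im w \<ge> 0 \<or> c = 0)"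
    using arccos_branch[OF w0] by metis
  let ?U = "U \<inter> {z. z $ 1 \<in> cos ` B}"
  have oU: "open ?U"
    using W(1) U(1) by (intro open_Int open_vimage[of "cos ` B" "\<lambda>z. z $ 1", unfolded vimage_def]) (auto intro!: continuous_intros)
  have zU: "?z \<in> ?U"
    using U B by auto
  have const: "Im (phase (W (x $ 1))) = c" if "x \<in> M" "x \<in> ?U" for x
  proof -
    from that obtain w where w: "w \<in> B" "x $ 1 = cos w"
      by blast
    have "x \<in> Lq c"
      using M that by blast
    then obtain e where "Im (phase w) = c"
      using Lq_same_cos w(2) c[OF w(1)] by metis
    then show ?thesis
      using W w by simp
  qed
  have "cvec (cos w0) (sin w0) e $ 1 = cos w0"
    by simp
  from tangent_const[OF v oU zU const phase_branch_derivative[OF B W this]]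
  show "Im (sin w0 * v $ 1) = 0"
    by simp
qed

text \<open>The three vectors lie in a plane. By Cramer's rule each coordinate of e times the triple
  product is a polynomial combination of the inner products with e, and some coordinate of e is
  nonzero.\<close>

lemma orthogonal_triple_zero:
  fixes e :: "real^3"
  assumes "norm e = 1" "f1 \<bullet> e = 0" "f2 \<bullet> e = 0" "f3 \<bullet> e = 0"
  shows "f1 \<bullet> cross3 f2 f3 = 0"
proof -
  have "e $ i * (f1 \<bullet> cross3 f2 f3) = 0" for i
  proof -
    have "e $ 1 * (f1 \<bullet> cross3 f2 f3) = 0" "e $ 2 * (f1 \<bullet> cross3 f2 f3) = 0" "e $ 3 * (f1 \<bullet> cross3 f2 f3) = 0"
      using assms(2-4) unfolding cross3_def inner_vec_def sum_3 inner_real_def vector_3 by algebra+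
    then show ?thesis
      using exhaust_3[of i] by auto
  qed
  moreover have "e \<noteq> 0"
    using assms(1) by auto
  ultimately show ?thesis
    by (auto simp: vec_eq_iff)
qed

lemma stenzel_form_herm:
  assumes "z \<in> quadric"
  shows "\<exists>B. \<forall>v w. stenzel_form \<kappa> z v w = of_real (- 2 *
     (stenzel_u' \<kappa> ((norm z)\<^sup>2) * Im (herm v w) + B * Im (herm v z * cnj (herm w z))))"
proof -
  have hz: "(\<Sum>j\<in>UNIV. cnj (z $ j) * v $ j) = herm v z" for v
    by (simp add: herm_def mult.commute)
  show ?thesis
    using stenzel_form_eq[OF norm_quadric_ge_1[OF assms], of \<kappa>]
    unfolding hz herm_def[symmetric] .
qed

lemma stenzel_form_zeroI:
  assumes "z \<in> quadric" "herm v w \<in> \<real>" "herm v z * cnj (herm w z) \<in> \<real>"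
  shows "stenzel_form \<kappa> z v w = 0"
proof -
  have "Im (herm v w) = 0" "Im (herm v z * cnj (herm w z)) = 0"
    using assms(2,3) by (simp_all only: complex_is_Real_iff)
  then show ?thesis
    using stenzel_form_herm[OF assms(1), of \<kappa>] by (metis mult_zero_right add_0 of_real_0)
qed

text \<open>In normal form all l lie on one real line, since (sin w)^2 l is real; this makes the
  Hermitian terms real. The volume form becomes a sum of terms (sin w)^2 l times real
  numbers.\<close>

lemma Lq_special_lagrangian_at:
  assumes M: "M \<inter> U \<subseteq> Lq c" "open U" "z \<in> M" "z \<in> U" and z: "z $ 1 \<noteq> 1" "z $ 1 \<noteq> - 1"
  shows "v \<in> tangent_space M z \<Longrightarrow> w \<in> tangent_space M z \<Longrightarrow> stenzel_form \<kappa> z v w = 0"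
    and "v1 \<in> tangent_space M z \<Longrightarrow> v2 \<in> tangent_space M z \<Longrightarrow> v3 \<in> tangent_space M z \<Longrightarrow>
      Im (stenzel_volume z v1 v2 v3) = 0"
proof -
  obtain w0 e where w0: "z = cvec (cos w0) (sin w0) e" "norm e = 1" "Im w0 \<ge> 0" "Im (phase w0) = c"
    using M unfolding Lq_def by blast
  have sin: "sin w0 \<noteq> 0"
  proof
    assume "sin w0 = 0"
    then have "(cos w0)\<^sup>2 = 1"
      using sin_cos_squared_add[of w0] by simp
    then show False
      using z by (simp add: w0(1) power2_eq_1_iff)
  qed
  have one: "(cos w0)\<^sup>2 + (sin w0)\<^sup>2 = 1"
    by simp
  define a where "a = cos w0"
  define b where "b = sin w0"
  have nf: "\<exists>l f. b\<^sup>2 * l \<in> \<real> \<and> f \<bullet> e = 0 \<and> v = cvec (- b * l) (a * l) e + cvec 0 b f"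
    if "v \<in> tangent_space M z" for v
    using tangent_normal_form[OF sin one w0(2) Lq_tangent[OF M(1,2) _ sin w0(3,4), of e v]] M(4) that
    unfolding a_def b_def w0(1) by metis
  show "stenzel_form \<kappa> z v w = 0" if vw: "v \<in> tangent_space M z" "w \<in> tangent_space M z"
  proof (rule stenzel_form_zeroI)
    show "z \<in> quadric"
      unfolding w0(1) by (rule cvec_in_quadric[OF w0(2) one])
    obtain l f where l: "b\<^sup>2 * l \<in> \<real>" "f \<bullet> e = 0" "v = cvec (- b * l) (a * l) e + cvec 0 b f"
      using nf[OF vw(1)] by blast
    obtain m g where m: "b\<^sup>2 * m \<in> \<real>" "g \<bullet> e = 0" "w = cvec (- b * m) (a * m) e + cvec 0 b g"
      using nf[OF vw(2)] by blast
    have lm: "l * cnj m \<in> \<real>"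
      using Reals_mult_cnj[OF _ l(1) m(1)] sin by (simp add: b_def)
    show "herm v w \<in> \<real>"
      unfolding l(3) m(3) herm_normal_form[OF l(2) m(2) w0(2)]
      by (rule Reals_add[OF Reals_mult[OF lm Reals_of_real] Reals_of_real])
    have eq: "(l * (a * cnj b - b * cnj a)) * cnj (m * (a * cnj b - b * cnj a))
        = (l * cnj m) * of_real ((cmod (a * cnj b - b * cnj a))\<^sup>2)"
      unfolding complex_norm_square by (simp add: mult_ac)
    show "herm v z * cnj (herm w z) \<in> \<real>"
      unfolding l(3) m(3) w0(1) a_def[symmetric] b_def[symmetric] herm_normal_form_point[OF l(2) w0(2)]
        herm_normal_form_point[OF m(2) w0(2)] eq by (rule Reals_mult[OF lm Reals_of_real])
  qed
  show "Im (stenzel_volume z v1 v2 v3) = 0"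
    if v: "v1 \<in> tangent_space M z" "v2 \<in> tangent_space M z" "v3 \<in> tangent_space M z"
  proof -
    obtain l1 f1 where 1: "b\<^sup>2 * l1 \<in> \<real>" "f1 \<bullet> e = 0" "v1 = cvec (- b * l1) (a * l1) e + cvec 0 b f1"
      using nf[OF v(1)] by blast
    obtain l2 f2 where 2: "b\<^sup>2 * l2 \<in> \<real>" "f2 \<bullet> e = 0" "v2 = cvec (- b * l2) (a * l2) e + cvec 0 b f2"
      using nf[OF v(2)] by blast
    obtain l3 f3 where 3: "b\<^sup>2 * l3 \<in> \<real>" "f3 \<bullet> e = 0" "v3 = cvec (- b * l3) (a * l3) e + cvec 0 b f3"
      using nf[OF v(3)] by blast
    have "stenzel_volume z v1 v2 v3 = b\<^sup>2 * l1 * of_real (e \<bullet> cross3 f2 f3) + b\<^sup>2 * l2 * of_real (e \<bullet> cross3 f3 f1)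
        + b\<^sup>2 * l3 * of_real (e \<bullet> cross3 f1 f2)"
      unfolding w0(1) a_def[symmetric] b_def[symmetric] 1(3) 2(3) 3(3) volume_normal_form
        orthogonal_triple_zero[OF w0(2) 1(2) 2(2) 3(2)] one[folded a_def b_def]
      by (simp add: algebra_simps)
    moreover have "\<dots> \<in> \<real>"
      by (intro Reals_add Reals_mult[OF 1(1) Reals_of_real] Reals_mult[OF 2(1) Reals_of_real] Reals_mult[OF 3(1) Reals_of_real])
    ultimately show ?thesis
      by (simp add: complex_is_Real_iff)
  qed
qed

section \<open>Charts off the poles\<close>

lemma Ck_on_subset: "Ck_on k f S \<Longrightarrow> T \<subseteq> S \<Longrightarrow> Ck_on k f T"
  by (induction k arbitrary: f) (auto intro: continuous_on_subset)

lemma smooth_on_subset: "smooth_on f S \<Longrightarrow> T \<subseteq> S \<Longrightarrow> smooth_on f T"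
  unfolding smooth_on_def using Ck_on_subset by blast

lemma inj_frechet_left_inverse:
  assumes "open V" "y \<in> V" "\<phi> differentiable (at y)" "\<psi> differentiable (at (\<phi> y))"
    and inv: "\<And>x. x \<in> V \<Longrightarrow> \<psi> (\<phi> x) = x"
  shows "inj (frechet_derivative \<phi> (at y))"
proof -
  have "((\<lambda>x. \<psi> (\<phi> x)) has_derivative (\<lambda>v. frechet_derivative \<psi> (at (\<phi> y)) (frechet_derivative \<phi> (at y) v))) (at y)"
    using has_derivative_compose[OF frechet_derivative_works[THEN iffD1, OF assms(3)]
        frechet_derivative_works[THEN iffD1, OF assms(4)]] .
  moreover have "((\<lambda>x. \<psi> (\<phi> x)) has_derivative (\<lambda>v. v)) (at y)"
    by (rule has_derivative_transform_within_open[OF has_derivative_ident assms(1,2)]) (simp add: inv)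
  ultimately have "(\<lambda>v. frechet_derivative \<psi> (at (\<phi> y)) (frechet_derivative \<phi> (at y) v)) = (\<lambda>v. v)"
    by (rule has_derivative_unique)
  then show ?thesis
    by (metis injI)
qed

definition chart3 :: "'a::euclidean_space set \<Rightarrow> 'a \<Rightarrow> bool" where
  "chart3 M p \<longleftrightarrow> (\<exists>U V (\<phi> :: real^3 \<Rightarrow> 'a) \<psi>.
        open U \<and> p \<in> U \<and> open V \<and> smooth_on \<phi> V \<and>
        (\<forall>y\<in>V. inj (frechet_derivative \<phi> (at y))) \<and>
        homeomorphism V (M \<inter> U) \<phi> \<psi>)"

lemma submanifold3_iff: "submanifold3 M \<longleftrightarrow> (\<forall>p\<in>M. chart3 M p)"
  by (simp add: submanifold3_def chart3_def)

text \<open>A smooth left inverse on an ambient neighbourhood yields both the immersion property, by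
  the chain rule, and continuity of the inverse on M.\<close>

lemma chart3I_smooth_inverse:
  fixes \<phi> :: "real^3 \<Rightarrow> 'a::euclidean_space"
  assumes U: "open U" "p \<in> U" and V: "open V" and \<phi>: "smooth_on \<phi> V" and \<psi>: "smooth_on \<psi> U"
    and 1: "\<And>y. y \<in> V \<Longrightarrow> \<phi> y \<in> M \<and> \<phi> y \<in> U \<and> \<psi> (\<phi> y) = y"
    and 2: "\<And>z. z \<in> M \<Longrightarrow> z \<in> U \<Longrightarrow> \<psi> z \<in> V \<and> \<phi> (\<psi> z) = z"
  shows "chart3 M p"
proof -
  have "inj (frechet_derivative \<phi> (at y))" if "y \<in> V" for y
    using smooth_on_has_derivative[OF \<phi> that] smooth_on_has_derivative[OF \<psi>, of "\<phi> y"] 1 that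
    by (intro inj_frechet_left_inverse[OF V that, of \<phi> \<psi>]) (auto simp: differentiable_def)
  moreover have "continuous_on V \<phi>" "continuous_on U \<psi>"
    using \<phi> \<psi> unfolding smooth_on_def by (metis Ck_on.simps(1))+
  then have "homeomorphism V (M \<inter> U) \<phi> \<psi>"
    using 1 2 by (intro homeomorphismI) (auto intro: continuous_on_subset)
  ultimately show ?thesis
    unfolding chart3_def
    by (intro exI[of _ U] exI[of _ V] exI[of _ \<phi>] exI[of _ \<psi>] conjI ballI U V \<phi>)
qed

lemma chart3_Int_open:
  fixes M :: "'a::euclidean_space set"
  assumes "chart3 M p" "open W" "p \<in> W"
  shows "chart3 (M \<inter> W) p"
proof -
  obtain U V and \<phi> :: "real^3 \<Rightarrow> 'a" and \<psi> where *: "open U" "p \<in> U" "open V" "smooth_on \<phi> V"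
    "\<forall>y\<in>V. inj (frechet_derivative \<phi> (at y))" "homeomorphism V (M \<inter> U) \<phi> \<psi>"
    using assms(1) unfolding chart3_def by (elim exE conjE) (rule that)
  let ?V = "V \<inter> \<phi> -` W"
  have "continuous_on V \<phi>"
    using *(6) by (rule homeomorphism_cont1)
  then have oV: "open ?V"
    by (rule continuous_open_preimage[OF _ *(3) assms(2)])
  have "\<phi> ` ?V = \<phi> ` V \<inter> W"
    by blast
  then have "\<phi> ` ?V = M \<inter> U \<inter> W"
    unfolding homeomorphism_image1[OF *(6)] .
  then have "homeomorphism ?V (M \<inter> W \<inter> (U \<inter> W)) \<phi> \<psi>"
    by (intro homeomorphism_of_subsets[OF *(6) _ order_refl]) auto
  moreover have "smooth_on \<phi> ?V"
    by (rule smooth_on_subset[OF *(4)]) simp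
  moreover have "\<forall>y\<in>?V. inj (frechet_derivative \<phi> (at y))"
    using *(5) by simp
  ultimately show ?thesis
    unfolding chart3_def using *(1,2) assms(2,3) oV
    by (intro exI[of _ "U \<inter> W"] exI[of _ ?V] exI[of _ \<phi>] exI[of _ \<psi>]) (simp add: open_Int)
qed

lemma smooth_on_diff: "open S \<Longrightarrow> smooth_on f S \<Longrightarrow> smooth_on g S \<Longrightarrow> smooth_on (\<lambda>x. f x - g x) S"
  using smooth_on_add[of S f "\<lambda>x. - g x"] smooth_on_bounded_linear[of S uminus g]
  by (simp add: bounded_linear_minus bounded_linear_ident)

lemma smooth_on_mult:
  fixes f :: "'a::real_normed_vector \<Rightarrow> 'b::real_normed_algebra"
  shows "open S \<Longrightarrow> smooth_on f S \<Longrightarrow> smooth_on g S \<Longrightarrow> smooth_on (\<lambda>x. f x * g x) S"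
  by (rule smooth_on_bilinear[OF _ bounded_bilinear_mult])

lemma smooth_on_of_real:
  "open S \<Longrightarrow> smooth_on f S \<Longrightarrow> smooth_on (\<lambda>x. complex_of_real (f x)) S"
  by (rule smooth_on_bounded_linear[OF _ bounded_linear_of_real])

lemma smooth_on_Re: "open S \<Longrightarrow> smooth_on f S \<Longrightarrow> smooth_on (\<lambda>x. Re (f x)) S"
  by (rule smooth_on_bounded_linear[OF _ bounded_linear_Re])

lemma smooth_on_nth: "open S \<Longrightarrow> smooth_on (\<lambda>x::'a::real_normed_vector^'n. x $ i) S"
  by (rule smooth_on_bounded_linear[OF _ bounded_linear_vec_nth smooth_on_ident])

lemma smooth_on_sqrt:
  assumes "open S" "smooth_on f S" "\<And>x. x \<in> S \<Longrightarrow> f x > 0"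
  shows "smooth_on (\<lambda>x. sqrt (f x)) S"
proof -
  have "smooth_on (\<lambda>x. csqrt (of_real (f x))) S"
  proof (rule smooth_on_holomorphic_compose[OF assms(1), where h = csqrt and f = "\<lambda>x. of_real (f x)"])
    show "open (- \<real>\<^sub>\<le>\<^sub>0 :: complex set)"
      by (simp add: open_Compl)
    show "csqrt holomorphic_on - \<real>\<^sub>\<le>\<^sub>0"
      by (rule holomorphic_on_csqrt)
    show "smooth_on (\<lambda>x. complex_of_real (f x)) S"
      by (rule smooth_on_of_real[OF assms(1,2)])
    show "(\<lambda>x. complex_of_real (f x)) ` S \<subseteq> - \<real>\<^sub>\<le>\<^sub>0"
      using assms(3) by (force simp: complex_nonpos_Reals_iff)
  qed
  then have "smooth_on (\<lambda>x. Re (csqrt (of_real (f x)))) S"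
    by (rule smooth_on_Re[OF assms(1)])
  then show ?thesis
    by (rule smooth_on_cong[OF assms(1), rotated]) (use assms(3) in \<open>auto simp: less_imp_le\<close>)
qed

lemmas smooth_intros = smooth_on_const smooth_on_add smooth_on_diff smooth_on_mult smooth_on_of_real
  smooth_on_nth

text \<open>The unit vectors with positive first component as a graph over the disc of (y2, y3); y1
  is kept free for the parameter along the phase curve.\<close>

definition hemisphere :: "real^3 \<Rightarrow> real^3" where
  "hemisphere y = vector [sqrt (1 - ((y$2)\<^sup>2 + (y$3)\<^sup>2)), y$2, y$3]"

lemma norm_hemisphere: "(y$2)\<^sup>2 + (y$3)\<^sup>2 < 1 \<Longrightarrow> norm (hemisphere y) = 1"
  unfolding norm_eq_1 by (simp add: hemisphere_def inner_vec_def sum_3 power2_eq_square[symmetric])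

lemma rotation_transpose:
  assumes "rotation_matrix R"
  shows "rotation_matrix (transpose R)" "transpose R *v (R *v x) = x" "R *v (transpose R *v x) = (x :: real^'n)"
proof -
  have R: "transpose R ** R = mat 1" "R ** transpose R = mat 1" "det R = 1"
    using assms by (auto simp: rotation_matrix_def orthogonal_matrix_def)
  then show "rotation_matrix (transpose R)"
    by (simp add: rotation_matrix_def orthogonal_matrix_def)
  show "transpose R *v (R *v x) = x" "R *v (transpose R *v x) = x"
    unfolding matrix_vector_mul_assoc R matrix_vector_mul_lid by (rule refl)+
qed

declare transpose_matrix_vector [simp del]

text \<open>In the coordinate \<open>phase\<close> w the level set is a horizontal line, so y1 runs
  along it and w = K (phase w0 + y1); y2 and y3 parametrise e near e0 by a rotated hemisphere.
  Conversely W recovers w from the first coordinate, and dividing the other coordinates by sin w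
  recovers e.\<close>

lemma Lq_chart:
  assumes e0: "norm e0 = 1" and w0: "sin w0 \<noteq> 0" "Im w0 \<ge> 0" "Im (phase w0) = c"
  shows "chart3 (Lq c) (cvec (cos w0) (sin w0) e0)"
proof -
  obtain B W K where B: "open B" "w0 \<in> B" "\<And>w. w \<in> B \<Longrightarrow> sin w \<noteq> 0"
    and W: "open (cos ` B)" "W holomorphic_on cos ` B" "\<And>w. w \<in> B \<Longrightarrow> W (cos w) = w"
    and K: "open (phase ` B)" "K holomorphic_on phase ` B" "\<And>w. w \<in> B \<Longrightarrow> K (phase w) = w"
    and c: "\<And>w. w \<in> B \<Longrightarrow> \<bar>Im (phase w)\<bar> = \<bar>c\<bar> \<Longrightarrow> Im (phase w) = c \<and> (Im w \<ge> 0 \<or> c = 0)"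
    by (rule arccos_branch[OF w0]) (rule that)
  obtain R where R: "rotation_matrix R" "R *v axis 1 1 = e0"
    using e0 by (rule unit_vector_rotation)
  define g where "g y = phase w0 + of_real (y $ 1)" for y :: "real^3"
  define V where "V = {y::real^3. g y \<in> phase ` B} \<inter> {y. (y$2)\<^sup>2 + (y$3)\<^sup>2 < 1}"
  define e where "e y = R *v hemisphere y" for y
  define \<phi> where "\<phi> y = cvec (cos (K (g y))) (sin (K (g y))) (e y)" for y
  define Q where "Q i z = rot (transpose R) z $ i / sin (W (z $ 1))" for i z
  define C where "C = {z::complex^4. z $ 1 \<in> cos ` B}"
  \<comment> \<open>Positivity keeps e in the open hemisphere about e0, where its other two rotated
    components determine it.\<close>
  define U where "U = {z\<in>C. Re (Q 2 z) > 0}"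
  define \<psi> where "\<psi> z = (vector [Re (phase (W (z $ 1))) - Re (phase w0), Re (Q 3 z), Re (Q 4 z)] :: real^3)" for z
  have contg: "continuous_on UNIV g"
    unfolding g_def by (intro continuous_intros)
  have oV: "open V"
    unfolding V_def using open_vimage[OF K(1) contg]
    by (intro open_Int open_Collect_less continuous_intros) (simp_all add: vimage_def)
  have smg: "smooth_on g V"
    unfolding g_def by (intro smooth_intros oV)
  have gV: "g ` V \<subseteq> phase ` B"
    by (auto simp: V_def)
  have "smooth_on (\<lambda>y::real^3. 1 - ((y$2)\<^sup>2 + (y$3)\<^sup>2)) V"
    unfolding power2_eq_square by (intro smooth_intros oV)
  then have "smooth_on (\<lambda>y::real^3. sqrt (1 - ((y$2)\<^sup>2 + (y$3)\<^sup>2))) V"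
    by (rule smooth_on_sqrt[OF oV]) (simp add: V_def)
  then have smh: "smooth_on (\<lambda>y. hemisphere y $ i) V" for i
    using exhaust_3[of i] unfolding hemisphere_def by (auto intro!: smooth_intros oV)
  have sme: "smooth_on (\<lambda>y. e y $ i) V" for i
    unfolding e_def matrix_vector_mult_3 by (intro smooth_intros smh oV)
  have smK: "smooth_on (\<lambda>y. cos (K (g y))) V" "smooth_on (\<lambda>y. sin (K (g y))) V"
    using smooth_on_holomorphic_compose[OF oV K(1) _ smg gV, of "\<lambda>u. cos (K u)"]
      smooth_on_holomorphic_compose[OF oV K(1) _ smg gV, of "\<lambda>u. sin (K u)"]
    by (simp_all add: holomorphic_on_cos'[OF K(2)] holomorphic_on_sin'[OF K(2)])
  have sm\<phi>: "smooth_on \<phi> V"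
  proof (rule smooth_on_vec[OF oV])
    show "smooth_on (\<lambda>y. \<phi> y $ i) V" for i
      using exhaust_4[of i] unfolding \<phi>_def by (auto intro!: smooth_intros sme smK oV)
  qed
  have oC: "open C"
    unfolding C_def using open_vimage[OF W(1) continuous_on_component[OF continuous_on_id]]
    by (simp add: vimage_def)
  have CW: "(\<lambda>z. z $ 1) ` C \<subseteq> cos ` B"
    by (auto simp: C_def)
  have smQ: "smooth_on (Q i) C" for i
  proof -
    have "(\<lambda>u. 1 / sin (W u)) holomorphic_on cos ` B"
      using W B(3) by (intro holomorphic_intros) auto
    then have "smooth_on (\<lambda>z. 1 / sin (W (z $ 1))) C"
      by (rule smooth_on_holomorphic_compose[OF oC W(1) _ smooth_on_nth[OF oC] CW])
    moreover have "smooth_on (\<lambda>z. rot (transpose R) z $ i) C"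
      using exhaust_4[of i] by (auto intro!: smooth_intros oC)
    ultimately have "smooth_on (\<lambda>z. rot (transpose R) z $ i * (1 / sin (W (z $ 1)))) C"
      by (intro smooth_on_mult oC)
    then show ?thesis
      unfolding Q_def by simp
  qed
  have "continuous_on C (Q 2)"
    using smQ unfolding smooth_on_def by (metis Ck_on.simps(1))
  then have "open (C \<inter> (\<lambda>z. Re (Q 2 z)) -` {0<..})"
    by (intro continuous_open_preimage oC continuous_on_Re open_greaterThan)
  then have oU: "open U"
    by (simp add: U_def vimage_def Int_def)
  have smQU: "smooth_on (\<lambda>z. Re (Q i z)) U" for i
    by (rule smooth_on_Re[OF oU smooth_on_subset[OF smQ]]) (auto simp: U_def)
  have UW: "(\<lambda>z. z $ 1) ` U \<subseteq> cos ` B"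
    by (auto simp: U_def C_def)
  have "(\<lambda>u. phase (W u)) holomorphic_on cos ` B"
    using holomorphic_on_compose[OF W(2) holomorphic_phase] by (simp add: o_def)
  then have smW: "smooth_on (\<lambda>z. Re (phase (W (z $ 1)))) U"
    by (intro smooth_on_Re oU smooth_on_holomorphic_compose[OF oU W(1) _ smooth_on_nth[OF oU] UW])
  have sm\<psi>: "smooth_on \<psi> U"
  proof (rule smooth_on_vec[OF oU])
    show "smooth_on (\<lambda>z. \<psi> z $ i) U" for i
      using exhaust_3[of i] unfolding \<psi>_def by (auto intro!: smooth_on_diff smooth_on_const smW smQU oU)
  qed
  have Qe: "Q 2 (cvec (cos w) (sin w) f) = of_real ((transpose R *v f) $ 1)"
    "Q 3 (cvec (cos w) (sin w) f) = of_real ((transpose R *v f) $ 2)"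
    "Q 4 (cvec (cos w) (sin w) f) = of_real ((transpose R *v f) $ 3)" if "w \<in> B" for w f
    using B(3)[OF that] W(3)[OF that] by (simp_all add: Q_def rot_cvec del: rot_nth)
  show ?thesis
  proof (rule chart3I_smooth_inverse[OF oU _ oV sm\<phi> sm\<psi>])
    show "cvec (cos w0) (sin w0) e0 \<in> U"
      using B(2) R rotation_transpose(2)[OF R(1), of "axis 1 1"] by (simp add: U_def C_def Qe)
    show "\<phi> y \<in> Lq c \<and> \<phi> y \<in> U \<and> \<psi> (\<phi> y) = y" if "y \<in> V" for y
    proof -
      from that obtain w where w: "w \<in> B" "g y = phase w" and y: "(y$2)\<^sup>2 + (y$3)\<^sup>2 < 1"
        by (auto simp: V_def)
      have \<phi>y: "\<phi> y = cvec (cos w) (sin w) (e y)"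
        using w K(3) by (simp add: \<phi>_def)
      have "Im (phase w) = c"
        unfolding w(2)[symmetric] using w0(3) by (simp add: g_def)
      with c[OF w(1)] have "\<phi> y \<in> Lq c"
        unfolding \<phi>y using norm_hemisphere[OF y] R(1) by (intro Lq_memI) (auto simp: e_def rotation_matrix_norm)
      moreover have te: "transpose R *v e y = hemisphere y"
        unfolding e_def by (rule rotation_transpose(2)[OF R(1)])
      moreover have "\<phi> y \<in> U"
        using w y by (simp add: \<phi>y U_def C_def Qe te) (simp add: hemisphere_def)
      moreover have "Re (phase w) - Re (phase w0) = y $ 1"
        unfolding w(2)[symmetric] by (simp add: g_def)
      then have "\<psi> (\<phi> y) = y"
        using w W(3) by (simp add: \<phi>y \<psi>_def Qe te vec_eq_iff forall_3) (simp add: hemisphere_def)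
      ultimately show ?thesis
        by blast
    qed
    show "\<psi> z \<in> V \<and> \<phi> (\<psi> z) = z" if z: "z \<in> Lq c" "z \<in> U" for z
    proof -
      from z(2) obtain w where w: "w \<in> B" "z $ 1 = cos w"
        by (auto simp: U_def C_def)
      obtain f where f: "norm f = 1" "z = cvec (cos w) (sin w) f" "Im (phase w) = c"
        using Lq_same_cos[OF z(1) w(2)] c[OF w(1)] by metis
      have "(transpose R *v f) $ 1 > 0"
        using z(2) w(1) by (simp add: U_def f(2) Qe)
      moreover have "((transpose R *v f) $ 1)\<^sup>2 + ((transpose R *v f) $ 2)\<^sup>2 + ((transpose R *v f) $ 3)\<^sup>2 = 1"
        using f(1) rotation_inner[OF rotation_transpose(1)[OF R(1)], of f f]
        by (simp add: norm_eq_1 inner_vec_def[of "transpose R *v f"] sum_3 power2_eq_square)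
      moreover have \<psi>z: "\<psi> z $ 2 = (transpose R *v f) $ 2" "\<psi> z $ 3 = (transpose R *v f) $ 3"
        using w W(3) by (simp_all add: \<psi>_def f(2) Qe)
      ultimately have 1: "(\<psi> z $ 2)\<^sup>2 + (\<psi> z $ 3)\<^sup>2 < 1" and 2: "sqrt (1 - ((\<psi> z $ 2)\<^sup>2 + (\<psi> z $ 3)\<^sup>2)) = (transpose R *v f) $ 1"
        by (auto intro!: real_sqrt_unique) (smt (verit) zero_less_power)
      have "hemisphere (\<psi> z) = transpose R *v f"
        unfolding hemisphere_def 2 by (simp add: vec_eq_iff forall_3 \<psi>z)
      then have ef: "e (\<psi> z) = f"
        unfolding e_def by (simp add: rotation_transpose(3)[OF R(1)])
      have "g (\<psi> z) = phase w"
        by (rule complex_eqI) (use w W(3) f(3) w0(3) in \<open>simp_all add: g_def \<psi>_def f(2)\<close>)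
      then show ?thesis
        using 1 w(1) K(3) ef f(2) by (auto simp: V_def \<phi>_def)
    qed
  qed
qed

section \<open>Sheets through the poles\<close>

lemma csqrt_cases_minus: "csqrt z = \<i> * csqrt (- z) \<or> csqrt z = - (\<i> * csqrt (- z))"
  by (simp add: power2_eq_iff[symmetric] power_mult_distrib)

text \<open>Although \<^const>\<open>csqrt\<close> jumps across the negative axis, its two branches differ by a sign only.\<close>

lemma even_holomorphic_csqrt:
  assumes f: "f holomorphic_on UNIV" and even: "\<And>z. f (- z) = f z"
  shows "(\<lambda>z. f (csqrt z)) holomorphic_on UNIV"
proof (rule no_isolated_singularity[where K = "{0}"])
  let ?g = "\<lambda>z. f (csqrt z)"
  have 1: "?g holomorphic_on (- \<real>\<^sub>\<le>\<^sub>0)"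
    using holomorphic_on_compose[OF holomorphic_on_csqrt holomorphic_on_subset[OF f]] by (simp add: o_def)
  \<comment> \<open>i \<open>csqrt\<close> (-z) is also a square root of z, with its cut on the
    positive axis. Evenness of f makes both choices agree, so only the point 0 remains, and
    continuity removes it.\<close>
  have "(\<lambda>z. \<i> * csqrt (- z)) holomorphic_on (- \<real>\<^sub>\<ge>\<^sub>0)"
    by (intro holomorphic_intros) (auto simp: complex_nonpos_Reals_iff complex_nonneg_Reals_iff)
  from holomorphic_on_compose[OF this holomorphic_on_subset[OF f]]
  have "(\<lambda>z. f (\<i> * csqrt (- z))) holomorphic_on (- \<real>\<^sub>\<ge>\<^sub>0)"
    by (simp add: o_def)
  moreover have "f (\<i> * csqrt (- z)) = f (csqrt z)" for z
    using csqrt_cases_minus[of z] even by metis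
  ultimately have "?g holomorphic_on (- \<real>\<^sub>\<ge>\<^sub>0)"
    by simp
  with 1 have un: "?g holomorphic_on (- \<real>\<^sub>\<le>\<^sub>0 \<union> - \<real>\<^sub>\<ge>\<^sub>0)"
    by (intro holomorphic_on_Un) (auto simp: open_Compl)
  show hol: "?g holomorphic_on UNIV - {0}"
    by (rule holomorphic_on_subset[OF un])
      (auto simp: complex_nonpos_Reals_iff complex_nonneg_Reals_iff complex_eq_iff)
  have "isCont ?g z" for z
  proof (cases "z = 0")
    case False
    then show ?thesis
      using hol by (auto simp: holomorphic_on_def field_differentiable_imp_continuous_at
          intro!: field_differentiable_imp_continuous_at)
        (metis DiffI UNIV_I at_within_open field_differentiable_imp_continuous_at open_delete open_UNIV singletonD)
  next
    case True
    have "isCont csqrt 0"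
      unfolding isCont_def csqrt_0 by (rule tendsto_norm_zero_cancel) (auto intro!: tendsto_eq_intros)
    moreover have "isCont f 0"
      using f by (auto simp: holomorphic_on_def intro: field_differentiable_imp_continuous_at)
    ultimately show ?thesis
      using True by (simp add: isCont_o2)
  qed
  then show "continuous_on UNIV ?g"
    by (simp add: continuous_at_imp_continuous_on)
qed auto

definition cosh_sqrt :: "complex \<Rightarrow> complex" where
  "cosh_sqrt z = cosh (csqrt z)"

text \<open>The entire function with coefficients 1 / (2 n + 1)!, as \<open>cosh_sqrt\<close> has 1
  / (2 n)!. At z = |y|^2 they are sinh |y| / |y| and cosh |y|, in a form that is smooth in
  y.\<close>

definition sinhc_sqrt :: "complex \<Rightarrow> complex" where
  "sinhc_sqrt z = (if z = 0 then 1 else sinh (csqrt z) / csqrt z)"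

lemma holomorphic_cosh_sqrt: "cosh_sqrt holomorphic_on UNIV"
  unfolding cosh_sqrt_def
  by (rule even_holomorphic_csqrt) (auto simp: cosh_def intro!: holomorphic_intros)

lemma holomorphic_sinhc_sqrt: "sinhc_sqrt holomorphic_on UNIV"
proof -
  have "sinh holomorphic_on (UNIV :: complex set)"
    unfolding sinh_def by (intro holomorphic_intros)
  from pole_lemma_open[OF this open_UNIV, of 0]
  have "(\<lambda>z::complex. if z = 0 then 1 else sinh z / z) holomorphic_on UNIV"
    using DERIV_imp_deriv[OF has_field_derivative_sinh[OF DERIV_ident, of "0::complex"]] by (simp cong: if_cong)
  from even_holomorphic_csqrt[OF this]
  show ?thesis
    by (simp add: sinhc_sqrt_def[abs_def])
qed

lemma hyperbolic_of_real:
  "cosh (complex_of_real x) = of_real (cosh x)" "sinh (complex_of_real x) = of_real (sinh x)"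
  by (simp_all add: cosh_def sinh_def exp_minus scaleR_conv_of_real exp_of_real)

lemma cosh_sqrt_of_real: "s \<ge> 0 \<Longrightarrow> cosh_sqrt (of_real (s\<^sup>2)) = of_real (cosh s)"
  by (simp add: cosh_sqrt_def csqrt_of_real hyperbolic_of_real del: of_real_power)

lemma sinhc_sqrt_of_real: "s > 0 \<Longrightarrow> sinhc_sqrt (of_real (s\<^sup>2)) = of_real (sinh s / s)"
  by (simp add: sinhc_sqrt_def csqrt_of_real hyperbolic_of_real del: of_real_power)

lemma sinhc_sqrt_0 [simp]: "sinhc_sqrt 0 = 1"
  by (simp add: sinhc_sqrt_def)

text \<open>On the level set of \<^const>\<open>phase\<close> through the poles, \<open>cos (2 t) = 2 s / sinh (2 s)\<close>, so that
  \<open>(sin t)\<^sup>2 = s\<^sup>2 sheet_P (s\<^sup>2)\<close>.\<close>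

definition sheet_P :: "complex \<Rightarrow> complex" where
  "sheet_P z = (if z = 0 then - deriv (\<lambda>z. 1 / sinhc_sqrt (4 * z)) 0
     else - ((1 / sinhc_sqrt (4 * z) - 1) / z)) / 2"

text \<open>At z = s^2 the function is sinh (2 s) / (2 s), whose reciprocal is the required value of
  cos (2 t); this is where the reciprocal is holomorphic.\<close>

definition sheet_dom0 :: "complex set" where
  "sheet_dom0 = {z. sinhc_sqrt (4 * z) \<noteq> 0}"

lemma continuous_sinhc_sqrt: "continuous_on UNIV (\<lambda>z. sinhc_sqrt (4 * z))"
  by (intro continuous_on_compose2[OF holomorphic_on_imp_continuous_on[OF holomorphic_sinhc_sqrt]] continuous_intros) auto

lemma open_sheet_dom0: "open sheet_dom0"
  unfolding sheet_dom0_def by (intro open_Collect_neq continuous_sinhc_sqrt continuous_intros)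

lemma holomorphic_sheet_P: "sheet_P holomorphic_on sheet_dom0"
proof -
  have "(\<lambda>z. sinhc_sqrt (4 * z)) holomorphic_on sheet_dom0"
    by (intro holomorphic_on_compose_gen[OF _ holomorphic_sinhc_sqrt, unfolded o_def] holomorphic_intros) auto
  then have "(\<lambda>z. 1 / sinhc_sqrt (4 * z)) holomorphic_on sheet_dom0"
    by (intro holomorphic_intros) (auto simp: sheet_dom0_def)
  from pole_lemma_open[OF this open_sheet_dom0, of 0]
  have "(\<lambda>z. - (if z = 0 then deriv (\<lambda>z. 1 / sinhc_sqrt (4 * z)) 0 else (1 / sinhc_sqrt (4 * z) - 1) / z) / 2)
      holomorphic_on sheet_dom0"
    by (intro holomorphic_intros) (simp_all cong: if_cong)
  moreover have "sheet_P = (\<lambda>z. - (if z = 0 then deriv (\<lambda>z. 1 / sinhc_sqrt (4 * z)) 0 else (1 / sinhc_sqrt (4 * z) - 1) / z) / 2)"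
    by (auto simp: sheet_P_def)
  ultimately show ?thesis
    by simp
qed

lemma sheet_dom0_of_real:
  assumes "s \<ge> 0"
  shows "of_real (s\<^sup>2) \<in> sheet_dom0"
proof (cases "s = 0")
  case False
  then have "sinhc_sqrt (of_real ((2 * s)\<^sup>2)) = of_real (sinh (2 * s) / (2 * s))"
    using assms by (intro sinhc_sqrt_of_real) simp
  then show ?thesis
    using False by (simp add: sheet_dom0_def power_mult_distrib)
qed (simp add: sheet_dom0_def)

lemma sheet_P_of_real:
  assumes "s > 0"
  shows "sheet_P (of_real (s\<^sup>2)) = of_real ((1 - 2 * s / sinh (2 * s)) / (2 * s\<^sup>2))"
proof -
  have "sinhc_sqrt (of_real ((2 * s)\<^sup>2)) = of_real (sinh (2 * s) / (2 * s))"
    using assms by (intro sinhc_sqrt_of_real) simp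
  then have "sinhc_sqrt (4 * of_real (s\<^sup>2)) = of_real (sinh (2 * s) / (2 * s))"
    by (simp add: power_mult_distrib)
  then have "sheet_P (of_real (s\<^sup>2)) = - ((1 / of_real (sinh (2 * s) / (2 * s)) - 1) / of_real (s\<^sup>2)) / 2"
    using assms by (simp add: sheet_P_def del: of_real_power)
  also have "\<dots> = of_real (- ((1 / (sinh (2 * s) / (2 * s)) - 1) / s\<^sup>2) / 2)"
    by (simp only: of_real_divide of_real_minus of_real_diff of_real_1 of_real_numeral)
  also have "- ((1 / (sinh (2 * s) / (2 * s)) - 1) / s\<^sup>2) / 2 = (1 - 2 * s / sinh (2 * s)) / (2 * s\<^sup>2)"
    using assms by (simp add: field_simps)
  finally show ?thesis .
qed

text \<open>Found as a limit along the positive reals from 2 s / sinh (2 s) = 1 - 2 s^2 / 3 + ...,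
  instead of from the derivative in the definition.\<close>

lemma sheet_P_0: "sheet_P 0 = of_real (1 / 3)"
proof -
  have "0 \<in> sheet_dom0"
    by (simp add: sheet_dom0_def)
  then have "isCont sheet_P 0"
    using holomorphic_on_imp_continuous_on[OF holomorphic_sheet_P] open_sheet_dom0
    by (simp add: continuous_on_eq_continuous_at)
  moreover have "((\<lambda>s::real. complex_of_real (s\<^sup>2)) \<longlongrightarrow> 0) (at_right 0)"
    by (auto intro!: tendsto_eq_intros)
  ultimately have "((\<lambda>s. sheet_P (of_real (s\<^sup>2))) \<longlongrightarrow> sheet_P 0) (at_right 0)"
    by (rule isCont_tendsto_compose)
  moreover have "((\<lambda>s::real. (1 - 2 * s / sinh (2 * s)) / (2 * s\<^sup>2)) \<longlongrightarrow> 1 / 3) (at_right 0)"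
    by real_asymp
  then have "((\<lambda>s. of_real ((1 - 2 * s / sinh (2 * s)) / (2 * s\<^sup>2))) \<longlongrightarrow> complex_of_real (1 / 3)) (at_right 0)"
    by (rule tendsto_of_real)
  then have "((\<lambda>s. sheet_P (of_real (s\<^sup>2))) \<longlongrightarrow> of_real (1 / 3)) (at_right 0)"
    by (rule Lim_transform_eventually)
      (rule eventually_mono[OF eventually_at_right_less[of 0]], simp only: sheet_P_of_real)
  ultimately show ?thesis
    by (rule tendsto_unique[rotated]) simp
qed

definition sheet_p :: "real \<Rightarrow> real" where
  "sheet_p s = (if s = 0 then 1 / 3 else (1 - 2 * s / sinh (2 * s)) / (2 * s\<^sup>2))"

lemma sheet_P_real: "s \<ge> 0 \<Longrightarrow> sheet_P (of_real (s\<^sup>2)) = of_real (sheet_p s)"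
  using sheet_P_of_real[of s] sheet_P_0 by (auto simp: sheet_p_def)

lemma sheet_p_pos: "s \<ge> 0 \<Longrightarrow> sheet_p s > 0"
  using sinh_gt_self[of "2 * s"] by (simp add: sheet_p_def)

text \<open>With (sin t)^2 = s^2 \<open>sheet_p\<close> s this is cos (2 t) sinh (2 s) = 2 s, the
  phase equation for c = 0.\<close>

lemma sheet_p_double: "s \<ge> 0 \<Longrightarrow> (1 - 2 * (s\<^sup>2 * sheet_p s)) * sinh (2 * s) = 2 * s"
  by (cases "s = 0") (auto simp: sheet_p_def field_simps)

lemma sheet_p_less: "s \<ge> 0 \<Longrightarrow> s\<^sup>2 * sheet_p s < 1"
  by (simp add: sheet_p_def) (smt (verit) divide_nonneg_pos sinh_real_pos_iff)

text \<open>Keeps both square roots in \<open>sheet_A\<close> and \<open>sheet_B\<close> off the cut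
  of \<open>csqrt\<close>. At z = s^2 with s > 0 the radicands are (sin t)^2 / s^2 and (cos
  t)^2.\<close>

definition sheet_dom :: "complex set" where
  "sheet_dom = {z\<in>sheet_dom0. sheet_P z \<notin> \<real>\<^sub>\<le>\<^sub>0 \<and> 1 - z * sheet_P z \<notin> \<real>\<^sub>\<le>\<^sub>0}"

lemma open_sheet_dom: "open sheet_dom"
proof -
  note P = holomorphic_on_imp_continuous_on[OF holomorphic_sheet_P]
  have "continuous_on sheet_dom0 (\<lambda>z. 1 - z * sheet_P z)"
    by (intro continuous_intros P)
  from continuous_open_preimage[OF this open_sheet_dom0 open_Compl[OF closed_nonpos_Reals_complex]]
    continuous_open_preimage[OF P open_sheet_dom0 open_Compl[OF closed_nonpos_Reals_complex]]
  have "open ((sheet_dom0 \<inter> sheet_P -` (- \<real>\<^sub>\<le>\<^sub>0)) \<inter> (sheet_dom0 \<inter> (\<lambda>z. 1 - z * sheet_P z) -` (- \<real>\<^sub>\<le>\<^sub>0)))"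
    by (rule open_Int[rotated])
  then show ?thesis
    by (rule back_subst[where P = "open"]) (auto simp: sheet_dom_def)
qed

lemma sheet_dom_of_real:
  assumes "s \<ge> 0"
  shows "of_real (s\<^sup>2) \<in> sheet_dom"
proof -
  have "1 - of_real (s\<^sup>2) * sheet_P (of_real (s\<^sup>2)) = of_real (1 - s\<^sup>2 * sheet_p s)"
    unfolding sheet_P_real[OF assms] by simp
  then show ?thesis
    unfolding sheet_dom_def using sheet_dom0_of_real[OF assms] sheet_p_pos[OF assms] sheet_p_less[OF assms]
    by (simp add: sheet_P_real[OF assms] complex_nonpos_Reals_iff del: of_real_power)
qed

text \<open>For z = s^2, with cos t and sin t the nonnegative roots, \<open>sheet_A\<close> is cos
  (sigma t + i s) and \<open>sheet_B\<close> is sin (sigma t + i s) / s, by the addition theorems.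
  The odd powers of s have paired up or cancelled, so both are holomorphic in z.\<close>

definition sheet_A :: "real \<Rightarrow> complex \<Rightarrow> complex" where
  "sheet_A \<sigma> z = csqrt (1 - z * sheet_P z) * cosh_sqrt z - \<i> * of_real \<sigma> * z * csqrt (sheet_P z) * sinhc_sqrt z"

definition sheet_B :: "real \<Rightarrow> complex \<Rightarrow> complex" where
  "sheet_B \<sigma> z = of_real \<sigma> * csqrt (sheet_P z) * cosh_sqrt z + \<i> * csqrt (1 - z * sheet_P z) * sinhc_sqrt z"

lemma holomorphic_sheet:
  shows "sheet_A \<sigma> holomorphic_on sheet_dom" "sheet_B \<sigma> holomorphic_on sheet_dom"
proof -
  have P: "sheet_P holomorphic_on sheet_dom"
    by (rule holomorphic_on_subset[OF holomorphic_sheet_P]) (auto simp: sheet_dom_def)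
  note * = P holomorphic_on_subset[OF holomorphic_cosh_sqrt subset_UNIV]
    holomorphic_on_subset[OF holomorphic_sinhc_sqrt subset_UNIV]
  show "sheet_A \<sigma> holomorphic_on sheet_dom"
    unfolding sheet_A_def[abs_def] by (intro holomorphic_intros *) (auto simp: sheet_dom_def)
  show "sheet_B \<sigma> holomorphic_on sheet_dom"
    unfolding sheet_B_def[abs_def] by (intro holomorphic_intros *) (auto simp: sheet_dom_def)
qed

text \<open>Solves the phase equation at c = 0 for t when s is given. The nonnegative roots select
  one solution; the other quadrants are reached through sigma and tau.\<close>

lemma sheet_angle:
  assumes "s \<ge> 0"
  obtains t where "cos t = sqrt (1 - s\<^sup>2 * sheet_p s)" "sin t = s * sqrt (sheet_p s)"
    "cos (2 * t) * sinh (2 * s) = 2 * s"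
proof -
  have "(sqrt (1 - s\<^sup>2 * sheet_p s))\<^sup>2 + (s * sqrt (sheet_p s))\<^sup>2 = 1"
    using sheet_p_pos[OF assms] sheet_p_less[OF assms] by (simp add: power_mult_distrib)
  then obtain t where t: "sqrt (1 - s\<^sup>2 * sheet_p s) = cos t" "s * sqrt (sheet_p s) = sin t"
    by (rule sincos_total_2pi)
  have "(sin t)\<^sup>2 = s\<^sup>2 * sheet_p s"
    unfolding t(2)[symmetric] using sheet_p_pos[OF assms] by (simp add: power_mult_distrib)
  then have "cos (2 * t) * sinh (2 * s) = 2 * s"
    using sheet_p_double[OF assms] by (simp add: cos_double_sin)
  with t show ?thesis
    by (intro that[of t]) simp_all
qed

lemma csqrt_sheet_real:
  assumes "s \<ge> 0"
  shows "csqrt (1 - of_real (s\<^sup>2) * sheet_P (of_real (s\<^sup>2))) = of_real (sqrt (1 - s\<^sup>2 * sheet_p s))"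
    and "csqrt (sheet_P (of_real (s\<^sup>2))) = of_real (sqrt (sheet_p s))"
proof -
  have "1 - of_real (s\<^sup>2) * sheet_P (of_real (s\<^sup>2)) = of_real (1 - s\<^sup>2 * sheet_p s)"
    unfolding sheet_P_real[OF assms] by simp
  then show "csqrt (1 - of_real (s\<^sup>2) * sheet_P (of_real (s\<^sup>2))) = of_real (sqrt (1 - s\<^sup>2 * sheet_p s))"
    using sheet_p_less[OF assms] by (simp only: csqrt_of_real less_imp_le diff_ge_0_iff_ge)
  show "csqrt (sheet_P (of_real (s\<^sup>2))) = of_real (sqrt (sheet_p s))"
    using sheet_p_pos[OF assms] by (simp only: sheet_P_real[OF assms] csqrt_of_real less_imp_le)
qed

lemma sheet_A_real:
  assumes "s \<ge> 0"
  shows "sheet_A \<sigma> (of_real (s\<^sup>2)) = Complex (sqrt (1 - s\<^sup>2 * sheet_p s) * cosh s) (- \<sigma> * (s * sqrt (sheet_p s)) * sinh s)"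
proof -
  note cp = csqrt_sheet_real[OF assms]
  have "of_real (s\<^sup>2) * sinhc_sqrt (of_real (s\<^sup>2)) = of_real (s * sinh s)"
    using sinhc_sqrt_of_real[of s] assms by (cases "s = 0") (auto simp: power2_eq_square)
  then have "sheet_A \<sigma> (of_real (s\<^sup>2)) = of_real (sqrt (1 - s\<^sup>2 * sheet_p s)) * of_real (cosh s)
      - \<i> * of_real \<sigma> * of_real (sqrt (sheet_p s)) * of_real (s * sinh s)"
    unfolding sheet_A_def cp cosh_sqrt_of_real[OF assms] by (metis (no_types, lifting) mult.assoc mult.left_commute)
  then show ?thesis
    by (simp add: complex_eq_iff)
qed

text \<open>The positive imaginary part is what allows y to be recovered from the imaginary parts of
  the last three coordinates.\<close>

lemma sheet_B_real:
  assumes "s \<ge> 0"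
  shows "of_real s * sheet_B \<sigma> (of_real (s\<^sup>2)) = Complex (\<sigma> * (s * sqrt (sheet_p s)) * cosh s) (sqrt (1 - s\<^sup>2 * sheet_p s) * sinh s)"
    and "Im (sheet_B \<sigma> (of_real (s\<^sup>2))) > 0"
proof -
  note cp = csqrt_sheet_real[OF assms]
  define S where "S = (if s = 0 then 1 else sinh s / s)"
  have S: "sinhc_sqrt (of_real (s\<^sup>2)) = of_real S" "s * S = sinh s" "S > 0"
    using sinhc_sqrt_of_real[of s] assms by (auto simp: S_def)
  have B: "sheet_B \<sigma> (of_real (s\<^sup>2)) = Complex (\<sigma> * sqrt (sheet_p s) * cosh s) (sqrt (1 - s\<^sup>2 * sheet_p s) * S)"
    unfolding sheet_B_def cp cosh_sqrt_of_real[OF assms] S(1) by (simp add: complex_eq_iff)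
  show "of_real s * sheet_B \<sigma> (of_real (s\<^sup>2)) = Complex (\<sigma> * (s * sqrt (sheet_p s)) * cosh s) (sqrt (1 - s\<^sup>2 * sheet_p s) * sinh s)"
    unfolding B S(2)[symmetric] by (simp add: complex_eq_iff)
  show "Im (sheet_B \<sigma> (of_real (s\<^sup>2))) > 0"
    unfolding B using S(3) sheet_p_less[OF assms] by simp
qed

lemma sheet_0: "sheet_A \<sigma> 0 = 1" "sheet_B \<sigma> 0 = Complex (\<sigma> * sqrt (1 / 3)) 1"
  by (simp_all add: sheet_A_def sheet_B_def sheet_P_0 cosh_sqrt_def complex_eq_iff csqrt_of_real del: of_real_divide)

text \<open>The map \<open>y \<mapsto> (cos w, sin w y / \<bar>y\<bar>)\<close> with \<open>w = \<sigma> t + i \<bar>y\<bar>\<close> on the level set of \<^const>\<open>phase\<close> through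
  the poles; \<open>\<tau>\<close> selects the pole and \<open>\<sigma>\<close> the branch.\<close>

definition sheet_map :: "real \<Rightarrow> real \<Rightarrow> real^3 \<Rightarrow> complex^4" where
  "sheet_map \<tau> \<sigma> y = cvec (of_real \<tau> * sheet_A \<sigma> (of_real ((norm y)\<^sup>2))) (sheet_B \<sigma> (of_real ((norm y)\<^sup>2))) y"

lemma sheet_map_polar:
  assumes "\<sigma> \<in> {1, -1}" "\<tau> \<in> {1, -1}"
  obtains w e where "norm e = 1" "sheet_map \<tau> \<sigma> y = cvec (cos w) (sin w) e" "Im (phase w) = 0" "\<bar>Im w\<bar> = norm y"
proof -
  define s where "s = norm y"
  have s: "s \<ge> 0"
    by (simp add: s_def)
  obtain t where t: "cos t = sqrt (1 - s\<^sup>2 * sheet_p s)" "sin t = s * sqrt (sheet_p s)"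
    "cos (2 * t) * sinh (2 * s) = 2 * s"
    using s by (rule sheet_angle)
  define w where "w = Complex (\<sigma> * t) s"
  have \<sigma>: "cos (\<sigma> * t) = cos t" "sin (\<sigma> * t) = \<sigma> * sin t" "cos (2 * (\<sigma> * t)) = cos (2 * t)"
    using assms(1) by auto
  have A: "cos w = sheet_A \<sigma> (of_real (s\<^sup>2))"
    unfolding w_def cos_sin_Complex sheet_A_real[OF s] \<sigma> t by simp
  have B: "sin w = of_real s * sheet_B \<sigma> (of_real (s\<^sup>2))"
    unfolding w_def cos_sin_Complex sheet_B_real(1)[OF s] \<sigma> t by simp
  have ph: "Im (phase w) = 0"
    by (simp add: Im_phase w_def \<sigma> t)
  \<comment> \<open>At y = 0 any unit vector will do, because sin w = 0 there.\<close>
  define e where "e = (if y = 0 then axis 1 1 else y /\<^sub>R s)"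
  have e: "norm e = 1"
    by (simp add: e_def s_def)
  have se: "s * e $ i = y $ i" for i
    by (auto simp: e_def s_def)
  have Be: "sin w * of_real (e $ i) = sheet_B \<sigma> (of_real (s\<^sup>2)) * of_real (y $ i)" for i
    unfolding B se[symmetric] by simp
  have \<phi>: "sheet_map \<tau> \<sigma> y = cvec (of_real \<tau> * cos w) (sin w) e"
    unfolding sheet_map_def s_def[symmetric] A[symmetric] vec_eq_iff forall_4 by (simp add: Be)
  show ?thesis
  proof (cases "\<tau> = 1")
    case True
    show ?thesis
      by (rule that[OF e]) (use \<phi> ph True in \<open>auto simp: w_def s_def\<close>)
  next
    case False
    with assms(2) have "\<tau> = -1"
      by simp
    \<comment> \<open>The other pole is reached by w -> pi - w, which negates cos w and Im w and
      keeps sin w; hence the absolute value of Im w in the claim.\<close>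
    have cs: "cos (of_real pi - w) = - cos w" "sin (of_real pi - w) = sin w"
      by (simp_all add: cos_diff sin_diff cos_of_real sin_of_real)
    have "Im (phase (of_real pi - w)) = - Im (phase w)"
      unfolding phase_alt cs by simp
    then show ?thesis
      using \<phi> ph \<open>\<tau> = -1\<close> cs by (intro that[OF e, of "of_real pi - w"]) (auto simp: w_def s_def)
  qed
qed

lemma norm_cvec: "norm e = 1 \<Longrightarrow> (norm (cvec a b e))\<^sup>2 = (cmod a)\<^sup>2 + (cmod b)\<^sup>2"
proof -
  assume "norm e = 1"
  then have "(e $ 1)\<^sup>2 + (e $ 2)\<^sup>2 + (e $ 3)\<^sup>2 = 1"
    by (simp add: norm_eq_1 inner_vec_def sum_3 power2_eq_square)
  moreover have "(norm (cvec a b e))\<^sup>2 = (cmod a)\<^sup>2 + (cmod b)\<^sup>2 * ((e $ 1)\<^sup>2 + (e $ 2)\<^sup>2 + (e $ 3)\<^sup>2)"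
    unfolding power2_norm_eq_inner by (simp add: inner_vec_def sum_4 norm_mult power_mult_distrib distrib_left
        power2_norm_eq_inner[symmetric])
  ultimately show ?thesis
    by simp
qed

lemma norm_polar: "norm e = 1 \<Longrightarrow> (norm (cvec (cos w) (sin w) e))\<^sup>2 = cosh (2 * Im w)"
proof -
  assume e: "norm e = 1"
  obtain t s where w: "w = Complex t s"
    by (cases w)
  have "(norm (cvec (cos w) (sin w) e))\<^sup>2 = ((cos t)\<^sup>2 + (sin t)\<^sup>2) * ((cosh s)\<^sup>2 + (sinh s)\<^sup>2)"
    unfolding norm_cvec[OF e] w cos_sin_Complex cmod_power2 by (simp add: power_mult_distrib algebra_simps del: sin_cos_squared_add2)
  then show ?thesis
    by (simp add: w cosh_double)
qed

lemma norm_sheet_map: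
  assumes "\<sigma> \<in> {1, -1}" "\<tau> \<in> {1, -1}"
  shows "(norm (sheet_map \<tau> \<sigma> y))\<^sup>2 = cosh (2 * norm y)"
proof -
  obtain w e where w: "norm e = 1" "sheet_map \<tau> \<sigma> y = cvec (cos w) (sin w) e" "\<bar>Im w\<bar> = norm y"
    by (rule sheet_map_polar[OF assms, of y])
  have "cosh (2 * Im w) = cosh \<bar>2 * Im w\<bar>"
    by simp
  then show ?thesis
    unfolding w(2) norm_polar[OF w(1)] using w(3) by (simp add: abs_mult)
qed

lemma sheet_map_in_Lq: "\<sigma> \<in> {1, -1} \<Longrightarrow> \<tau> \<in> {1, -1} \<Longrightarrow> sheet_map \<tau> \<sigma> y \<in> Lq 0"
  by (rule sheet_map_polar[of \<sigma> \<tau> y]) (auto intro: Lq_memI)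

lemma sheet_map_rot: "rotation_matrix A \<Longrightarrow> sheet_map \<tau> \<sigma> (A *v y) = rot A (sheet_map \<tau> \<sigma> y)"
  by (simp add: sheet_map_def rot_cvec rotation_matrix_norm)

lemma sheet_map_0: "sheet_map \<tau> \<sigma> 0 = cvec (of_real \<tau>) 0 0"
  by (simp add: sheet_map_def sheet_0 cvec_def vec_eq_iff forall_4)

text \<open>Since |z|^2 = cosh (2 |y|) on the sheet, half its arcosh is |y|; the imaginary parts of
  the last three coordinates are y scaled by Im (\<open>sheet_B\<close>). One formula thus serves
  both values of tau.\<close>

definition sheet_inv :: "real \<Rightarrow> complex^4 \<Rightarrow> real^3" where
  "sheet_inv \<sigma> z = (1 / Im (sheet_B \<sigma> (of_real ((arcosh ((norm z)\<^sup>2) / 2)\<^sup>2)))) *\<^sub>R spatial (im_vec z)"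

lemma sheet_inv_sheet_map:
  assumes "\<sigma> \<in> {1, -1}" "\<tau> \<in> {1, -1}"
  shows "sheet_inv \<sigma> (sheet_map \<tau> \<sigma> y) = y"
proof -
  have ar: "arcosh ((norm (sheet_map \<tau> \<sigma> y))\<^sup>2) / 2 = norm y"
    unfolding norm_sheet_map[OF assms] by (simp add: arcosh_cosh_real)
  show ?thesis
    unfolding sheet_inv_def ar using sheet_B_real(2)[of "norm y" \<sigma>]
    by (simp add: vec_eq_iff forall_3 sheet_map_def del: of_real_power)
qed

lemma continuous_on_sheet:
  fixes f :: "'a::topological_space \<Rightarrow> real"
  assumes "continuous_on S f" "\<And>x. x \<in> S \<Longrightarrow> f x \<ge> 0"
  shows "continuous_on S (\<lambda>x. sheet_A \<sigma> (of_real ((f x)\<^sup>2)))" "continuous_on S (\<lambda>x. sheet_B \<sigma> (of_real ((f x)\<^sup>2)))"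
proof -
  have f: "continuous_on S (\<lambda>x. complex_of_real ((f x)\<^sup>2))"
    by (intro continuous_intros assms(1))
  have sub: "(\<lambda>x. complex_of_real ((f x)\<^sup>2)) ` S \<subseteq> sheet_dom"
    using sheet_dom_of_real assms(2) by blast
  show "continuous_on S (\<lambda>x. sheet_A \<sigma> (of_real ((f x)\<^sup>2)))"
    by (rule continuous_on_compose2[OF holomorphic_on_imp_continuous_on[OF holomorphic_sheet(1)] f sub])
  show "continuous_on S (\<lambda>x. sheet_B \<sigma> (of_real ((f x)\<^sup>2)))"
    by (rule continuous_on_compose2[OF holomorphic_on_imp_continuous_on[OF holomorphic_sheet(2)] f sub])
qed

lemma continuous_on_sheet_inv: "continuous_on {z. norm z \<ge> 1} (sheet_inv \<sigma>)"
proof -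
  have ge: "norm z \<ge> 1 \<Longrightarrow> (norm z)\<^sup>2 \<ge> 1" for z :: "complex^4"
    by simp
  have 1: "continuous_on {z::complex^4. norm z \<ge> 1} (\<lambda>z. arcosh ((norm z)\<^sup>2) / 2)"
    by (intro continuous_on_divide continuous_on_const
        continuous_on_compose2[OF continuous_on_arcosh[OF order_refl]] continuous_on_power continuous_on_norm_id) auto
  have "continuous_on {z::complex^4. norm z \<ge> 1} (\<lambda>z. Im (sheet_B \<sigma> (of_real ((arcosh ((norm z)\<^sup>2) / 2)\<^sup>2))))"
    by (intro continuous_on_Im continuous_on_sheet(2)[OF 1]) simp
  moreover have "Im (sheet_B \<sigma> (of_real ((arcosh ((norm z)\<^sup>2) / 2)\<^sup>2))) \<noteq> 0" if "norm z \<ge> 1" for z :: "complex^4"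
    using sheet_B_real(2)[of "arcosh ((norm z)\<^sup>2) / 2" \<sigma>] ge[OF that] by simp
  moreover have "continuous_on S (\<lambda>z. spatial (im_vec z))" for S
  proof -
    have "(\<lambda>z. spatial (im_vec z)) = (\<lambda>z. \<chi> i. Im (z $ (if i = 1 then 2 else if i = 2 then 3 else 4)))"
      by (simp add: fun_eq_iff vec_eq_iff forall_3)
    then show ?thesis
      by (simp only:) (intro continuous_intros)
  qed
  ultimately show ?thesis
    unfolding sheet_inv_def by (intro continuous_on_scaleR continuous_on_divide continuous_on_const ballI) auto
qed

lemma sheet_map_nth:
  "sheet_map \<tau> \<sigma> y $ 1 = of_real \<tau> * sheet_A \<sigma> (of_real (y \<bullet> y))"
  "sheet_map \<tau> \<sigma> y $ 2 = sheet_B \<sigma> (of_real (y \<bullet> y)) * of_real (y $ 1)"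
  "sheet_map \<tau> \<sigma> y $ 3 = sheet_B \<sigma> (of_real (y \<bullet> y)) * of_real (y $ 2)"
  "sheet_map \<tau> \<sigma> y $ 4 = sheet_B \<sigma> (of_real (y \<bullet> y)) * of_real (y $ 3)"
  by (simp_all add: sheet_map_def power2_norm_eq_inner)

lemma of_real_inner_sheet_dom: "of_real (y \<bullet> y) \<in> sheet_dom"
  using sheet_dom_of_real[of "norm y"] by (simp add: power2_norm_eq_inner[symmetric] del: of_real_power)

lemma smooth_sheet_map: "smooth_on (sheet_map \<tau> \<sigma>) UNIV"
proof (rule smooth_on_vec[OF open_UNIV])
  have "smooth_on (\<lambda>y::real^3. complex_of_real (y \<bullet> y)) UNIV"
    by (intro smooth_on_of_real smooth_on_bilinear[OF open_UNIV bounded_bilinear_inner] smooth_on_ident open_UNIV)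
  then have "smooth_on (\<lambda>y::real^3. h (of_real (y \<bullet> y))) UNIV" if "h holomorphic_on sheet_dom" for h
    by (rule smooth_on_holomorphic_compose[OF open_UNIV open_sheet_dom that]) (auto intro: of_real_inner_sheet_dom)
  note * = this[OF holomorphic_sheet(1)] this[OF holomorphic_sheet(2)]
  show "smooth_on (\<lambda>y. sheet_map \<tau> \<sigma> y $ i) UNIV" for i
    using exhaust_4[of i] by (auto simp: sheet_map_nth intro!: smooth_intros *)
qed

text \<open>\<open>sheet_inv\<close> contains arcosh, singular at the value 1 taken at the pole, so
  injectivity is checked directly. For v in the kernel, |z|^2 = cosh (2 |y|) has derivative 0 along
  v, hence y is orthogonal to v; then the derivatives of the last three coordinates reduce to
  \<open>sheet_B\<close> times v.\<close>

lemma inj_frechet_sheet_map: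
  assumes \<sigma>: "\<sigma> \<in> {1, -1}" "\<tau> \<in> {1, -1}"
  shows "inj (frechet_derivative (sheet_map \<tau> \<sigma>) (at y))"
proof -
  let ?\<phi> = "sheet_map \<tau> \<sigma>"
  let ?D = "frechet_derivative (sheet_map \<tau> \<sigma>) (at y)"
  have D: "(?\<phi> has_derivative ?D) (at y)"
    by (rule smooth_on_has_derivative[OF smooth_sheet_map UNIV_I])
  have "v = 0" if v: "?D v = 0" for v
  proof -
    have yv: "y \<bullet> v = 0"
    proof (cases "y = 0")
      case False
      have "((\<lambda>x. ?\<phi> x \<bullet> ?\<phi> x) has_derivative (\<lambda>v. ?\<phi> y \<bullet> ?D v + ?D v \<bullet> ?\<phi> y)) (at y)"
        by (rule has_derivative_inner[OF D D])
      moreover have "?\<phi> x \<bullet> ?\<phi> x = cosh (2 * sqrt (x \<bullet> x))" for x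
        using norm_sheet_map[OF \<sigma>, of x] by (simp add: power2_norm_eq_inner norm_eq_sqrt_inner)
      ultimately have 1: "((\<lambda>x. cosh (2 * sqrt (x \<bullet> x))) has_derivative (\<lambda>v. ?\<phi> y \<bullet> ?D v + ?D v \<bullet> ?\<phi> y)) (at y)"
        by simp
      have "y \<bullet> y > 0"
        using False by simp
      then have "((\<lambda>r. cosh (2 * sqrt r)) has_field_derivative sinh (2 * sqrt (y \<bullet> y)) * (inverse (sqrt (y \<bullet> y)))) (at (y \<bullet> y))"
        by (auto intro!: derivative_eq_intros simp del: inner_gt_zero_iff)
      then have 2: "((\<lambda>r. cosh (2 * sqrt r)) has_derivative (*) (sinh (2 * sqrt (y \<bullet> y)) * (inverse (sqrt (y \<bullet> y))))) (at (y \<bullet> y))"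
        by (simp add: has_field_derivative_def)
      have 3: "((\<lambda>x. x \<bullet> x) has_derivative (\<lambda>v. y \<bullet> v + v \<bullet> y)) (at y)"
        by (rule has_derivative_inner[OF has_derivative_ident has_derivative_ident])
      from has_derivative_unique[OF 1 has_derivative_compose[OF 3 2]]
      have "?\<phi> y \<bullet> ?D v + ?D v \<bullet> ?\<phi> y = sinh (2 * sqrt (y \<bullet> y)) * inverse (sqrt (y \<bullet> y)) * (y \<bullet> v + v \<bullet> y)"
        by metis
      then show ?thesis
        using False by (simp add: v inner_commute[of v y])
    qed simp
    define b where "b = sheet_B \<sigma> (of_real (y \<bullet> y))"
    have b: "b \<noteq> 0"
      using sheet_B_real(2)[of "norm y" \<sigma>] by (auto simp: b_def power2_norm_eq_inner[symmetric] simp del: of_real_power)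
    have "v $ i = 0" for i
    proof -
      define j where "j = (if i = 1 then 2 else if i = 2 then 3 else 4 :: 4)"
      have j: "?\<phi> x $ j = sheet_B \<sigma> (of_real (x \<bullet> x)) * of_real (x $ i)" for x
        using exhaust_3[of i] by (auto simp: j_def sheet_map_nth)
      have "((\<lambda>x. complex_of_real (x \<bullet> x)) has_derivative (\<lambda>v. of_real (y \<bullet> v + v \<bullet> y))) (at y)"
        by (intro has_derivative_of_real has_derivative_inner has_derivative_ident)
      moreover have "(sheet_B \<sigma> has_derivative (*) (deriv (sheet_B \<sigma>) (of_real (y \<bullet> y)))) (at (of_real (y \<bullet> y)))"
        using holomorphic_derivI[OF holomorphic_sheet(2) open_sheet_dom of_real_inner_sheet_dom]
        by (simp add: has_field_derivative_def)
      ultimately have "((\<lambda>x. sheet_B \<sigma> (of_real (x \<bullet> x))) has_derivative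
          (\<lambda>v. deriv (sheet_B \<sigma>) (of_real (y \<bullet> y)) * of_real (y \<bullet> v + v \<bullet> y))) (at y)"
        by (rule has_derivative_compose)
      moreover have "((\<lambda>x::real^3. complex_of_real (x $ i)) has_derivative (\<lambda>v. of_real (v $ i))) (at y)"
        by (intro has_derivative_of_real bounded_linear.has_derivative[OF bounded_linear_vec_nth has_derivative_ident])
      ultimately have "((\<lambda>x. ?\<phi> x $ j) has_derivative
         (\<lambda>v. b * of_real (v $ i) + deriv (sheet_B \<sigma>) (of_real (y \<bullet> y)) * of_real (y \<bullet> v + v \<bullet> y) * of_real (y $ i))) (at y)"
        unfolding j b_def by (rule has_derivative_mult)
      moreover have "((\<lambda>x. ?\<phi> x $ j) has_derivative (\<lambda>v. ?D v $ j)) (at y)"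
        by (rule bounded_linear.has_derivative[OF bounded_linear_vec_nth D])
      ultimately have "(\<lambda>v. b * of_real (v $ i) + deriv (sheet_B \<sigma>) (of_real (y \<bullet> y)) * of_real (y \<bullet> v + v \<bullet> y) * of_real (y $ i))
          = (\<lambda>v. ?D v $ j)"
        by (rule has_derivative_unique)
      from fun_cong[OF this, of v] show ?thesis
        using b by (simp add: v yv inner_commute[of v y])
    qed
    then show ?thesis
      by (simp add: vec_eq_iff)
  qed
  moreover have "linear ?D"
    using D has_derivative_linear by blast
  ultimately show ?thesis
    using linear_injective_0 by blast
qed

lemma range_sheet_map_norm_ge: "\<sigma> \<in> {1, -1} \<Longrightarrow> \<tau> \<in> {1, -1} \<Longrightarrow> range (sheet_map \<tau> \<sigma>) \<subseteq> {z. norm z \<ge> 1}"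
  using sheet_map_in_Lq Lq_subset_quadric norm_quadric_ge_1 by blast

lemma sheet_chart:
  assumes "\<sigma> \<in> {1, -1}" "\<tau> \<in> {1, -1}"
  shows "chart3 (range (sheet_map \<tau> \<sigma>)) p"
proof -
  have "continuous_on UNIV (sheet_map \<tau> \<sigma>)"
    using smooth_sheet_map unfolding smooth_on_def by (metis Ck_on.simps(1))
  then have "homeomorphism UNIV (range (sheet_map \<tau> \<sigma>) \<inter> UNIV) (sheet_map \<tau> \<sigma>) (sheet_inv \<sigma>)"
    using sheet_inv_sheet_map[OF assms] continuous_on_subset[OF continuous_on_sheet_inv range_sheet_map_norm_ge[OF assms]]
    by (intro homeomorphismI) auto
  then show ?thesis
    unfolding chart3_def
    by (intro exI[of _ UNIV] exI[of _ "sheet_map \<tau> \<sigma>"] exI[of _ "sheet_inv \<sigma>"] conjI ballI open_UNIV UNIV_I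
        smooth_sheet_map inj_frechet_sheet_map[OF assms])
qed

text \<open>The sheet is the fixed-point set of the continuous map \<open>sheet_map\<close> after
  \<open>sheet_inv\<close> on a closed domain.\<close>

lemma closed_sheet:
  assumes "\<sigma> \<in> {1, -1}" "\<tau> \<in> {1, -1}"
  shows "closed (range (sheet_map \<tau> \<sigma>))"
proof -
  have 1: "closed {z::complex^4. norm z \<ge> 1}"
    by (intro closed_Collect_le continuous_intros)
  have "continuous_on UNIV (sheet_map \<tau> \<sigma>)"
    using smooth_sheet_map unfolding smooth_on_def by (metis Ck_on.simps(1))
  then have "continuous_on {z. norm z \<ge> 1} (\<lambda>z. sheet_map \<tau> \<sigma> (sheet_inv \<sigma> z) - z)"
    by (intro continuous_intros continuous_on_compose2[OF _ continuous_on_sheet_inv]) auto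
  from continuous_closed_preimage[OF this 1 closed_singleton[of 0]]
  have "closed ({z. norm z \<ge> 1} \<inter> (\<lambda>z. sheet_map \<tau> \<sigma> (sheet_inv \<sigma> z) - z) -` {0})" .
  moreover have "{z. norm z \<ge> 1} \<inter> (\<lambda>z. sheet_map \<tau> \<sigma> (sheet_inv \<sigma> z) - z) -` {0} = range (sheet_map \<tau> \<sigma>)"
  proof (intro equalityI subsetI)
    fix z
    assume "z \<in> {z. norm z \<ge> 1} \<inter> (\<lambda>z. sheet_map \<tau> \<sigma> (sheet_inv \<sigma> z) - z) -` {0}"
    then have "z = sheet_map \<tau> \<sigma> (sheet_inv \<sigma> z)"
      by simp
    then show "z \<in> range (sheet_map \<tau> \<sigma>)"
      by (rule range_eqI)
  next
    fix z
    assume "z \<in> range (sheet_map \<tau> \<sigma>)"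
    then show "z \<in> {z. norm z \<ge> 1} \<inter> (\<lambda>z. sheet_map \<tau> \<sigma> (sheet_inv \<sigma> z) - z) -` {0}"
      using range_sheet_map_norm_ge[OF assms] sheet_inv_sheet_map[OF assms] by auto
  qed
  ultimately show ?thesis
    by simp
qed

text \<open>Meant for a pole, where the coordinate L vanishes. Along a curve the product of L and h
  is real; dividing by s before s -> 0 turns L (gamma s) into L v and h (gamma s) into h z, so
  continuity of h is enough.\<close>

lemma tangent_limit:
  fixes L :: "'a::real_normed_vector \<Rightarrow> complex"
  assumes v: "v \<in> tangent_space M z" and L: "bounded_linear L" "L z = 0" and h: "continuous_on M h"
    and M: "\<And>x. x \<in> M \<Longrightarrow> Im (L x * h x) = 0"
  shows "Im (L v * h z) = 0"
proof -
  obtain \<gamma> \<epsilon> where \<epsilon>: "\<epsilon> > 0" "\<And>s::real. \<bar>s\<bar> < \<epsilon> \<Longrightarrow> \<gamma> s \<in> M" and \<gamma>0: "\<gamma> 0 = z"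
    and \<gamma>: "(\<gamma> has_vector_derivative v) (at 0)"
    using v unfolding tangent_space_def by blast
  have ev: "\<forall>\<^sub>F s in at 0. \<gamma> s \<in> M"
    unfolding eventually_at using \<epsilon> by (intro exI[of _ \<epsilon>]) (auto simp: dist_real_def)
  have zM: "z \<in> M"
    using \<epsilon>(2)[of 0] \<epsilon>(1) \<gamma>0 by simp
  have lim: "((\<lambda>s. norm (\<gamma> s - \<gamma> 0 - s *\<^sub>R v) / norm s) \<longlongrightarrow> 0) (at 0)"
    using \<gamma> unfolding has_vector_derivative_def has_derivative_at by simp
  have "((\<lambda>s. norm ((\<gamma> s - \<gamma> 0) /\<^sub>R (s - 0) - v)) \<longlongrightarrow> 0) (at 0)"
  proof (rule Lim_transform_eventually[OF lim])
    have quot: "norm (d - s *\<^sub>R v) / norm s = norm (d /\<^sub>R s - v)" if "s \<noteq> 0" for s and d :: 'a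
    proof -
      have "d /\<^sub>R s - v = inverse s *\<^sub>R (d - s *\<^sub>R v)"
        using that by (simp add: scaleR_right_diff_distrib)
      then show ?thesis
        by (simp only: norm_scaleR real_norm_def abs_inverse divide_inverse_commute)
    qed
    have "norm (\<gamma> s - \<gamma> 0 - s *\<^sub>R v) / norm s = norm ((\<gamma> s - \<gamma> 0) /\<^sub>R (s - 0) - v)" if "s \<noteq> 0" for s
      unfolding diff_0_right by (rule quot[OF that])
    then show "\<forall>\<^sub>F s in at 0. norm (\<gamma> s - \<gamma> 0 - s *\<^sub>R v) / norm s = norm ((\<gamma> s - \<gamma> 0) /\<^sub>R (s - 0) - v)"
      by (rule eventually_mono[OF eventually_neq_at_within])
  qed
  then have "((\<lambda>s. (\<gamma> s - \<gamma> 0) /\<^sub>R (s - 0)) \<longlongrightarrow> v) (at 0)"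
    by (rule LIM_zero_cancel[OF tendsto_norm_zero_cancel])
  then have "((\<lambda>s. L ((\<gamma> s - \<gamma> 0) /\<^sub>R (s - 0))) \<longlongrightarrow> L v) (at 0)"
    by (rule bounded_linear.tendsto[OF L(1)])
  moreover have "L ((\<gamma> s - \<gamma> 0) /\<^sub>R (s - 0)) = L (\<gamma> s) /\<^sub>R s" for s
    using L(2) by (simp add: linear_simps[OF L(1)] \<gamma>0)
  ultimately have 1: "((\<lambda>s. L (\<gamma> s) /\<^sub>R s) \<longlongrightarrow> L v) (at 0)"
    by simp
  have "(\<gamma> \<longlongrightarrow> z) (at 0)"
    using has_vector_derivative_continuous[OF \<gamma>] \<gamma>0 by (simp add: isCont_def)
  then have "((\<lambda>s. h (\<gamma> s)) \<longlongrightarrow> h z) (at 0)"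
    by (rule continuous_on_tendsto_compose[OF h _ zM ev])
  with 1 have "((\<lambda>s. Im (L (\<gamma> s) /\<^sub>R s * h (\<gamma> s))) \<longlongrightarrow> Im (L v * h z)) (at 0)"
    by (intro tendsto_Im tendsto_mult)
  moreover have "\<forall>\<^sub>F s in at 0. Im (L (\<gamma> s) /\<^sub>R s * h (\<gamma> s)) = 0"
    using ev
  proof eventually_elim
    case (elim s)
    then show ?case
      using M[OF elim] by simp
  qed
  then have "((\<lambda>s. Im (L (\<gamma> s) /\<^sub>R s * h (\<gamma> s))) \<longlongrightarrow> 0) (at 0)"
    by (rule tendsto_eventually)
  ultimately show ?thesis
    by (rule tendsto_unique[rotated]) simp
qed

text \<open>The number sigma / sqrt 3 + i has argument pi / 3 or 2 pi / 3: the value 1/3 of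
  \<open>sheet_P\<close> at 0 makes the sheets meet the zero section at exactly the special
  angles.\<close>

lemma sheet_B_0_cube: "\<sigma> \<in> {1, -1} \<Longrightarrow> (sheet_B \<sigma> 0) ^ 3 \<in> \<real>"
proof -
  assume "\<sigma> \<in> {1, -1}"
  define x where "x = \<sigma> * sqrt (1 / 3)"
  have "x\<^sup>2 = 1 / 3"
    using \<open>\<sigma> \<in> {1, -1}\<close> by (auto simp: x_def power_mult_distrib)
  moreover have "Im ((Complex x 1) ^ 3) = 3 * x\<^sup>2 - 1"
    by (simp add: power3_eq_cube power2_eq_square algebra_simps)
  ultimately show ?thesis
    unfolding sheet_0 x_def[symmetric] by (simp add: complex_is_Real_iff)
qed

lemma continuous_sheet_B_inv:
  assumes "\<sigma> \<in> {1, -1}" "\<tau> \<in> {1, -1}"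
  shows "continuous_on (range (sheet_map \<tau> \<sigma>)) (\<lambda>z. sheet_B \<sigma> (of_real ((norm (sheet_inv \<sigma> z))\<^sup>2)))"
  by (intro continuous_on_sheet(2) continuous_on_norm continuous_on_subset[OF continuous_on_sheet_inv range_sheet_map_norm_ge[OF assms]])
    simp

text \<open>T lies in b times a real 3-space orthogonal to z: Hermitian products are |b|^2 times
  real numbers, and the volume form is b^3 times a real number.\<close>

lemma special_lagrangian_at_pole:
  assumes v: "\<And>v. v \<in> T \<Longrightarrow> \<exists>f. v = cvec 0 b f" and b: "b ^ 3 \<in> \<real>"
    and z: "z = cvec (of_real \<tau>) 0 0" "z \<in> quadric"
  shows "v \<in> T \<Longrightarrow> w \<in> T \<Longrightarrow> stenzel_form \<kappa> z v w = 0"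
    and "v1 \<in> T \<Longrightarrow> v2 \<in> T \<Longrightarrow> v3 \<in> T \<Longrightarrow> Im (stenzel_volume z v1 v2 v3) = 0"
proof -
  show "stenzel_form \<kappa> z v w = 0" if vw: "v \<in> T" "w \<in> T"
  proof (rule stenzel_form_zeroI[OF z(2)])
    obtain f g where fg: "v = cvec 0 b f" "w = cvec 0 b g"
      using v[OF vw(1)] v[OF vw(2)] by blast
    have "herm v w = of_real ((cmod b)\<^sup>2 * (f \<bullet> g))"
      unfolding fg herm_cvec of_real_mult complex_norm_square by simp
    then show "herm v w \<in> \<real>"
      by (simp only: Reals_of_real)
    have "herm v z = 0"
      unfolding fg z(1) herm_cvec by simp
    then show "herm v z * cnj (herm w z) \<in> \<real>"
      by simp
  qed
  show "Im (stenzel_volume z v1 v2 v3) = 0" if vs: "v1 \<in> T" "v2 \<in> T" "v3 \<in> T"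
  proof -
    obtain f1 f2 f3 where f: "v1 = cvec 0 b f1" "v2 = cvec 0 b f2" "v3 = cvec 0 b f3"
      using v[OF vs(1)] v[OF vs(2)] v[OF vs(3)] by blast
    have "stenzel_volume z v1 v2 v3 = of_real \<tau> * tri (b *s cvec3 f1) (b *s cvec3 f2) (b *s cvec3 f3)"
      unfolding f z(1)
      by (subst volume_cofactor[where b = 0 and x = 0 and p = "b *s cvec3 f1" and q = "b *s cvec3 f2" and r = "b *s cvec3 f3"])
        (simp_all add: cvec3_def)
    also have "\<dots> = of_real (\<tau> * (f1 \<bullet> cross3 f2 f3)) * b ^ 3"
      unfolding tri_mult tri_cvec3 by (simp add: power3_eq_cube)
    finally show ?thesis
      using Reals_mult[OF Reals_of_real b] by (simp only: complex_is_Real_iff)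
  qed
qed

lemma sheet_tangent_0:
  assumes \<sigma>: "\<sigma> \<in> {1, -1}" "\<tau> \<in> {1, -1}"
    and v: "v \<in> tangent_space (range (sheet_map \<tau> \<sigma>)) (cvec (of_real \<tau>) 0 0)"
  shows "\<exists>f. v = cvec 0 (sheet_B \<sigma> 0) f"
proof -
  let ?M = "range (sheet_map \<tau> \<sigma>)"
  have "?M \<inter> UNIV \<subseteq> quadric"
    using sheet_map_in_Lq[OF \<sigma>] Lq_subset_quadric by blast
  from quadric_tangent[OF this open_UNIV UNIV_I v] have v1: "v $ 1 = 0"
    using \<sigma>(2) by (auto simp: sum_4)
  define b where "b = sheet_B \<sigma> 0"
  have b: "b \<noteq> 0"
    by (simp add: b_def sheet_0 complex_eq_iff)
  have "Im (v $ j * cnj b) = 0" if j: "j \<in> {2, 3, 4}" for j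
  proof -
    \<comment> \<open>Each of the last three coordinates is \<open>sheet_B\<close> at |y|^2 times a
      real number, so multiplying by the conjugate of that factor gives a real number;
      \<open>tangent_limit\<close> carries this to the pole.\<close>
    have "Im (x $ j * cnj (sheet_B \<sigma> (of_real ((norm (sheet_inv \<sigma> x))\<^sup>2)))) = 0" if "x \<in> ?M" for x
    proof -
      from that obtain y where x: "x = sheet_map \<tau> \<sigma> y"
        by blast
      obtain r :: real where "x $ j = sheet_B \<sigma> (of_real ((norm y)\<^sup>2)) * of_real r"
        using j unfolding x sheet_map_def by (elim insertE emptyE) (auto simp only: cvec_nth intro: that)
      then show ?thesis
        unfolding x sheet_inv_sheet_map[OF \<sigma>] by simp
    qed
    from tangent_limit[OF v bounded_linear_vec_nth _ continuous_on_cnj[OF continuous_sheet_B_inv[OF \<sigma>]] this]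
    have "Im (v $ j * cnj (sheet_B \<sigma> (of_real ((norm (sheet_inv \<sigma> (cvec (of_real \<tau>) 0 0)))\<^sup>2)))) = 0"
      using j by auto
    then show ?thesis
      unfolding sheet_map_0[of \<tau> \<sigma>, symmetric] sheet_inv_sheet_map[OF \<sigma>] by (simp add: b_def)
  qed
  then have "v $ j = b * of_real (Re (v $ j * cnj b) / (cmod b)\<^sup>2)" if "j \<in> {2, 3, 4}" for j
  proof -
    have r: "v $ j * cnj b = of_real (Re (v $ j * cnj b))"
      using \<open>\<And>j. j \<in> {2, 3, 4} \<Longrightarrow> Im (v $ j * cnj b) = 0\<close>[OF that] by (simp add: complex_eq_iff)
    have "v $ j * of_real ((cmod b)\<^sup>2) = b * of_real (Re (v $ j * cnj b))"
      unfolding r[symmetric] complex_norm_square by (simp add: mult_ac)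
    then show ?thesis
      using b by (simp add: field_simps)
  qed
  then have "v = cvec 0 b (vector [Re (v $ 2 * cnj b) / (cmod b)\<^sup>2, Re (v $ 3 * cnj b) / (cmod b)\<^sup>2, Re (v $ 4 * cnj b) / (cmod b)\<^sup>2])"
    unfolding vec_eq_iff forall_4 cvec_nth vector_3 using v1 by blast
  then show ?thesis
    unfolding b_def by blast
qed

lemma quadric_pole_iff: "z \<in> Lq c \<Longrightarrow> z $ 1 = of_real \<tau> \<Longrightarrow> \<tau> \<in> {1, -1} \<Longrightarrow> z = cvec (of_real \<tau>) 0 0"
proof -
  assume z: "z \<in> Lq c" "z $ 1 = of_real \<tau>" "\<tau> \<in> {1, -1}"
  then obtain w e where w: "z = cvec (cos w) (sin w) e"
    unfolding Lq_def by blast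
  then have "(cos w)\<^sup>2 = 1"
    using z by auto
  then have "sin w = 0"
    using sin_cos_squared_add[of w] by simp
  then show ?thesis
    using z(2) by (simp add: w vec_eq_iff forall_4)
qed

lemma special_lagrangian_sheet:
  assumes \<sigma>: "\<sigma> \<in> {1, -1}" "\<tau> \<in> {1, -1}"
  shows "special_lagrangian_quadric \<kappa> (range (sheet_map \<tau> \<sigma>))"
proof -
  let ?M = "range (sheet_map \<tau> \<sigma>)"
  have sub: "?M \<subseteq> Lq 0"
    using sheet_map_in_Lq[OF \<sigma>] by blast
  have sq: "?M \<subseteq> quadric"
    using sub Lq_subset_quadric by blast
  \<comment> \<open>A first coordinate 1 or -1 forces |z| = 1, hence y = 0: a sheet meets only the
    pole given by its tau.\<close>
  have pole: "z = cvec (of_real \<tau>) 0 0" if z: "z \<in> ?M" "z $ 1 = 1 \<or> z $ 1 = - 1" for z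
  proof -
    from z(2) obtain r :: real where r: "r \<in> {1, -1}" "z $ 1 = of_real r"
      by (metis insertCI of_real_1 of_real_minus)
    then have zr: "z = cvec (of_real r) 0 0"
      using quadric_pole_iff z(1) sub by blast
    obtain y where y: "z = sheet_map \<tau> \<sigma> y"
      using z(1) by blast
    have "(norm z)\<^sup>2 = 1"
      using norm_cvec[of "axis 1 1" "of_real r" 0] r(1) by (auto simp: zr cvec_def)
    then have "cosh (2 * norm y) = 1"
      using norm_sheet_map[OF \<sigma>, of y] y by simp
    then have "y = 0"
      by simp
    then show ?thesis
      by (simp add: y sheet_map_0)
  qed
  have pole_sl: "v \<in> tangent_space ?M z \<Longrightarrow> w \<in> tangent_space ?M z \<Longrightarrow> stenzel_form \<kappa> z v w = 0"
    "v1 \<in> tangent_space ?M z \<Longrightarrow> v2 \<in> tangent_space ?M z \<Longrightarrow> v3 \<in> tangent_space ?M z \<Longrightarrow>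
      Im (stenzel_volume z v1 v2 v3) = 0" if z: "z \<in> ?M" for z v w v1 v2 v3
  proof -
    consider "z = cvec (of_real \<tau>) 0 0" | "z $ 1 \<noteq> 1" "z $ 1 \<noteq> -1"
      using pole[OF z] by blast
    then have "(v \<in> tangent_space ?M z \<longrightarrow> w \<in> tangent_space ?M z \<longrightarrow> stenzel_form \<kappa> z v w = 0) \<and>
      (v1 \<in> tangent_space ?M z \<longrightarrow> v2 \<in> tangent_space ?M z \<longrightarrow> v3 \<in> tangent_space ?M z \<longrightarrow>
      Im (stenzel_volume z v1 v2 v3) = 0)"
    proof cases
      case 1
      have "z \<in> quadric"
        using z sq by blast
      then show ?thesis
        using special_lagrangian_at_pole[where T = "tangent_space ?M z" and b = "sheet_B \<sigma> 0", OF _ sheet_B_0_cube[OF \<sigma>(1)] 1]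
          sheet_tangent_0[OF \<sigma>] 1 by blast
    next
      case 2
      have "?M \<inter> UNIV \<subseteq> Lq 0"
        using sub by simp
      then show ?thesis
        using Lq_special_lagrangian_at[OF _ open_UNIV z UNIV_I 2] by blast
    qed
    then show "v \<in> tangent_space ?M z \<Longrightarrow> w \<in> tangent_space ?M z \<Longrightarrow> stenzel_form \<kappa> z v w = 0"
      "v1 \<in> tangent_space ?M z \<Longrightarrow> v2 \<in> tangent_space ?M z \<Longrightarrow> v3 \<in> tangent_space ?M z \<Longrightarrow>
      Im (stenzel_volume z v1 v2 v3) = 0"
      by blast+
  qed
  show ?thesis
    unfolding special_lagrangian_quadric_def submanifold3_iff
    by (intro conjI ballI sq sheet_chart[OF \<sigma>]) (fact pole_sl)+
qed

section \<open>The zero section\<close>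

definition sphere_q :: "(complex^4) set" where
  "sphere_q = {z\<in>quadric. im_vec z = 0}"

definition complexify :: "real^4 \<Rightarrow> complex^4" where
  "complexify x = (\<chi> j. of_real (x $ j))"

definition hemisphere4 :: "real^3 \<Rightarrow> real^4" where
  "hemisphere4 y = vector [sqrt (1 - y \<bullet> y), y$1, y$2, y$3]"

lemma complexify_in_sphere_q: "norm x = 1 \<Longrightarrow> complexify x \<in> sphere_q"
proof -
  assume "norm x = 1"
  moreover have "re_vec (complexify x) = x" "im_vec (complexify x) = 0"
    by (simp_all add: vec_eq_iff complexify_def)
  ultimately show ?thesis
    by (simp add: sphere_q_def quadric_iff norm_eq_1)
qed

lemma sphere_qE:
  assumes "z \<in> sphere_q"
  shows "norm (re_vec z) = 1" "z = complexify (re_vec z)"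
proof -
  show "norm (re_vec z) = 1"
    using assms by (auto simp: sphere_q_def quadric_iff norm_eq_1)
  have "im_vec z $ j = 0" for j
    using assms by (simp add: sphere_q_def)
  then show "z = complexify (re_vec z)"
    by (simp add: complexify_def vec_eq_iff complex_eq_iff)
qed

lemma sphere_chart:
  assumes "p \<in> sphere_q"
  shows "chart3 sphere_q p"
proof -
  obtain R where R: "rotation_matrix R" "R *v axis 1 1 = re_vec p"
    using rotation_matrix_exists_basis[of "re_vec p" 1] sphere_qE(1)[OF assms] by auto
  define \<phi> where "\<phi> y = complexify (R *v hemisphere4 y)" for y
  define Q where "Q z = transpose R *v re_vec z" for z
  define U where "U = {z. Q z $ 1 > 0}"
  define \<psi> where "\<psi> z = spatial (Q z)" for z
  define V where "V = {y::real^3. y \<bullet> y < 1}"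
  have oV: "open V"
    unfolding V_def by (intro open_Collect_less continuous_intros)
  have Q_nth: "Q z $ i = (\<Sum>j\<in>UNIV. transpose R $ i $ j * Re (z $ j))" for z i
    by (simp add: Q_def matrix_vector_mult_def)
  have smQ: "smooth_on (\<lambda>z. Q z $ i) S" if "open S" for S i
    unfolding Q_nth sum_4
    by (intro smooth_on_add smooth_on_mult smooth_on_const smooth_on_Re smooth_on_nth that)
  have oU: "open U"
    unfolding U_def Q_nth by (intro open_Collect_less continuous_intros)
  have sm\<psi>: "smooth_on \<psi> U"
  proof (rule smooth_on_vec[OF oU])
    show "smooth_on (\<lambda>z. \<psi> z $ i) U" for i
      using exhaust_3[of i] unfolding \<psi>_def by (auto intro!: smQ oU)
  qed
  have "smooth_on (\<lambda>y::real^3. 1 - y \<bullet> y) V"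
    by (intro smooth_on_diff smooth_on_const smooth_on_bilinear[OF oV bounded_bilinear_inner] smooth_on_ident oV)
  then have "smooth_on (\<lambda>y::real^3. sqrt (1 - y \<bullet> y)) V"
    by (rule smooth_on_sqrt[OF oV]) (simp add: V_def)
  then have smh: "smooth_on (\<lambda>y. hemisphere4 y $ i) V" for i
    using exhaust_4[of i] unfolding hemisphere4_def by (auto intro!: smooth_intros oV)
  have sm\<phi>: "smooth_on \<phi> V"
  proof (rule smooth_on_vec[OF oV])
    have "(\<lambda>y. \<phi> y $ i) = (\<lambda>y. of_real (R$i$1 * hemisphere4 y $ 1 + R$i$2 * hemisphere4 y $ 2
        + R$i$3 * hemisphere4 y $ 3 + R$i$4 * hemisphere4 y $ 4))" for i
      by (simp add: \<phi>_def complexify_def matrix_vector_mult_def sum_4)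
    then show "smooth_on (\<lambda>y. \<phi> y $ i) V" for i
      by (simp only:) (intro smooth_on_of_real smooth_on_add smooth_on_mult smooth_on_const smh oV)
  qed
  have re\<phi>: "Q (\<phi> y) = hemisphere4 y" for y
  proof -
    have "re_vec (\<phi> y) = R *v hemisphere4 y"
      by (simp add: \<phi>_def complexify_def vec_eq_iff)
    then show ?thesis
      by (simp only: Q_def rotation_transpose(2)[OF R(1)])
  qed
  show ?thesis
  proof (rule chart3I_smooth_inverse[OF oU _ oV sm\<phi> sm\<psi>])
    show "p \<in> U"
      using rotation_transpose(2)[OF R(1), of "axis 1 1"] by (simp add: U_def Q_def R(2)[symmetric])
    show "\<phi> y \<in> sphere_q \<and> \<phi> y \<in> U \<and> \<psi> (\<phi> y) = y" if "y \<in> V" for y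
    proof -
      have y: "y \<bullet> y < 1"
        using that by (simp add: V_def)
      then have "hemisphere4 y \<bullet> hemisphere4 y = 1"
        by (simp add: hemisphere4_def inner_vec_def sum_4 sum_3)
      then have "\<phi> y \<in> sphere_q"
        unfolding \<phi>_def by (intro complexify_in_sphere_q) (simp add: rotation_matrix_norm[OF R(1)] norm_eq_1)
      then show ?thesis
        using y by (simp add: U_def \<psi>_def re\<phi>) (simp add: hemisphere4_def vec_eq_iff forall_3)
    qed
    show "\<psi> z \<in> V \<and> \<phi> (\<psi> z) = z" if z: "z \<in> sphere_q" "z \<in> U" for z
    proof -
      have Q1: "Q z $ 1 > 0"
        using z(2) by (simp add: U_def)
      have "norm (Q z) = 1"
        using sphere_qE(1)[OF z(1)] rotation_transpose(1)[OF R(1)] by (simp add: Q_def rotation_matrix_norm)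
      then have "(Q z $ 1)\<^sup>2 + spatial (Q z) \<bullet> spatial (Q z) = 1"
        by (simp add: norm_eq_1 inner_spatial[of "Q z"] power2_eq_square)
      then have 1: "1 - \<psi> z \<bullet> \<psi> z = (Q z $ 1)\<^sup>2"
        by (simp add: \<psi>_def)
      then have "hemisphere4 (\<psi> z) = Q z"
        unfolding hemisphere4_def 1 using Q1 by (simp add: \<psi>_def vec_eq_iff forall_4)
      then have "\<phi> (\<psi> z) = complexify (re_vec z)"
        by (simp add: \<phi>_def Q_def rotation_transpose(3)[OF R(1)])
      moreover have "\<psi> z \<in> V"
        using 1 zero_less_power[OF Q1, of 2] unfolding V_def mem_Collect_eq by linarith
      ultimately show ?thesis
        using sphere_qE(2)[OF z(1)] by simp
    qed
  qed
qed

text \<open>The zero section consists of the real points, so its tangent vectors are real, and so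
  are their Hermitian products and determinants. The argument covers the poles at the same
  time.\<close>

lemma special_lagrangian_sphere: "special_lagrangian_quadric \<kappa> sphere_q"
proof -
  have real: "v $ j \<in> \<real>" if "v \<in> tangent_space sphere_q z" for v z j
  proof -
    have "((\<lambda>x. Im (x $ j)) has_derivative (\<lambda>v. Im (v $ j))) (at z)"
      by (intro has_derivative_Im bounded_linear.has_derivative[OF bounded_linear_vec_nth has_derivative_ident])
    moreover have "Im (x $ j) = 0" if "x \<in> sphere_q" for x
      using that by (auto simp: sphere_q_def vec_eq_iff)
    ultimately have "Im (v $ j) = 0"
      by (intro tangent_const[OF that open_UNIV UNIV_I, where k = 0 and g' = "\<lambda>v. Im (v $ j)"])
    then show ?thesis
      by (simp add: complex_is_Real_iff)
  qed
  have cnj_real: "x \<in> \<real> \<Longrightarrow> cnj x \<in> \<real>" for x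
    by (simp add: complex_is_Real_iff)
  have zr: "z $ j \<in> \<real>" if "z \<in> sphere_q" for z j
    using that by (auto simp: sphere_q_def vec_eq_iff complex_is_Real_iff)
  have herm: "herm v w \<in> \<real>" if "\<And>j. v $ j \<in> \<real>" "\<And>j. w $ j \<in> \<real>" for v w
    unfolding herm_def by (intro sum_in_Reals Reals_mult cnj_real that)
  have "stenzel_form \<kappa> z v w = 0"
    if z: "z \<in> sphere_q" and v: "v \<in> tangent_space sphere_q z" and w: "w \<in> tangent_space sphere_q z" for z v w
    using z by (intro stenzel_form_zeroI herm Reals_mult cnj_real real[OF v] real[OF w] zr[OF z]) (auto simp: sphere_q_def)
  moreover have "Im (stenzel_volume z v1 v2 v3) = 0"
    if "z \<in> sphere_q" "v1 \<in> tangent_space sphere_q z" "v2 \<in> tangent_space sphere_q z" "v3 \<in> tangent_space sphere_q z"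
    for z v1 v2 v3
  proof -
    have "stenzel_volume z v1 v2 v3 \<in> \<real>"
      unfolding stenzel_volume_def det_4 vector_4
      by (intro Reals_add Reals_diff Reals_mult zr[OF that(1)] real[OF that(2)] real[OF that(3)] real[OF that(4)])
    then show ?thesis
      by (simp add: complex_is_Real_iff)
  qed
  ultimately show ?thesis
    unfolding special_lagrangian_quadric_def submanifold3_iff
    using sphere_chart by (auto simp: sphere_q_def)
qed

lemma closed_sphere_q: "closed sphere_q"
proof -
  have "sphere_q = {z. re_vec z \<bullet> re_vec z = 1} \<inter> {z. im_vec z = 0}"
    by (auto simp: sphere_q_def quadric_iff)
  moreover have "closed \<dots>"
    by (intro closed_Int closed_Collect_eq continuous_intros continuous_on_re_vec continuous_on_im_vec)
  ultimately show ?thesis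
    by simp
qed

lemma Lq_0_decomposition: "Lq 0 = sphere_q \<union> (\<Union>\<tau>\<in>{1, -1}. \<Union>\<sigma>\<in>{1, -1}. range (sheet_map \<tau> \<sigma>))"
proof (intro equalityI subsetI)
  fix z
  assume "z \<in> Lq 0"
  then obtain w e where w: "z = cvec (cos w) (sin w) e" "norm e = 1" "Im w \<ge> 0" "Im (phase w) = 0"
    unfolding Lq_def by blast
  obtain t s where ts: "w = Complex t s"
    by (cases w)
  show "z \<in> sphere_q \<union> (\<Union>\<tau>\<in>{1, -1}. \<Union>\<sigma>\<in>{1, -1}. range (sheet_map \<tau> \<sigma>))"
  proof (cases "s = 0")
    case True
    have "z \<in> quadric"
      unfolding w(1) by (rule cvec_in_quadric[OF w(2)]) simp
    moreover have "im_vec z = 0"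
      unfolding vec_eq_iff forall_4 by (simp add: w(1) ts True cos_sin_Complex)
    ultimately show ?thesis
      by (simp add: sphere_q_def)
  next
    case False
    then have s: "s > 0"
      using w(3) by (simp add: ts)
    have "cos (2 * t) * sinh (2 * s) = 2 * s"
      using w(4) by (simp add: Im_phase ts)
    moreover have "(1 - 2 * (s\<^sup>2 * sheet_p s)) * sinh (2 * s) = 2 * s"
      using s by (intro sheet_p_double) simp
    ultimately have c2: "cos (2 * t) = 1 - 2 * (s\<^sup>2 * sheet_p s)"
      using s by (metis mult_right_cancel sinh_real_zero_iff mult_eq_0_iff less_irrefl zero_neq_numeral)
    then have "(sin t)\<^sup>2 = s\<^sup>2 * sheet_p s"
      by (simp add: cos_double_sin)
    then have "(sin t)\<^sup>2 = (s * sqrt (sheet_p s))\<^sup>2"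
      using sheet_p_pos[of s] s by (simp add: power_mult_distrib)
    then have "sin t = s * sqrt (sheet_p s) \<or> sin t = - (s * sqrt (sheet_p s))"
      by (simp only: power2_eq_iff)
    then obtain \<sigma>' where \<sigma>': "\<sigma>' \<in> {1, -1}" "sin t = \<sigma>' * (s * sqrt (sheet_p s))"
      by (elim disjE) (auto intro: that[of 1] that[of "-1"])
    have "(cos t)\<^sup>2 = (sqrt (1 - s\<^sup>2 * sheet_p s))\<^sup>2"
      using \<open>(sin t)\<^sup>2 = s\<^sup>2 * sheet_p s\<close> sheet_p_less[of s] s by (simp add: cos_squared_eq)
    then have "cos t = sqrt (1 - s\<^sup>2 * sheet_p s) \<or> cos t = - sqrt (1 - s\<^sup>2 * sheet_p s)"
      by (simp only: power2_eq_iff)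
    then obtain \<tau> where \<tau>: "\<tau> \<in> {1, -1}" "cos t = \<tau> * sqrt (1 - s\<^sup>2 * sheet_p s)"
      by (elim disjE) (auto intro: that[of 1] that[of "-1"])
    \<comment> \<open>With cos t = tau |cos t|, sin w equals tau s times \<open>sheet_B\<close> (tau
      sigma'). So one sign tau moves into y and another into the branch.\<close>
    define y where "y = (s * \<tau>) *\<^sub>R e"
    have ny: "norm y = s"
      using s \<tau>(1) w(2) by (auto simp: y_def)
    have s0: "s \<ge> 0"
      using s by simp
    have \<tau>\<tau>: "\<tau> * \<tau> = 1"
      using \<tau>(1) by auto
    have "sheet_map \<tau> (\<tau> * \<sigma>') y = z"
    proof -
      have A: "of_real \<tau> * sheet_A (\<tau> * \<sigma>') (of_real (s\<^sup>2)) = cos w"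
        unfolding ts cos_sin_Complex sheet_A_real[OF s0] \<sigma>'(2) \<tau>(2) using \<tau>(1) by (auto simp: complex_eq_iff)
      have "of_real \<tau> * (of_real s * sheet_B (\<tau> * \<sigma>') (of_real (s\<^sup>2))) = sin w"
        unfolding ts cos_sin_Complex sheet_B_real(1)[OF s0] \<sigma>'(2) \<tau>(2) using \<tau>(1) by (auto simp: complex_eq_iff)
      then have B: "sheet_B (\<tau> * \<sigma>') (of_real (s\<^sup>2)) * of_real (y $ i) = sin w * of_real (e $ i)" for i
        by (simp add: y_def mult_ac)
      show ?thesis
        unfolding sheet_map_def ny A w(1) vec_eq_iff forall_4 cvec_nth B by simp
    qed
    moreover have "\<tau> * \<sigma>' \<in> {1, -1}"
      using \<tau>(1) \<sigma>'(1) by auto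
    ultimately show ?thesis
      using \<tau>(1) by blast
  qed
next
  fix z
  assume "z \<in> sphere_q \<union> (\<Union>\<tau>\<in>{1, -1}. \<Union>\<sigma>\<in>{1, -1}. range (sheet_map \<tau> \<sigma>))"
  then show "z \<in> Lq 0"
  proof (elim UnE UN_E rangeE)
    assume z: "z \<in> sphere_q"
    define x where "x = re_vec z"
    have x: "norm x = 1" "z = complexify x"
      using sphere_qE[OF z] by (simp_all add: x_def)
    define r where "r = norm (spatial x)"
    have "(x $ 1)\<^sup>2 + r\<^sup>2 = 1"
      using x(1) unfolding r_def power2_norm_eq_inner power2_eq_square[of "x $ 1"] norm_eq_1 inner_spatial[of x x] .
    then obtain t where t: "x $ 1 = cos t" "r = sin t"
      by (rule sincos_total_2pi)
    define e where "e = (if spatial x = 0 then axis 1 1 else spatial x /\<^sub>R r)"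
    have e: "norm e = 1" "r *\<^sub>R e = spatial x"
      by (auto simp: e_def r_def)
    have "cvec (cos (of_real t)) (sin (of_real t)) e \<in> Lq 0"
      by (rule Lq_memI[OF e(1)]) (simp_all add: Im_phase)
    moreover have "cvec (cos (of_real t)) (sin (of_real t)) e = z"
    proof -
      have "r * e $ i = spatial x $ i" for i
        using e(2) by (simp add: vec_eq_iff)
      from this[of 1] this[of 2] this[of 3] show ?thesis
        unfolding vec_eq_iff forall_4 x(2)
        by (simp add: complexify_def t cos_of_real sin_of_real flip: of_real_mult)
    qed
    ultimately show ?thesis
      by simp
  qed (auto intro: sheet_map_in_Lq)
qed

section \<open>The family in the cotangent bundle\<close>

definition poles_q :: "(complex^4) set" where
  "poles_q = {cvec 1 0 0, cvec (- 1) 0 0}"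

lemma L_c_subset_cotangent: "L_c c \<subseteq> cotangent_S3"
  unfolding L_c_def SO3_def by (auto intro: cotangent_S3_block_matrix)

lemma poles_subset_cotangent: "poles \<subseteq> cotangent_S3"
  by (auto simp: poles_def cotangent_S3_def)

lemma inj_on_to_quadric: "inj_on to_quadric cotangent_S3"
  by (rule inj_on_inverseI[of _ from_quadric]) (rule from_to_quadric)

lemma to_quadric_poles: "to_quadric ` poles = poles_q"
proof -
  have "to_quadric (axis 1 1, 0) = cvec 1 0 0" "to_quadric (- axis 1 1, 0) = cvec (- 1) 0 0"
    unfolding vec_eq_iff forall_4 by (simp_all add: to_quadric_nth axis_def complex_eq_iff)
  then show ?thesis
    by (simp add: poles_def poles_q_def)
qed

lemma mem_L_c_iff: "p \<in> cotangent_S3 \<Longrightarrow> p \<in> L_c c \<longleftrightarrow> to_quadric p \<in> Lq c"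
  unfolding to_quadric_L_c[symmetric]
  by (rule inj_on_image_mem_iff[OF inj_on_to_quadric _ L_c_subset_cotangent, symmetric])

lemma mem_poles_iff: "p \<in> cotangent_S3 \<Longrightarrow> p \<in> poles \<longleftrightarrow> to_quadric p \<in> poles_q"
  unfolding to_quadric_poles[symmetric]
  by (rule inj_on_image_mem_iff[OF inj_on_to_quadric _ poles_subset_cotangent, symmetric])

lemma to_quadric_L_c_poles: "to_quadric ` (L_c c - poles) = Lq c - poles_q"
  using inj_on_image_set_diff[OF inj_on_to_quadric, of "L_c c" poles] L_c_subset_cotangent poles_subset_cotangent
  by (auto simp: to_quadric_L_c to_quadric_poles)

lemma Lq_pole: "z \<in> Lq c \<Longrightarrow> z \<in> poles_q \<longleftrightarrow> z $ 1 = 1 \<or> z $ 1 = - 1"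
  using quadric_pole_iff[of z c 1] quadric_pole_iff[of z c "-1"] by (auto simp: poles_q_def)

lemma sin_nonzero_off_poles: "cvec (cos w) (sin w) e \<notin> poles_q \<Longrightarrow> sin w \<noteq> 0"
proof
  assume "cvec (cos w) (sin w) e \<notin> poles_q" and s: "sin w = 0"
  moreover have "(cos w)\<^sup>2 = 1"
    using s sin_cos_squared_add[of w] by simp
  then have "cos w = 1 \<or> cos w = - 1"
    by (simp add: power2_eq_1_iff)
  ultimately show False
    by (auto simp: poles_q_def cvec_def)
qed

lemma open_Compl_poles_q: "open (- poles_q)"
  unfolding poles_q_def by (intro open_Compl finite_imp_closed) simp

lemma Lq_chart_off_poles:
  assumes "z \<in> Lq c - poles_q"
  shows "chart3 (Lq c - poles_q) z"
proof -
  obtain w e where w: "z = cvec (cos w) (sin w) e" "norm e = 1" "Im w \<ge> 0" "Im (phase w) = c"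
    using assms unfolding Lq_def by blast
  have "chart3 (Lq c) z"
    unfolding w(1) using assms w by (intro Lq_chart sin_nonzero_off_poles) auto
  from chart3_Int_open[OF this open_Compl_poles_q] assms show ?thesis
    by (simp add: Diff_eq)
qed

lemma special_lagrangian_Lq: "special_lagrangian_quadric \<kappa> (Lq c - poles_q)"
proof -
  have sub: "(Lq c - poles_q) \<inter> UNIV \<subseteq> Lq c"
    by blast
  have nz: "z $ 1 \<noteq> 1" "z $ 1 \<noteq> - 1" if "z \<in> Lq c - poles_q" for z
    using that Lq_pole by auto
  show ?thesis
    unfolding special_lagrangian_quadric_def submanifold3_iff
  proof (intro conjI ballI)
    show "Lq c - poles_q \<subseteq> quadric"
      using Lq_subset_quadric by blast
  qed (auto intro: Lq_chart_off_poles Lq_special_lagrangian_at[OF sub open_UNIV _ UNIV_I nz] simp del: Diff_iff)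
qed

lemma special_lagrangian_L_c_off_poles: "special_lagrangian \<kappa> (L_c c - poles)"
  unfolding special_lagrangian_def to_quadric_L_c_poles
  using L_c_subset_cotangent special_lagrangian_Lq by blast

text \<open>At a pole sin w = 0, which forces w to be real, and the phase of a real number is
  real.\<close>

lemma L_c_nonzero_no_poles:
  assumes "c \<noteq> 0"
  shows "L_c c - poles = L_c c"
proof -
  have "z \<notin> poles_q" if z: "z \<in> Lq c" for z
  proof
    assume "z \<in> poles_q"
    obtain w e where w: "z = cvec (cos w) (sin w) e" "Im (phase w) = c"
      using z unfolding Lq_def by blast
    have "(cos w)\<^sup>2 = 1"
      using \<open>z \<in> poles_q\<close> by (auto simp: w poles_q_def cvec_eq_iff)
    then have "Im w = 0"
      using sin_cos_squared_add[of w] by (intro sin_zero_imp_real) simp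
    then show False
      using w(2) assms by (simp add: Im_phase)
  qed
  then show ?thesis
    using L_c_subset_cotangent[of c] mem_L_c_iff mem_poles_iff by blast
qed

lemma L_c_nonempty: "L_c c \<noteq> {}"
proof -
  obtain s t :: real where s: "s \<ge> 0" "2 * s - cos (2 * t) * sinh (2 * s) = c"
  proof (cases "c \<ge> 0")
    case True
    then show ?thesis
      \<comment> \<open>Here cos (2 t) = 0, which leaves 2 s = c.\<close>
      by (intro that[of "c / 2" "pi / 4"]) simp_all
  next
    case False
    have "filterlim (\<lambda>s::real. sinh (2 * s) - 2 * s) at_top at_top"
      by real_asymp
    then have "\<forall>\<^sub>F s in at_top. sinh (2 * s) - 2 * s \<ge> - c"
      by (simp add: filterlim_at_top)
    then obtain s where s: "s \<ge> 1" "sinh (2 * s) - 2 * s \<ge> - c"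
      using eventually_happens'[OF _ eventually_conj[OF eventually_ge_at_top[of "1::real"]]] by fastforce
    \<comment> \<open>For negative c the equation is solved for cos (2 t): r is its required value,
      and s is large enough for r <= 1.\<close>
    define r where "r = (2 * s - c) / sinh (2 * s)"
    have r: "0 \<le> r" "r \<le> 1"
      using s False by (simp_all add: r_def)
    show ?thesis
      by (rule that[of s "arccos r / 2"]) (use s r in \<open>simp_all add: r_def\<close>)
  qed
  have "cvec (cos (Complex t s)) (sin (Complex t s)) (axis 1 1) \<in> Lq c"
    using s by (intro Lq_memI) (simp_all add: Im_phase)
  then show ?thesis
    unfolding to_quadric_L_c[symmetric] by blast
qed

lemma closed_cotangent_S3: "closed cotangent_S3"
proof -
  have "cotangent_S3 = {p. norm (fst p) = 1} \<inter> {p. fst p \<bullet> snd p = 0}"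
    by (auto simp: cotangent_S3_def)
  moreover have "closed \<dots>"
    by (intro closed_Int closed_Collect_eq continuous_intros)
  ultimately show ?thesis
    by simp
qed

section \<open>Transport from the quadric back to the cotangent bundle\<close>

definition lift_q :: "(complex^4) set \<Rightarrow> ((real^4) \<times> (real^4)) set" where
  "lift_q N = {p\<in>cotangent_S3. to_quadric p \<in> N}"

lemma to_quadric_lift_q: "N \<subseteq> quadric \<Longrightarrow> to_quadric ` lift_q N = N"
  unfolding lift_q_def using to_from_quadric by (force simp: image_iff)

lemma closed_lift_q: "closed N \<Longrightarrow> closed (lift_q N)"
proof -
  assume "closed N"
  then have "closed (to_quadric -` N)"
    using continuous_on_to_quadric by (rule closed_vimage)
  then show ?thesis
    using closed_Int[OF closed_cotangent_S3, of "to_quadric -` N"] by (simp add: lift_q_def vimage_def Collect_conj_eq)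
qed

lemma SO3_invariant_lift_q:
  assumes "\<And>A z. rotation_matrix A \<Longrightarrow> z \<in> N \<Longrightarrow> rot A z \<in> N"
  shows "SO3_invariant (lift_q N)"
  unfolding SO3_invariant_def SO3_def lift_q_def
  using assms by (auto simp: cotangent_S3_block_matrix to_quadric_block_matrix)

lemma special_lagrangian_lift_q:
  "special_lagrangian_quadric \<kappa> N \<Longrightarrow> special_lagrangian \<kappa> (lift_q N)"
  unfolding special_lagrangian_def
  by (subst to_quadric_lift_q) (auto simp: special_lagrangian_quadric_def lift_q_def)

lemma rot_sphere_q: "rotation_matrix A \<Longrightarrow> z \<in> sphere_q \<Longrightarrow> rot A z \<in> sphere_q"
proof -
  assume A: "rotation_matrix A" and z: "z \<in> sphere_q"
  have "re_vec (rot A z) = block_matrix A *v re_vec z"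
    unfolding vec_eq_iff forall_4 by (simp add: block_matrix_mult_nth matrix_vector_mult_3)
  moreover have "im_vec (rot A z) = block_matrix A *v im_vec z"
    unfolding vec_eq_iff forall_4 by (simp add: block_matrix_mult_nth matrix_vector_mult_3)
  ultimately show ?thesis
    using z block_matrix_inner[OF A] by (auto simp: sphere_q_def quadric_iff)
qed

lemma L_c_0_decomposition:
  "\<exists>\<S>. finite \<S> \<and> L_c 0 = \<Union>\<S> \<and> (\<forall>M\<in>\<S>. closed M \<and> SO3_invariant M \<and> special_lagrangian \<kappa> M)"
proof -
  define F where "F = insert sphere_q ((\<lambda>(\<tau>, \<sigma>). range (sheet_map \<tau> \<sigma>)) ` ({1, -1} \<times> {1, -1}))"
  have "L_c 0 = lift_q (Lq 0)"
    using mem_L_c_iff[of _ 0] L_c_subset_cotangent[of 0] unfolding lift_q_def by blast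
  also have "\<dots> = \<Union>(lift_q ` F)"
    unfolding Lq_0_decomposition F_def lift_q_def by auto
  finally have "L_c 0 = \<Union>(lift_q ` F)" .
  moreover have "closed N \<and> (\<forall>A z. rotation_matrix A \<longrightarrow> z \<in> N \<longrightarrow> rot A z \<in> N) \<and> special_lagrangian_quadric \<kappa> N"
    if N: "N \<in> F" for N
  proof (cases "N = sphere_q")
    case True
    then show ?thesis
      using closed_sphere_q rot_sphere_q special_lagrangian_sphere by blast
  next
    case False
    then obtain \<tau> \<sigma> where \<sigma>: "\<sigma> \<in> {1, -1}" "\<tau> \<in> {1, -1}" "N = range (sheet_map \<tau> \<sigma>)"
      using N by (auto simp: F_def)
    show ?thesis
      unfolding \<sigma>(3) using closed_sheet[OF \<sigma>(1,2)] special_lagrangian_sheet[OF \<sigma>(1,2)]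
      by (auto simp: sheet_map_rot[symmetric])
  qed
  then have "\<forall>M\<in>lift_q ` F. closed M \<and> SO3_invariant M \<and> special_lagrangian \<kappa> M"
    by (auto intro: closed_lift_q SO3_invariant_lift_q special_lagrangian_lift_q)
  moreover have "finite (lift_q ` F)"
    by (simp add: F_def)
  ultimately show ?thesis
    by blast
qed

section \<open>Invariant special Lagrangians\<close>

definition axis_rotation :: "3 \<Rightarrow> real \<Rightarrow> real^3^3" where
  "axis_rotation k t =
    (if k = 1 then vector [vector [1, 0, 0], vector [0, cos t, - sin t], vector [0, sin t, cos t]]
     else if k = 2 then vector [vector [cos t, 0, sin t], vector [0, 1, 0], vector [- sin t, 0, cos t]]
     else vector [vector [cos t, - sin t, 0], vector [sin t, cos t, 0], vector [0, 0, 1]])"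

text \<open>The velocity of \<open>axis_rotation\<close> at t = 0: the standard generators of so(3)
  acting on the last three coordinates.\<close>

definition axis_field :: "3 \<Rightarrow> complex^4 \<Rightarrow> complex^4" where
  "axis_field k z =
    (if k = 1 then vector [0, 0, - z $ 4, z $ 3]
     else if k = 2 then vector [0, z $ 4, 0, - z $ 2]
     else vector [0, - z $ 3, z $ 2, 0])"

lemma rotation_matrix_axis_rotation: "rotation_matrix (axis_rotation k t)"
proof -
  have cs: "sin t * sin t + cos t * cos t = 1" "cos t * cos t + sin t * sin t = 1"
    using sin_cos_squared_add[of t] by (simp_all add: power2_eq_square)
  show ?thesis
    using exhaust_3[of k]
    by (auto simp: rotation_matrix_def orthogonal_matrix det_3 axis_rotation_def
        matrix_matrix_mult_def transpose_def mat_def vec_eq_iff forall_3 sum_3 cs)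
qed

lemma has_vector_derivative_vec:
  fixes f :: "real \<Rightarrow> 'a::real_normed_vector^'n"
  assumes "\<And>i. ((\<lambda>t. f t $ i) has_vector_derivative v $ i) F"
  shows "(f has_vector_derivative v) F"
proof -
  have sum_axis: "(\<Sum>i\<in>UNIV. axis i (x $ i)) = x" for x :: "'a^'n"
    by (simp add: vec_eq_iff axis_def)
  have "((\<lambda>t. \<Sum>i\<in>UNIV. axis i (f t $ i)) has_vector_derivative (\<Sum>i\<in>UNIV. axis i (v $ i))) F"
    by (intro has_vector_derivative_sum bounded_linear.has_vector_derivative[OF bounded_linear_axis] assms)
  then show ?thesis
    unfolding sum_axis .
qed

lemma axis_rotation_derivative:
  "((\<lambda>t. rot (axis_rotation k t) z) has_vector_derivative axis_field k z) (at 0)"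
proof (rule has_vector_derivative_vec)
  fix i
  have of_real: "((\<lambda>t. complex_of_real (g t)) has_vector_derivative of_real D) (at 0)"
    if "(g has_real_derivative D) (at 0)" for g D
    using that by (intro bounded_linear.has_vector_derivative[OF bounded_linear_of_real])
      (simp add: has_real_derivative_iff_has_vector_derivative)
  have sc: "((\<lambda>t. complex_of_real (sin t)) has_vector_derivative 1) (at 0)"
    "((\<lambda>t. complex_of_real (cos t)) has_vector_derivative 0) (at 0)"
    using of_real[of sin 1] of_real[of cos 0] DERIV_sin[of 0] DERIV_cos[of 0] by simp_all
  have mult: "((\<lambda>t. g t * x) has_vector_derivative D * x) (at 0)"
    if "(g has_vector_derivative D) (at 0)" for g D and x :: complex
    using that by (rule bounded_linear.has_vector_derivative[OF bounded_linear_mult_left])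
  note smult = mult[OF sc(1)] mult[OF sc(2)]
  have "((\<lambda>t. of_real (sin t) * x + of_real (cos t) * y) has_vector_derivative x) (at 0)"
    "((\<lambda>t. of_real (cos t) * x + of_real (sin t) * y) has_vector_derivative y) (at 0)"
    "((\<lambda>t. of_real (cos t) * x - of_real (sin t) * y) has_vector_derivative - y) (at 0)"
    "((\<lambda>t. of_real (cos t) * y - of_real (sin t) * x) has_vector_derivative - x) (at 0)" for x y :: complex
    using has_vector_derivative_add[OF smult(1)[of x] smult(2)[of y]] has_vector_derivative_add[OF smult(2)[of x] smult(1)[of y]]
      has_vector_derivative_diff[OF smult(2)[of x] smult(1)[of y]] has_vector_derivative_diff[OF smult(2)[of y] smult(1)[of x]]
    by simp_all
  note deriv = this has_vector_derivative_const
  show "((\<lambda>t. rot (axis_rotation k t) z $ i) has_vector_derivative axis_field k z $ i) (at 0)"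
    using exhaust_3[of k] exhaust_4[of i]
    by (auto simp: axis_rotation_def axis_field_def intro!: deriv)
qed

text \<open>The generators are real skew-symmetric matrices, so each factor is purely imaginary.
  This removes the rank-one term of the Kaehler form on orbit directions.\<close>

lemma herm_axis_field:
  "herm (axis_field k z) z * cnj (herm (axis_field l z) z) \<in> \<real>"
proof -
  have "Re (herm (axis_field k z) z) = 0" for k
    using exhaust_3[of k] by (auto simp: herm_def sum_4 axis_field_def)
  then show ?thesis
    by (simp add: complex_is_Real_iff)
qed

text \<open>The nonzero ones among the last three coordinates have real ratios, so all three are one
  complex number b times a real unit vector. The equation of the quadric and surjectivity of cos
  give z_1 = cos w and b = sin w up to sign; replacing w by -w, and then (w, e) by (-w, -e), adjusts
  the signs.\<close>

lemma zero_level_form: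
  assumes z: "z \<in> quadric"
    and im: "Im (z $ 3 * cnj (z $ 2)) = 0" "Im (z $ 4 * cnj (z $ 2)) = 0" "Im (z $ 4 * cnj (z $ 3)) = 0"
  obtains w e where "norm e = 1" "Im w \<ge> 0" "z = cvec (cos w) (sin w) e"
proof -
  have im': "Im (z $ i * cnj (z $ j)) = 0" if "i \<in> {2, 3, 4}" "j \<in> {2, 3, 4}" for i j
    using that im by (auto simp: algebra_simps)
  obtain b e where be: "norm e = 1" "z = cvec (z $ 1) b e"
  proof (cases "\<exists>k\<in>{2, 3, 4}. z $ k \<noteq> 0")
    case False
    then show ?thesis
      by (intro that[of "axis 1 1" 0]) (auto simp: vec_eq_iff forall_4)
  next
    case True
    then obtain k where k: "k \<in> {2, 3, 4}" "z $ k \<noteq> 0"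
      by blast
    define r where "r j = Re (z $ j * cnj (z $ k)) / (cmod (z $ k))\<^sup>2" for j
    have r: "z $ j = z $ k * of_real (r j)" if "j \<in> {2, 3, 4}" for j
    proof -
      have "z $ j * cnj (z $ k) = of_real (Re (z $ j * cnj (z $ k)))"
        using im'[OF that k(1)] by (intro complex_eqI) simp_all
      then have "z $ k * of_real (Re (z $ j * cnj (z $ k))) = z $ j * of_real ((cmod (z $ k))\<^sup>2)"
        unfolding complex_norm_square by (metis mult.assoc mult.commute)
      then show ?thesis
        using k(2) by (simp add: r_def field_simps)
    qed
    define f where "f = (vector [r 2, r 3, r 4] :: real^3)"
    have "f \<noteq> 0"
      using k r[OF k(1)] by (auto simp: f_def vec_eq_iff forall_3)
    then have f: "norm f \<noteq> 0"
      by simp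
    show ?thesis
    proof (rule that[of "f /\<^sub>R norm f" "z $ k * of_real (norm f)"])
      show "norm (f /\<^sub>R norm f) = 1"
        using f by simp
      show "z = cvec (z $ 1) (z $ k * of_real (norm f)) (f /\<^sub>R norm f)"
        unfolding vec_eq_iff forall_4 using r[of 2] r[of 3] r[of 4] f by (simp add: f_def)
    qed
  qed
  have "(\<Sum>j\<in>UNIV. (cvec (z $ 1) b e $ j)\<^sup>2) = (z $ 1)\<^sup>2 + b\<^sup>2 * of_real (e \<bullet> e)"
    by (simp add: sum_4 inner_vec_def sum_3 power2_eq_square algebra_simps)
  then have ab: "(z $ 1)\<^sup>2 + b\<^sup>2 = 1"
    using z be by (simp add: quadric_def norm_eq_1)
  define w where "w = Arccos (z $ 1)"
  have w: "cos w = z $ 1"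
    by (simp add: w_def)
  then have "(sin w)\<^sup>2 = b\<^sup>2"
    using ab sin_cos_squared_add[of w] by (metis add.commute add_left_cancel)
  then have "b = sin w \<or> b = sin (- w)"
    by (auto simp: power2_eq_iff)
  then obtain u where u: "cos u = z $ 1" "sin u = b"
    using w by (metis cos_minus)
  show ?thesis
  proof (cases "Im u \<ge> 0")
    case True
    then show ?thesis
      using that[OF be(1), of u] be(2) u by simp
  next
    case False
    then show ?thesis
      using that[of "- e" "- u"] be u cvec_uminus[of "z $ 1" b e] by simp
  qed
qed

text \<open>Contracting the volume form with two rotation fields gives the components of - sin w v_1
  e. All three pairs occur because single coordinates of e may vanish.\<close>

lemma volume_axis_field:
  assumes e: "norm e = 1" and ab: "a\<^sup>2 + b\<^sup>2 = 1" and v: "(\<Sum>j\<in>UNIV. cvec a b e $ j * v $ j) = 0"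
  shows "stenzel_volume (cvec a b e) v (axis_field 2 (cvec a b e)) (axis_field 3 (cvec a b e)) = - b * v $ 1 * of_real (e $ 1)"
    and "stenzel_volume (cvec a b e) v (axis_field 3 (cvec a b e)) (axis_field 1 (cvec a b e)) = - b * v $ 1 * of_real (e $ 2)"
    and "stenzel_volume (cvec a b e) v (axis_field 1 (cvec a b e)) (axis_field 2 (cvec a b e)) = - b * v $ 1 * of_real (e $ 3)"
proof -
  define x y z where "x = complex_of_real (e $ 1)" and "y = complex_of_real (e $ 2)" and "z = complex_of_real (e $ 3)"
  define q where "q = v $ 2 * x + v $ 3 * y + v $ 4 * z"
  have "x * x + y * y + z * z = of_real (e \<bullet> e)"
    by (simp add: x_def y_def z_def inner_vec_def sum_3)
  then have xyz: "x * x + y * y + z * z = 1"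
    using e by (simp add: norm_eq_1)
  have q: "a * v $ 1 + b * q = 0"
    using v by (simp add: sum_4 q_def x_def y_def z_def algebra_simps)
  \<comment> \<open>The determinants expand to this left-hand side, with q the product of the last
    three coordinates of v with e. Tangency to the quadric, a v_1 + b q = 0, and a^2 + b^2 = 1
    reduce it.\<close>
  have *: "b * b * (a * q - b * v $ 1 * (x * x + y * y + z * z)) * t = - b * v $ 1 * t" for t
  proof -
    have "b * (a * q) = - a\<^sup>2 * v $ 1"
      using q by algebra
    then have "b * b * (a * q - b * v $ 1) = - b * v $ 1 * (a\<^sup>2 + b\<^sup>2)"
      by algebra
    then show ?thesis
      unfolding xyz ab by simp
  qed
  show "stenzel_volume (cvec a b e) v (axis_field 2 (cvec a b e)) (axis_field 3 (cvec a b e)) = - b * v $ 1 * of_real (e $ 1)"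
    unfolding stenzel_volume_def det_4 x_def[symmetric] *[symmetric] q_def
    by (simp add: axis_field_def x_def[symmetric] y_def[symmetric] z_def[symmetric]) (simp add: algebra_simps)
  show "stenzel_volume (cvec a b e) v (axis_field 3 (cvec a b e)) (axis_field 1 (cvec a b e)) = - b * v $ 1 * of_real (e $ 2)"
    unfolding stenzel_volume_def det_4 y_def[symmetric] *[symmetric] q_def
    by (simp add: axis_field_def x_def[symmetric] y_def[symmetric] z_def[symmetric]) (simp add: algebra_simps)
  show "stenzel_volume (cvec a b e) v (axis_field 1 (cvec a b e)) (axis_field 2 (cvec a b e)) = - b * v $ 1 * of_real (e $ 3)"
    unfolding stenzel_volume_def det_4 z_def[symmetric] *[symmetric] q_def
    by (simp add: axis_field_def x_def[symmetric] y_def[symmetric] z_def[symmetric]) (simp add: algebra_simps)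
qed

lemma axis_field_tangent:
  assumes inv: "\<And>A z. rotation_matrix A \<Longrightarrow> z \<in> N \<Longrightarrow> rot A z \<in> N" and z: "z \<in> N"
  shows "axis_field k z \<in> tangent_space N z"
proof -
  have "rot (axis_rotation k 0) z = z"
    using exhaust_3[of k] unfolding vec_eq_iff forall_4 by (auto simp: axis_rotation_def)
  moreover have "rot (axis_rotation k s) z \<in> N" for s
    by (rule inv[OF rotation_matrix_axis_rotation z])
  ultimately show ?thesis
    unfolding tangent_space_def using axis_rotation_derivative[of k z]
    by (intro CollectI exI[of _ "\<lambda>t. rot (axis_rotation k t) z"] exI[of _ 1]) simp
qed

lemma invariant_lagrangian_zero_level:
  assumes "\<kappa> > 0" and sl: "special_lagrangian_quadric \<kappa> N"
    and inv: "\<And>A z. rotation_matrix A \<Longrightarrow> z \<in> N \<Longrightarrow> rot A z \<in> N" and z: "z \<in> N"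
  obtains w e where "norm e = 1" "Im w \<ge> 0" "z = cvec (cos w) (sin w) e"
proof -
  have zq: "z \<in> quadric"
    using sl z unfolding special_lagrangian_quadric_def by blast
  obtain B where B: "\<And>v w. stenzel_form \<kappa> z v w = of_real (- 2 *
     (stenzel_u' \<kappa> ((norm z)\<^sup>2) * Im (herm v w) + B * Im (herm v z * cnj (herm w z))))"
    using stenzel_form_herm[OF zq, of \<kappa>] by blast
  have "norm z \<ge> 1"
    using zq by (rule norm_quadric_ge_1)
  then have pos: "stenzel_u' \<kappa> ((norm z)\<^sup>2) > 0"
    by (intro stenzel_u'_pos[OF assms(1)]) simp
  have "Im (herm (axis_field k z) (axis_field l z)) = 0" for k l
  proof -
    define x where "x = Im (herm (axis_field k z) (axis_field l z))"
    define y where "y = Im (herm (axis_field k z) z * cnj (herm (axis_field l z) z))"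
    have "stenzel_form \<kappa> z (axis_field k z) (axis_field l z) = 0"
      using sl z axis_field_tangent[OF inv z] unfolding special_lagrangian_quadric_def by blast
    then have "- 2 * (stenzel_u' \<kappa> ((norm z)\<^sup>2) * x + B * y) = 0"
      unfolding B x_def[symmetric] y_def[symmetric] of_real_eq_0_iff .
    moreover have "y = 0"
      using herm_axis_field unfolding y_def complex_is_Real_iff .
    ultimately have "x = 0"
      using pos by simp
    then show ?thesis
      unfolding x_def .
  qed
  \<comment> \<open>Up to sign, the three pairs of generators give the three components of the
    moment map.\<close>
  from this[of 1 2] this[of 1 3] this[of 2 3]
  have "Im (z $ 3 * cnj (z $ 2)) = 0" "Im (z $ 4 * cnj (z $ 2)) = 0" "Im (z $ 4 * cnj (z $ 3)) = 0"
    by (simp_all add: herm_def sum_4 axis_field_def)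
  then show ?thesis
    using zero_level_form[OF zq] that by blast
qed

text \<open>v_1 is - sin w dw, so the conclusion says that the differential of Im
  (\<open>phase\<close> w) vanishes on the tangent space.\<close>

lemma invariant_special_lagrangian_phase:
  assumes sl: "special_lagrangian_quadric \<kappa> N"
    and inv: "\<And>A z. rotation_matrix A \<Longrightarrow> z \<in> N \<Longrightarrow> rot A z \<in> N"
    and z: "cvec (cos w) (sin w) e \<in> N" "norm e = 1" and v: "v \<in> tangent_space N (cvec (cos w) (sin w) e)"
  shows "Im (sin w * v $ 1) = 0"
proof -
  let ?z = "cvec (cos w) (sin w) e"
  have "N \<inter> UNIV \<subseteq> quadric"
    using sl unfolding special_lagrangian_quadric_def by blast
  from quadric_tangent[OF this open_UNIV UNIV_I v] have sum: "(\<Sum>j\<in>UNIV. ?z $ j * v $ j) = 0" .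
  have one: "(cos w)\<^sup>2 + (sin w)\<^sup>2 = 1"
    by simp
  have "Im (stenzel_volume ?z v (axis_field k ?z) (axis_field l ?z)) = 0" for k l
    using sl z(1) v axis_field_tangent[OF inv z(1)] unfolding special_lagrangian_quadric_def by blast
  from this[of 2 3] this[of 3 1] this[of 1 2]
  have "Im (sin w * v $ 1) * e $ 1 = 0" "Im (sin w * v $ 1) * e $ 2 = 0" "Im (sin w * v $ 1) * e $ 3 = 0"
    unfolding volume_axis_field[OF z(2) one sum] by simp_all
  moreover have "e \<noteq> 0"
    using z(2) by auto
  ultimately show ?thesis
    by (auto simp: vec_eq_iff forall_3)
qed

lemma chart_derivative_tangent:
  assumes "smooth_on \<phi> V" "open V" "y \<in> V" "\<phi> ` V \<subseteq> N"
  shows "frechet_derivative \<phi> (at y) h \<in> tangent_space N (\<phi> y)"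
proof -
  have line: "((\<lambda>s. y + s *\<^sub>R h) has_vector_derivative h) (at 0)"
    by (auto intro!: derivative_eq_intros simp: has_vector_derivative_def)
  have "isCont (\<lambda>s. y + s *\<^sub>R h) 0"
    by (intro continuous_intros)
  then have "\<forall>\<^sub>F s in at 0. y + s *\<^sub>R h \<in> V"
    using assms(2,3) by (auto simp: isCont_def intro: topological_tendstoD)
  then have "\<forall>\<^sub>F s in nhds 0. y + s *\<^sub>R h \<in> V"
    using assms(3) by (simp add: eventually_nhds_conv_at)
  then obtain \<epsilon> where "\<epsilon> > 0" "\<And>s. dist s 0 < \<epsilon> \<Longrightarrow> y + s *\<^sub>R h \<in> V"
    unfolding eventually_nhds_metric by blast
  then have \<epsilon>: "\<epsilon> > 0" "\<And>s. \<bar>s\<bar> < \<epsilon> \<Longrightarrow> \<phi> (y + s *\<^sub>R h) \<in> N"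
    using assms(4) by (auto simp: dist_real_def)
  have D: "(\<phi> has_derivative frechet_derivative \<phi> (at y)) (at (y + 0 *\<^sub>R h))"
    using smooth_on_has_derivative[OF assms(1,3)] by simp
  have "((\<lambda>s. \<phi> (y + s *\<^sub>R h)) has_derivative (\<lambda>s. frechet_derivative \<phi> (at y) (s *\<^sub>R h))) (at 0)"
    using has_derivative_compose[OF line[unfolded has_vector_derivative_def] D] .
  then have "((\<lambda>s. \<phi> (y + s *\<^sub>R h)) has_vector_derivative frechet_derivative \<phi> (at y) h) (at 0)"
    unfolding has_vector_derivative_def
    using linear_cmul[OF has_derivative_linear[OF D]] by simp
  then show ?thesis
    unfolding tangent_space_def using \<epsilon>
    by (intro CollectI exI[of _ "\<lambda>s. \<phi> (y + s *\<^sub>R h)"] exI[of _ \<epsilon>]) simp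
qed

text \<open>In a chart of N the value of Im (\<open>phase\<close> w), computed with one fixed branch
  of w, has zero derivative and is therefore constant on a ball. The branch may differ by a sign
  from the parameter normalised by Im w >= 0, hence the absolute values in the last claim.\<close>

lemma invariant_local_structure:
  assumes \<kappa>: "\<kappa> > 0" and sl: "special_lagrangian_quadric \<kappa> N"
    and inv: "\<And>A z. rotation_matrix A \<Longrightarrow> z \<in> N \<Longrightarrow> rot A z \<in> N"
    and z0: "z0 \<in> N" "z0 \<in> Lq c" "z0 \<notin> poles_q"
  obtains U and \<phi> :: "real^3 \<Rightarrow> complex^4" and y0 r where
    "r > 0" "open U" "\<phi> ` ball y0 r = N \<inter> U" "\<phi> y0 = z0" "continuous_on (ball y0 r) \<phi>" "inj_on \<phi> (ball y0 r)"
    "\<And>z. z \<in> N \<Longrightarrow> z \<in> U \<Longrightarrow> z \<notin> poles_q"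
    "\<And>z c'. z \<in> N \<Longrightarrow> z \<in> U \<Longrightarrow> z \<in> Lq c' \<Longrightarrow> \<bar>c'\<bar> = \<bar>c\<bar>"
proof -
  obtain w0 e0 where w0: "z0 = cvec (cos w0) (sin w0) e0" "norm e0 = 1" "Im w0 \<ge> 0" "Im (phase w0) = c"
    using z0(2) unfolding Lq_def by blast
  have s0: "sin w0 \<noteq> 0"
    using z0(3) unfolding w0(1) by (rule sin_nonzero_off_poles)
  obtain B W K where B: "open B" "w0 \<in> B" "\<And>w. w \<in> B \<Longrightarrow> sin w \<noteq> 0"
    and W: "open (cos ` B)" "W holomorphic_on cos ` B" "\<And>w. w \<in> B \<Longrightarrow> W (cos w) = w"
    by (rule arccos_branch[OF s0 w0(3,4)]) (rule that)
  have "chart3 N z0"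
    using sl z0(1) unfolding special_lagrangian_quadric_def submanifold3_iff by blast
  then obtain U V and \<phi> :: "real^3 \<Rightarrow> complex^4" and \<psi> where U: "open U" "z0 \<in> U" and V: "open V" and sm: "smooth_on \<phi> V"
    and "\<forall>y\<in>V. inj (frechet_derivative \<phi> (at y))" and hom: "homeomorphism V (N \<inter> U) \<phi> \<psi>"
    unfolding chart3_def by (elim exE conjE) (rule that)
  have \<phi>V: "\<phi> ` V = N \<inter> U"
    by (rule homeomorphism_image1[OF hom])
  have cont: "continuous_on V \<phi>"
    by (rule homeomorphism_cont1[OF hom])
  define y0 where "y0 = \<psi> z0"
  have y0: "y0 \<in> V" "\<phi> y0 = z0"
    using homeomorphism_image2[OF hom] homeomorphism_apply2[OF hom] z0(1) U(2) by (auto simp: y0_def)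
  have "continuous_on V (\<lambda>y. \<phi> y $ 1)"
    by (intro continuous_intros cont)
  from continuous_open_preimage[OF this V W(1)]
  have "open (V \<inter> (\<lambda>y. \<phi> y $ 1) -` (cos ` B))" .
  moreover have "y0 \<in> V \<inter> (\<lambda>y. \<phi> y $ 1) -` (cos ` B)"
    using y0 B(2) by (simp add: w0(1))
  ultimately obtain r where r: "r > 0" "ball y0 r \<subseteq> V \<inter> (\<lambda>y. \<phi> y $ 1) -` (cos ` B)"
    by (rule openE)
  define b where "b = ball y0 r"
  have b: "b \<subseteq> V" "y0 \<in> b" "open b" "\<And>y. y \<in> b \<Longrightarrow> \<phi> y $ 1 \<in> cos ` B"
    using r by (auto simp: b_def)
  have bN: "\<phi> y \<in> N" if "y \<in> b" for y
    using \<phi>V b(1) that by blast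
  define k where "k y = Im (phase (W (\<phi> y $ 1)))" for y
  have "(k has_derivative (\<lambda>h. 0)) (at y)" if y: "y \<in> b" for y
  proof -
    obtain w where w: "w \<in> B" "\<phi> y $ 1 = cos w"
      using b(4)[OF y] by blast
    have D: "(\<phi> has_derivative frechet_derivative \<phi> (at y)) (at y)"
      using smooth_on_has_derivative[OF sm] b(1) y by blast
    obtain w' e where w': "norm e = 1" "\<phi> y = cvec (cos w') (sin w') e"
      by (rule invariant_lagrangian_zero_level[OF \<kappa> sl inv bN[OF y]])
    have "Im (sin w * frechet_derivative \<phi> (at y) h $ 1) = 0" for h
    proof -
      have "frechet_derivative \<phi> (at y) h \<in> tangent_space N (\<phi> y)"
        using \<phi>V b(1) y by (intro chart_derivative_tangent[OF sm V]) auto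
      then have "Im (sin w' * frechet_derivative \<phi> (at y) h $ 1) = 0"
        using bN[OF y] unfolding w'(2) by (intro invariant_special_lagrangian_phase[OF sl inv _ w'(1)])
      moreover have "cos w = cos w'"
        using w w' by simp
      \<comment> \<open>The branch and the normalised parameter may have opposite sines, which
        preserves the vanishing of the imaginary part.\<close>
      then have "sin w = sin w' \<or> sin w = - sin w'"
        using cos_eq_cases by blast
      ultimately show ?thesis
        by auto
    qed
    then show ?thesis
      using has_derivative_compose[OF D phase_branch_derivative[OF B(1) w(1) W w(2)]]
      by (simp add: k_def[abs_def])
  qed
  then have k: "k y = k y0" if "y \<in> b" for y
    using that b(2,3) by (intro has_derivative_zero_unique_connected[of b k]) (auto simp: b_def)
  have k0: "k y0 = c"
    using W(3)[OF B(2)] w0 by (simp add: k_def y0(2))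
  have key: "\<phi> y \<notin> poles_q \<and> (\<forall>c'. \<phi> y \<in> Lq c' \<longrightarrow> \<bar>c'\<bar> = \<bar>c\<bar>)" if y: "y \<in> b" for y
  proof -
    obtain w where w: "w \<in> B" "\<phi> y $ 1 = cos w"
      using b(4)[OF y] by blast
    have "(sin w)\<^sup>2 \<noteq> 0"
      using B(3)[OF w(1)] by simp
    then have "cos w \<noteq> 1" "cos w \<noteq> - 1"
      unfolding sin_squared_eq by auto
    then have "\<phi> y \<notin> poles_q"
      using w(2) by (auto simp: poles_q_def)
    moreover have "\<bar>c'\<bar> = \<bar>c\<bar>" if c': "\<phi> y \<in> Lq c'" for c'
    proof -
      obtain w' e where w': "\<phi> y = cvec (cos w') (sin w') e" "Im (phase w') = c'"
        using c' unfolding Lq_def by blast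
      then have "cos w = cos w'"
        using w by simp
      then have "\<bar>Im (phase w)\<bar> = \<bar>c'\<bar>"
        using cos_eq_cases w'(2) by fastforce
      moreover have "Im (phase w) = c"
        using k[OF y] k0 w W(3) by (simp add: k_def)
      ultimately show ?thesis
        by simp
    qed
    ultimately show ?thesis
      by blast
  qed
  \<comment> \<open>The ball is open in the chart domain, so its image is cut out of N by an open
    set.\<close>
  have "openin (top_of_set V) b"
    using b(1,3) by (simp add: open_subset)
  then have "openin (top_of_set (N \<inter> U)) (\<phi> ` b)"
    by (rule homeomorphism_imp_open_map[OF hom])
  then obtain T where T: "open T" "\<phi> ` b = N \<inter> U \<inter> T"
    by (auto simp: openin_open)
  show ?thesis
  proof (rule that[of r "U \<inter> T" \<phi> y0])
    show img: "\<phi> ` ball y0 r = N \<inter> (U \<inter> T)"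
      using T(2) by (simp add: b_def Int_assoc)
    show "continuous_on (ball y0 r) \<phi>"
      using continuous_on_subset[OF cont b(1)] by (simp add: b_def)
    show "inj_on \<phi> (ball y0 r)"
      using homeomorphism_apply1[OF hom] b(1) by (intro inj_on_inverseI[of _ \<psi>]) (auto simp: b_def)
    have ex: "\<exists>y\<in>b. z = \<phi> y" if "z \<in> N" "z \<in> U \<inter> T" for z
      using that T(2) by blast
    show "z \<notin> poles_q" if "z \<in> N" "z \<in> U \<inter> T" for z
      using ex[OF that] key by blast
    show "\<bar>c'\<bar> = \<bar>c\<bar>" if "z \<in> N" "z \<in> U \<inter> T" "z \<in> Lq c'" for z c'
      using ex[OF that(1,2)] key that(3) by blast
  qed (use r(1) U(1) T(1) y0(2) in auto)
qed

text \<open>The invariant form of the equation defining \<^const>\<open>L_c\<close>: \<open>cos (2 t) = 2 (cos t)\<^sup>2 - 1\<close>, and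
  \<open>cos t\<close> is the first coordinate of the base point.\<close>

definition level :: "(real^4) \<times> (real^4) \<Rightarrow> real" where
  "level p = 2 * norm (snd p) - (2 * (fst p $ 1)\<^sup>2 - 1) * sinh (2 * norm (snd p))"

lemma continuous_on_level: "continuous_on S level"
  unfolding level_def by (intro continuous_intros)

lemma level_L_c: "p \<in> L_c c \<Longrightarrow> level p = c"
  unfolding L_c_def SO3_def level_def
  by (auto simp: block_matrix_norm block_matrix_mult_nth cos_double_cos)

section \<open>From local values of the phase to components\<close>

lemma connected_countable_constant:
  fixes f :: "'a::topological_space \<Rightarrow> 'b::metric_space"
  assumes "connected S" "continuous_on S f" "countable (f ` S)" "x \<in> S" "y \<in> S"
  shows "f x = f y"
  using connected_uncountable[OF connected_continuous_image[OF assms(2,1)], of "f x" "f y"] assms(3-5) by blast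

text \<open>The poles are taken out of the openness claim because several sheets of
  \<open>L_c\<close> 0 meet there and C may contain just one of them. N is not assumed closed, so C
  can be a proper open part of a level set.\<close>

lemma component_classification:
  assumes \<kappa>: "\<kappa> > 0" and sl: "special_lagrangian \<kappa> N" and inv: "SO3_invariant N" and C: "C \<in> components N"
  shows "\<exists>c. C \<subseteq> L_c c \<and> openin (top_of_set (L_c c - poles)) (C - poles)"
proof -
  define Nq where "Nq = to_quadric ` N"
  have N: "N \<subseteq> cotangent_S3" and slq: "special_lagrangian_quadric \<kappa> Nq"
    using sl by (auto simp: special_lagrangian_def Nq_def)
  have invq: "rot A z \<in> Nq" if A: "rotation_matrix A" and z: "z \<in> Nq" for A z
  proof -
    obtain x \<xi> where x: "(x, \<xi>) \<in> N" "z = to_quadric (x, \<xi>)"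
      using z by (auto simp: Nq_def)
    have "block_matrix A \<in> SO3"
      using A by (simp add: SO3_def)
    then have "(block_matrix A *v x, block_matrix A *v \<xi>) \<in> N"
      using inv x(1) unfolding SO3_invariant_def by blast
    then show ?thesis
      unfolding x(2) to_quadric_block_matrix[OF A, symmetric] Nq_def by (rule imageI)
  qed
  have memq: "to_quadric p \<in> Nq" if "p \<in> N" for p
    using that by (simp add: Nq_def)
  have level: "p \<in> L_c (level p)" if p: "p \<in> N" for p
  proof -
    obtain w e where w: "norm e = 1" "Im w \<ge> 0" "to_quadric p = cvec (cos w) (sin w) e"
      by (rule invariant_lagrangian_zero_level[OF \<kappa> slq invq memq[OF p]])
    then have "to_quadric p \<in> Lq (Im (phase w))"
      by (simp add: Lq_memI)
    then have "p \<in> L_c (Im (phase w))"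
      using mem_L_c_iff N p by blast
    then show ?thesis
      using level_L_c by simp
  qed
  have levelq: "to_quadric p \<in> Lq (level p)" if "p \<in> N" for p
    using level[OF that] mem_L_c_iff N that by blast
  \<comment> \<open>Open sets on which the absolute value of \<open>level\<close> is constant along
    N. By Lindelof's theorem countably many of them cover N off the poles, so only countably many
    values occur there.\<close>
  define \<F> where "\<F> = {T. open T \<and> (\<exists>k. \<forall>q\<in>N \<inter> T. \<bar>level q\<bar> = k)}"
  have cover: "N - poles \<subseteq> \<Union>\<F>"
  proof
    fix p
    assume p: "p \<in> N - poles"
    then have pN: "p \<in> N" "to_quadric p \<notin> poles_q"
      using mem_poles_iff N by blast+
    obtain U and \<phi> :: "real^3 \<Rightarrow> complex^4" and y0 r where r: "r > 0" and U: "open U"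
      and \<phi>: "\<phi> ` ball y0 r = Nq \<inter> U" "\<phi> y0 = to_quadric p"
      and "continuous_on (ball y0 r) \<phi>" "inj_on \<phi> (ball y0 r)" "\<And>z. z \<in> Nq \<Longrightarrow> z \<in> U \<Longrightarrow> z \<notin> poles_q"
      and c: "\<And>z c'. z \<in> Nq \<Longrightarrow> z \<in> U \<Longrightarrow> z \<in> Lq c' \<Longrightarrow> \<bar>c'\<bar> = \<bar>level p\<bar>"
      by (rule invariant_local_structure[OF \<kappa> slq invq memq[OF pN(1)] levelq[OF pN(1)] pN(2)]) (assumption, assumption, rule that)
    have "\<phi> y0 \<in> \<phi> ` ball y0 r"
      using r by simp
    then have pU: "to_quadric p \<in> U"
      unfolding \<phi> by simp
    have "open (to_quadric -` U)"
      by (rule open_vimage[OF U continuous_on_to_quadric])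
    moreover have "\<forall>q\<in>N \<inter> to_quadric -` U. \<bar>level q\<bar> = \<bar>level p\<bar>"
    proof
      fix q
      assume "q \<in> N \<inter> to_quadric -` U"
      then show "\<bar>level q\<bar> = \<bar>level p\<bar>"
        using c[OF memq _ levelq] by simp
    qed
    ultimately have "to_quadric -` U \<in> \<F>"
      unfolding \<F>_def by (intro CollectI conjI exI)
    then show "p \<in> \<Union>\<F>"
      using pU by blast
  qed
  obtain \<F>' where \<F>': "\<F>' \<subseteq> \<F>" "countable \<F>'" "\<Union>\<F>' = \<Union>\<F>"
    by (rule Lindelof[of \<F>]) (auto simp: \<F>_def)
  have "\<forall>T\<in>\<F>'. \<exists>k. \<forall>q\<in>N \<inter> T. \<bar>level q\<bar> = k"
    using \<F>'(1) unfolding \<F>_def by blast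
  then obtain k where k: "\<And>T q. T \<in> \<F>' \<Longrightarrow> q \<in> N \<Longrightarrow> q \<in> T \<Longrightarrow> \<bar>level q\<bar> = k T"
    by (metis IntI)
  \<comment> \<open>The poles may be left uncovered, but they contribute only finitely many
    values.\<close>
  define K where "K = k ` \<F>' \<union> (\<lambda>q. \<bar>level q\<bar>) ` poles"
  have K: "countable K"
    using \<F>'(2) by (simp add: K_def poles_def)
  have abs_K: "\<bar>level q\<bar> \<in> K" if q: "q \<in> N" for q
  proof (cases "q \<in> poles")
    case False
    then have "q \<in> \<Union>\<F>'"
      using q cover unfolding \<F>'(3) by blast
    then obtain T where "T \<in> \<F>'" "q \<in> T"
      by blast
    then show ?thesis
      using k[of T q] q by (simp add: K_def)
  qed (simp add: K_def)
  have "level ` N \<subseteq> K \<union> uminus ` K"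
  proof (intro image_subsetI)
    fix q
    assume "q \<in> N"
    then show "level q \<in> K \<union> uminus ` K"
      using abs_K[of q] imageI[of "\<bar>level q\<bar>" K uminus] by (cases "level q \<ge> 0") simp_all
  qed
  then have "countable (level ` N)"
    by (rule countable_subset) (simp add: K)
  moreover have CN: "C \<subseteq> N" "connected C" "C \<noteq> {}"
    using in_components_subset[OF C] in_components_connected[OF C] in_components_nonempty[OF C] .
  ultimately have count: "countable (level ` C)"
    using countable_subset[OF image_mono[OF CN(1)], of level] by simp
  obtain p0 where p0: "p0 \<in> C"
    using CN(3) by blast
  define c where "c = level p0"
  have lc: "level p = c" if "p \<in> C" for p
    unfolding c_def by (rule connected_countable_constant[OF CN(2) continuous_on_level count that p0])
  have CL: "C \<subseteq> L_c c"
  proof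
    fix p
    assume "p \<in> C"
    then show "p \<in> L_c c"
      using level[of p] CN(1) lc[of p] by auto
  qed
  moreover have "openin (top_of_set (L_c c - poles)) (C - poles)"
  proof (subst openin_subopen, intro ballI)
    fix p
    assume p: "p \<in> C - poles"
    define z0 where "z0 = to_quadric p"
    have pN: "p \<in> N" "p \<in> L_c c" "p \<in> cotangent_S3"
      using p CN(1) CL N by blast+
    have z0: "z0 \<in> Nq" "z0 \<in> Lq c" "z0 \<notin> poles_q"
      using p pN memq mem_L_c_iff mem_poles_iff unfolding z0_def by blast+
    obtain U and \<phi> :: "real^3 \<Rightarrow> complex^4" and y0 r where
      r: "r > 0" "open U" "\<phi> ` ball y0 r = Nq \<inter> U" "\<phi> y0 = z0" "continuous_on (ball y0 r) \<phi>" "inj_on \<phi> (ball y0 r)"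
      and np: "\<And>z. z \<in> Nq \<Longrightarrow> z \<in> U \<Longrightarrow> z \<notin> poles_q"
      by (rule invariant_local_structure[OF \<kappa> slq invq z0]) (assumption, assumption, rule that)
    have "chart3 (Lq c - poles_q) z0"
      using z0 by (intro Lq_chart_off_poles) simp
    then obtain U2 V2 and \<phi>2 :: "real^3 \<Rightarrow> complex^4" and \<psi>2 where U2: "open U2" "z0 \<in> U2" and V2: "open V2"
      and "smooth_on \<phi>2 V2" "\<forall>y\<in>V2. inj (frechet_derivative \<phi>2 (at y))"
      and hom: "homeomorphism V2 ((Lq c - poles_q) \<inter> U2) \<phi>2 \<psi>2"
      unfolding chart3_def by (elim exE conjE) (rule that)
    have "open (ball y0 r \<inter> \<phi> -` U2)" "y0 \<in> ball y0 r \<inter> \<phi> -` U2"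
      using continuous_open_preimage[OF r(5) open_ball U2(1)] r(1,4) U2(2) by auto
    then obtain r2 where r2: "r2 > 0" "ball y0 r2 \<subseteq> ball y0 r \<inter> \<phi> -` U2"
      by (rule openE)
    \<comment> \<open>Shrunk so that the image A lies in the chart neighbourhood for
      \<open>Lq\<close> c; A is connected and contains z0, so its preimage in N lies in C.\<close>
    define b where "b = ball y0 r2"
    define A where "A = \<phi> ` b"
    have b: "b \<subseteq> ball y0 r" "connected b" "open b" "y0 \<in> b"
      using r2 by (auto simp: b_def)
    have A: "A \<subseteq> Nq" "A \<subseteq> U2" "A \<inter> poles_q = {}" "z0 \<in> A"
      using r2(2) r(3,4) b np unfolding A_def b_def by blast+
    have contb: "continuous_on b \<phi>" and injb: "inj_on \<phi> b"
      using continuous_on_subset[OF r(5) b(1)] inj_on_subset[OF r(6) b(1)] .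
    have "A \<subseteq> quadric"
      using A(1) slq unfolding special_lagrangian_quadric_def by blast
    then have "connected (from_quadric ` A)"
      unfolding A_def
      by (intro connected_continuous_image contb b(2) continuous_on_subset[OF continuous_on_from_quadric])
    moreover have fN: "from_quadric ` A \<subseteq> N"
      using A(1) from_to_quadric N unfolding Nq_def by force
    moreover have "p \<in> from_quadric ` A"
      using A(4) from_to_quadric[OF pN(3)] unfolding z0_def by force
    ultimately have fC: "from_quadric ` A \<subseteq> C"
      using components_maximal[OF C] p by blast
    have AL: "A \<subseteq> (Lq c - poles_q) \<inter> U2"
    proof
      fix z
      assume z: "z \<in> A"
      then have "from_quadric z \<in> L_c c"
        using fC CL by blast
      moreover have "to_quadric (from_quadric z) = z" "from_quadric z \<in> cotangent_S3"
        using to_from_quadric \<open>A \<subseteq> quadric\<close> z by blast+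
      ultimately have "z \<in> Lq c"
        using mem_L_c_iff by metis
      then show "z \<in> (Lq c - poles_q) \<inter> U2"
        using A z by blast
    qed
    have \<psi>2: "continuous_on A \<psi>2" "inj_on \<psi>2 A" "\<psi>2 ` A \<subseteq> V2" "\<phi>2 ` \<psi>2 ` A = A"
    proof -
      show "continuous_on A \<psi>2"
        by (rule continuous_on_subset[OF homeomorphism_cont2[OF hom] AL])
      show "inj_on \<psi>2 A"
        using homeomorphism_apply2[OF hom] AL by (intro inj_on_inverseI[of _ \<phi>2]) blast
      show "\<psi>2 ` A \<subseteq> V2"
        using homeomorphism_image2[OF hom] AL by blast
      show "\<phi>2 ` \<psi>2 ` A = A"
        using homeomorphism_apply2[OF hom] AL by force
    qed
    \<comment> \<open>Both charts have domains in real 3-space, so the change from the chart of N to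
      that of \<open>Lq\<close> c is open by invariance of domain; hence A is open in
      \<open>Lq\<close> c off the poles and not merely contained in it.\<close>
    have "open ((\<psi>2 \<circ> \<phi>) ` b)"
      using \<psi>2(1,2) contb injb b(3)
      by (intro invariance_of_domain continuous_on_compose comp_inj_on) (simp_all add: A_def)
    then have "open (\<psi>2 ` A)"
      by (simp add: A_def image_comp)
    then have "openin (top_of_set V2) (\<psi>2 ` A)"
      using \<psi>2(3) by (rule open_subset[rotated])
    then have "openin (top_of_set ((Lq c - poles_q) \<inter> U2)) (\<phi>2 ` \<psi>2 ` A)"
      by (rule homeomorphism_imp_open_map[OF hom])
    then obtain T where T: "open T" "A = (Lq c - poles_q) \<inter> U2 \<inter> T"
      unfolding \<psi>2(4) by (auto simp: openin_open)
    define S where "S = (L_c c - poles) \<inter> to_quadric -` (U2 \<inter> T)"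
    have "openin (top_of_set (L_c c - poles)) S"
      unfolding S_def using open_vimage[OF open_Int[OF U2(1) T(1)] continuous_on_to_quadric]
      by (rule openin_open_Int)
    moreover have "p \<in> S"
      using A(4) T(2) pN(2) p unfolding S_def z0_def by blast
    moreover have "S \<subseteq> C - poles"
    proof
      fix q
      assume q: "q \<in> S"
      then have qc: "q \<in> cotangent_S3" "q \<in> L_c c" "q \<notin> poles" "to_quadric q \<in> U2 \<inter> T"
        using L_c_subset_cotangent unfolding S_def by blast+
      then have "to_quadric q \<in> A"
        unfolding T(2) using mem_L_c_iff mem_poles_iff by blast
      then have "q \<in> C"
        using fC from_to_quadric[OF qc(1)] by force
      then show "q \<in> C - poles"
        using qc(3) by blast
    qed
    ultimately show "\<exists>S. openin (top_of_set (L_c c - poles)) S \<and> p \<in> S \<and> S \<subseteq> C - poles"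
      by blast
  qed
  ultimately show ?thesis
    by blast
qed

text \<open>For c = 0 several sheets cross at the poles, so the claim takes two forms: smoothness
  off the poles, and a finite union of closed special Lagrangians running through them. Uniqueness
  is stated for components, because different components of N may have different values of
  c.\<close>

theorem theorem6p2:
  fixes \<kappa> :: real
  assumes "\<kappa> > 0"
  shows
    "(\<forall>c. L_c c \<noteq> {} \<and> SO3_invariant (L_c c)) \<and>
     (\<forall>c. c \<noteq> 0 \<longrightarrow> special_lagrangian \<kappa> (L_c c)) \<and>
     special_lagrangian \<kappa> (L_c 0 - poles) \<and>
     (\<exists>\<S>. finite \<S> \<and> L_c 0 = \<Union>\<S> \<and>
          (\<forall>M\<in>\<S>. closed M \<and> SO3_invariant M \<and> special_lagrangian \<kappa> M)) \<and>
     (\<forall>N. special_lagrangian \<kappa> N \<and> SO3_invariant N \<longrightarrow>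
        (\<forall>C\<in>components N. \<exists>c. C \<subseteq> L_c c \<and>
           openin (top_of_set (L_c c - poles)) (C - poles)))"
proof (intro conjI allI impI ballI)
  show "special_lagrangian \<kappa> (L_c c)" if "c \<noteq> 0" for c
    using special_lagrangian_L_c_off_poles[of \<kappa> c] L_c_nonzero_no_poles[OF that] by simp
  show "\<exists>c. C \<subseteq> L_c c \<and> openin (top_of_set (L_c c - poles)) (C - poles)"
    if "special_lagrangian \<kappa> N \<and> SO3_invariant N" "C \<in> components N" for N C
    using component_classification[OF assms] that by blast
qed (rule L_c_nonempty SO3_invariant_L_c special_lagrangian_L_c_off_poles L_c_0_decomposition)+

end
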